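(* Assume $q=p$ is prime. Let $d$ be a positive integer and $\wp\in A$ a monic irreducible of degree $d$ with $\wp\neq T$. Then for every $j\in\{1,\dots,q-1\}$, $h^{q^d+j}$ is not an eigenform for $\mathcal{T}_{\wp,(q^d+j)(q+1)}$ acting on $M_{(q^d+j)(q+1),\,q^d+j}$.
   Context: $A=\mathbb{F}_q[T]$, $K=\mathbb{F}_q(T)$, $A_+$ the monic polynomials. Let $\phi$ be the Carlitz module ($\phi_T(z)=Tz+z^q$), $\tilde\pi$ a fixed period, $e_{\tilde\pi A}$ the exponential of $\tilde\pi A$, $t(z)=1/e_{\tilde\pi A}(\tilde\pi z)$, $t_a(z)=t(az)$. $M_{k,m}$ is the $K$-space of Drinfeld modular forms of weight $k$ and type $m\in\mathbb{Z}/(q-1)$ for $\mathbf{GL}_2(A)$ over $K$. $h=\sum_{a\in A_+}a^qt_a\in M_{q+1,1}$, so $h^n\in M_{n(q+1),n}$. For $\wp$ monic irreducible of degree $d$, the Hecke operator is $(\mathcal{T}_{\wp,k}f)(z)=\wp^kf(\wp z)+\sum_{\beta\in A,\deg\beta<d}f((z+\beta)/\wp)$, mapping $M_{k,m}$ to itself. An eigenform for $\mathcal{T}_{\wp,k}$ is a nonzero $f$ with $\mathcal{T}_{\wp,k}f=\lambda f$ for some scalar $\lambda$. *)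

theory Defs
  imports
    "HOL-Analysis.Analysis"
    "HOL-Computational_Algebra.Computational_Algebra"
begin

text \<open>
  Throughout, \<open>'f\<close> is the finite field with \<open>q = CARD('f)\<close> elements, \<open>'f poly\<close> is
  \<open>A = F_q[T]\<close> and \<open>'f poly fract\<close> is \<open>K = F_q(T)\<close>.  The library has no \<open>C_\<infinity>\<close> (the completion
  of an algebraic closure of \<open>K_\<infinity> = F_q((1/T))\<close>).  It is a type \<open>'c\<close> of the class below together
  with an embedding \<open>\<iota>\<close> of \<open>K\<close> satisfying the locale \<open>C_infinity\<close>; these conditions
  determine \<open>('c, \<iota>)\<close> up to isometric isomorphism over \<open>K\<close>.
\<close>

class complete_valued_field = alg_closed_field + complete_space +
  assumes dist_diff: "dist x y = dist (x - y) 0"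
    and dist_mult_zero: "dist (x * y) 0 = dist x 0 * dist y 0"
    and dist_add_zero: "dist (x + y) 0 \<le> max (dist x 0) (dist y 0)"

text \<open>
  The library reserves \<open>norm\<close> for real normed spaces, which have characteristic 0, so the
  absolute value of \<open>C_\<infinity>\<close> is recovered from the metric.
\<close>

definition absval :: "'c::complete_valued_field \<Rightarrow> real" where
  "absval x = dist x 0"

definition K_inf :: "('f::finite_field poly fract \<Rightarrow> 'c::complete_valued_field) \<Rightarrow> 'c set" where
  "K_inf \<iota> = closure (range \<iota>)"

definition algebraic_over :: "'c::field set \<Rightarrow> 'c \<Rightarrow> bool" where
  "algebraic_over S x \<longleftrightarrow> (\<exists>p. p \<noteq> 0 \<and> (\<forall>i. coeff p i \<in> S) \<and> poly p x = 0)"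

locale C_infinity =
  fixes \<iota> :: "'f::finite_field poly fract \<Rightarrow> 'c::complete_valued_field"
  assumes emb_one: "\<iota> 1 = 1"
    and emb_add: "\<iota> (x + y) = \<iota> x + \<iota> y"
    and emb_mult: "\<iota> (x * y) = \<iota> x * \<iota> y"
    and absval_emb: "a \<noteq> 0 \<Longrightarrow> absval (\<iota> (to_fract a)) = real CARD('f) ^ degree a"
    and algebraic_dense: "closure {x. algebraic_over (K_inf \<iota>) x} = UNIV"

definition emb_A :: "('f::finite_field poly fract \<Rightarrow> 'c::complete_valued_field) \<Rightarrow> 'f poly \<Rightarrow> 'c"
  where "emb_A \<iota> a = \<iota> (to_fract a)"

definition Omega :: "('f::finite_field poly fract \<Rightarrow> 'c::complete_valued_field) \<Rightarrow> 'c set" where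
  "Omega \<iota> = - K_inf \<iota>"

text \<open>
  \<open>e_\<Lambda>(z) = z \<Prod>\<^bsub>\<lambda> \<in> \<Lambda>, \<lambda> \<noteq> 0\<^esub> (1 - z / \<lambda>)\<close>, as an unordered product, in analogy with \<open>infsum\<close>.
  For a discrete \<open>\<Lambda>\<close> the finite products do converge, the metric being ultrametric.
\<close>

definition exp_lattice :: "'c::complete_valued_field set \<Rightarrow> 'c \<Rightarrow> 'c" where
  "exp_lattice \<Lambda> z = z * Lim (finite_subsets_at_top (\<Lambda> - {0})) (\<lambda>F. \<Prod>l\<in>F. (1 - z / l))"

definition period_lattice ::
  "('f::finite_field poly fract \<Rightarrow> 'c::complete_valued_field) \<Rightarrow> 'c \<Rightarrow> 'c set" where
  "period_lattice \<iota> \<pi> = range (\<lambda>a. \<pi> * emb_A \<iota> a)"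

definition carlitz_T :: "('f::finite_field poly fract \<Rightarrow> 'c::complete_valued_field) \<Rightarrow> 'c \<Rightarrow> 'c"
  where "carlitz_T \<iota> z = emb_A \<iota> [:0, 1:] * z + z ^ CARD('f)"

text \<open>
  \<open>\<pi>\<close> is a period of the Carlitz module \<open>\<phi>\<close> if \<open>\<phi>\<close> is the Drinfeld module uniformized by the
  lattice \<open>\<pi>A\<close>, that is, \<open>e_{\<pi>A}(Tz) = \<phi>_T(e_{\<pi>A}(z))\<close>.  This determines \<open>\<pi>\<close> up to a factor
  in the multiplicative group of \<open>F_q\<close>.
\<close>

definition carlitz_period ::
  "('f::finite_field poly fract \<Rightarrow> 'c::complete_valued_field) \<Rightarrow> 'c \<Rightarrow> bool" where
  "carlitz_period \<iota> \<pi> \<longleftrightarrow> \<pi> \<noteq> 0 \<and>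
     (\<forall>z. exp_lattice (period_lattice \<iota> \<pi>) (emb_A \<iota> [:0, 1:] * z) =
          carlitz_T \<iota> (exp_lattice (period_lattice \<iota> \<pi>) z))"

definition t_param ::
  "('f::finite_field poly fract \<Rightarrow> 'c::complete_valued_field) \<Rightarrow> 'c \<Rightarrow> 'c \<Rightarrow> 'c" where
  "t_param \<iota> \<pi> z = 1 / exp_lattice (period_lattice \<iota> \<pi>) (\<pi> * z)"

text \<open>
  Rigid analytic functions on \<open>\<Omega>\<close>: the sets \<open>Omega_affinoid \<iota> n\<close> form the standard admissible
  covering of \<open>\<Omega>\<close> by affinoids, with \<open>infdist z (K_inf \<iota>)\<close> the imaginary absolute value of \<open>z\<close>,
  and on each of them \<open>f\<close> has to be a uniform limit of rational functions without poles there.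
\<close>

definition Omega_affinoid ::
  "('f::finite_field poly fract \<Rightarrow> 'c::complete_valued_field) \<Rightarrow> nat \<Rightarrow> 'c set" where
  "Omega_affinoid \<iota> n =
     {z. absval z \<le> real CARD('f) ^ n \<and> infdist z (K_inf \<iota>) \<ge> 1 / real CARD('f) ^ n}"

definition rigid_holomorphic ::
  "('f::finite_field poly fract \<Rightarrow> 'c::complete_valued_field) \<Rightarrow> ('c \<Rightarrow> 'c) \<Rightarrow> bool" where
  "rigid_holomorphic \<iota> f \<longleftrightarrow>
     (\<forall>n. \<forall>\<epsilon>>0. \<exists>P Q. \<forall>z\<in>Omega_affinoid \<iota> n.
        poly Q z \<noteq> 0 \<and> absval (f z - poly P z / poly Q z) < \<epsilon>)"

text \<open>
  \<open>f(\<gamma>z) = (det \<gamma>)\<^bsup>-m\<^esup> (cz + d)\<^bsup>k\<^esup> f(z)\<close> for \<open>\<gamma> \<in> GL_2(A)\<close>.  The determinant lies in the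
  multiplicative group of \<open>F_q\<close>, so only the class of \<open>m\<close> modulo \<open>q - 1\<close> matters.
\<close>

definition modular_transformation ::
  "('f::finite_field poly fract \<Rightarrow> 'c::complete_valued_field) \<Rightarrow> nat \<Rightarrow> int \<Rightarrow> ('c \<Rightarrow> 'c) \<Rightarrow> bool"
  where
  "modular_transformation \<iota> k m f \<longleftrightarrow>
     (\<forall>\<gamma> :: 'f poly ^ 2 ^ 2. invertible \<gamma> \<longrightarrow> (\<forall>z\<in>Omega \<iota>.
        f ((emb_A \<iota> (\<gamma> $ 1 $ 1) * z + emb_A \<iota> (\<gamma> $ 1 $ 2)) /
           (emb_A \<iota> (\<gamma> $ 2 $ 1) * z + emb_A \<iota> (\<gamma> $ 2 $ 2))) =
        emb_A \<iota> (det \<gamma>) powi (- m) *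
          (emb_A \<iota> (\<gamma> $ 2 $ 1) * z + emb_A \<iota> (\<gamma> $ 2 $ 2)) ^ k * f z))"

text \<open>
  Holomorphy at the cusp with coefficients in \<open>K\<close>: \<open>f = \<Sum>\<^bsub>i \<ge> 0\<^esub> a_i t\<^bsup>i\<^esup>\<close> with \<open>a_i \<in> K\<close> wherever the
  imaginary absolute value is large.
\<close>

definition has_t_expansion_over_K ::
  "('f::finite_field poly fract \<Rightarrow> 'c::complete_valued_field) \<Rightarrow> 'c \<Rightarrow> ('c \<Rightarrow> 'c) \<Rightarrow> bool" where
  "has_t_expansion_over_K \<iota> \<pi> f \<longleftrightarrow>
     (\<exists>a :: nat \<Rightarrow> 'f poly fract. \<exists>r>0. \<forall>z. infdist z (K_inf \<iota>) \<ge> r \<longrightarrow>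
        (\<lambda>i. \<iota> (a i) * t_param \<iota> \<pi> z ^ i) sums f z)"

text \<open>
  A form on \<open>\<Omega>\<close> is given by a function on all of \<open>'c\<close>, whose values outside \<open>\<Omega>\<close> are irrelevant.
\<close>

definition drinfeld_modular_forms ::
  "('f::finite_field poly fract \<Rightarrow> 'c::complete_valued_field) \<Rightarrow> 'c \<Rightarrow> nat \<Rightarrow> int \<Rightarrow> ('c \<Rightarrow> 'c) set"
  where
  "drinfeld_modular_forms \<iota> \<pi> k m =
     {f. rigid_holomorphic \<iota> f \<and> modular_transformation \<iota> k m f \<and> has_t_expansion_over_K \<iota> \<pi> f}"

definition drinfeld_h ::
  "('f::finite_field poly fract \<Rightarrow> 'c::complete_valued_field) \<Rightarrow> 'c \<Rightarrow> 'c \<Rightarrow> 'c" where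
  "drinfeld_h \<iota> \<pi> z =
     (\<Sum>\<^sub>\<infinity>a\<in>{a. lead_coeff a = 1}. emb_A \<iota> a ^ CARD('f) * t_param \<iota> \<pi> (emb_A \<iota> a * z))"

definition hecke ::
  "('f::finite_field poly fract \<Rightarrow> 'c::complete_valued_field) \<Rightarrow> 'f poly \<Rightarrow> nat \<Rightarrow> ('c \<Rightarrow> 'c) \<Rightarrow> 'c \<Rightarrow> 'c"
  where
  "hecke \<iota> P k f z =
     emb_A \<iota> P ^ k * f (emb_A \<iota> P * z) +
     (\<Sum>\<beta>\<in>{\<beta>. degree \<beta> < degree P}. f ((z + emb_A \<iota> \<beta>) / emb_A \<iota> P))"

definition hecke_eigenform ::
  "('f::finite_field poly fract \<Rightarrow> 'c::complete_valued_field) \<Rightarrow> 'c \<Rightarrow> 'f poly \<Rightarrow> nat \<Rightarrow> int \<Rightarrow>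
   ('c \<Rightarrow> 'c) \<Rightarrow> bool" where
  "hecke_eigenform \<iota> \<pi> P k m f \<longleftrightarrow>
     f \<in> drinfeld_modular_forms \<iota> \<pi> k m \<and> (\<exists>z\<in>Omega \<iota>. f z \<noteq> 0) \<and>
     (\<exists>c. \<forall>z\<in>Omega \<iota>. hecke \<iota> P k f z = c * f z)"

end

theory Submission
  imports Defs
begin

text \<open>
  Let \<open>Q = q\<^sup>d\<close>, \<open>n = Q + j\<close> and let \<open>y = 1 / t\<close> be the Carlitz exponential at \<open>\<pi> z\<close>. Then \<open>h\<close> is a function
  \<open>H(y) = \<Sum> a\<^sup>q / \<phi>_a(y)\<close> of \<open>y\<close>, and the points \<open>(z + \<beta>) / P\<close> correspond to the \<open>Q\<close> roots of
  \<open>\<phi>_P(x) = y\<close>. As \<open>H(y) = O(1 / y)\<close>, an eigenform would satisfy \<open>\<Sum> H(x)\<^sup>n = O(y\<^bsup>-n\<^esup>)\<close>, the sum being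
  over these roots, with \<open>n > j + 1\<close>. However, the coefficient of \<open>y\<^bsup>-(j + 1)\<^esup>\<close> in the sum is \<open>j P\<^sup>j\<close>, which is
  nonzero because \<open>0 < j < q\<close> and \<open>q\<close> is prime.

  To compute this coefficient, one replaces \<open>H\<^sup>n\<close> by \<open>x\<^bsup>-Q\<^esup> H(x)\<^sup>j\<close> and uses \<open>H\<^sup>j = \<Sum> a\<^bsup>q j\<^esup> \<phi>_a\<^bsup>-j\<^esup>\<close>,
  a consequence of an identity for sums of ratios of linear functions over a projective space.
  The coefficient for the term of \<open>a\<close> is, up to the factor \<open>P a\<^bsup>q j\<^esup>\<close>, the coefficient of \<open>u\<^bsup>Q - 1\<^esup>\<close> in the
  expansion of \<open>(\<phi>_P(u) / \<phi>_a(u))\<^sup>j\<close> at infinity. Iterating the Cartier operator shows that it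
  vanishes for \<open>deg a \<ge> 1\<close>.
\<close>

section \<open>Additive polynomials and the Cartier operator\<close>

text \<open>The exponent \<open>Q + j\<close> is made for Frobenius:
  \<open>H(x) = 1/x + O(x^-q)\<close> gives \<open>H^Q = x^-Q + O(x^(-q Q))\<close>. For large
  \<open>y\<close> the roots satisfy \<open>|x|^Q = |y|\<close>, so an error of order
  \<open>Q (j + 1) + 1\<close> in \<open>1/x\<close> is negligible against
  \<open>y^-(j + 1)\<close>. Every truncation is measured against this threshold: replacing
  \<open>H^Q\<close> leaves an error of order \<open>q Q + j\<close>, dropping the \<open>a\<close>
  of degree above \<open>d\<close> one of order \<open>Q + q Q\<close>, and
  \<open>j + 1 \<le> q\<close> makes both sufficient. What remains is replaced by a polynomial in
  \<open>1/x\<close>. Its sum over the roots is exactly a polynomial in \<open>1/y\<close>, so no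
  infinite expansions have to be rearranged, and values at points of \<open>\<Omega>\<close> with
  \<open>|y|\<close> tending to infinity isolate its coefficients. Primality makes \<open>q\<close>
  the characteristic, so the exponents of \<open>\<phi>_a\<close> are powers of the characteristic
  \<open>p = q\<close>. One Cartier step then absorbs the whole \<open>j\<close>-th power of
  \<open>\<phi>_P\<close> and leaves a single additive polynomial.\<close>

definition expand_poly :: "nat \<Rightarrow> 'a::comm_ring_1 poly \<Rightarrow> 'a poly" where
  "expand_poly p g = pcompose g (monom 1 p)"

lemma expand_poly_mult: "expand_poly p (f * g) = expand_poly p f * expand_poly p g"
  by (simp add: expand_poly_def pcompose_mult)

lemma expand_poly_power: "expand_poly p (f ^ k) = expand_poly p f ^ k"
  by (induction k) (simp_all add: expand_poly_mult, simp add: expand_poly_def pcompose_1)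

lemma expand_poly_monom: "expand_poly p (monom c k) = monom c (p * k)"
proof (induction k)
  case (Suc k)
  have "monom c (Suc k) \<circ>\<^sub>p monom 1 p = monom 1 p * (monom c k \<circ>\<^sub>p monom 1 p)"
    by (subst monom_Suc) (simp add: pcompose_pCons)
  thus ?case using Suc by (simp add: expand_poly_def mult_monom)
qed (simp add: expand_poly_def monom_0)

lemma expand_poly_0: "expand_poly p 0 = 0"
  by (simp add: expand_poly_def)

lemma expand_poly_sum: "expand_poly p (sum h A) = (\<Sum>x\<in>A. expand_poly p (h x))"
  by (simp add: expand_poly_def pcompose_sum)

lemma coeff_expand_poly:
  assumes "p > 0"
  shows "coeff (expand_poly p g) m = (if p dvd m then coeff g (m div p) else 0)"
proof -
  have "expand_poly p g = (\<Sum>i\<le>degree g. monom (coeff g i) (p * i))"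
    by (subst poly_as_sum_of_monoms[of g, symmetric], subst expand_poly_sum) (simp add: expand_poly_monom)
  hence "coeff (expand_poly p g) m = (\<Sum>i\<le>degree g. if p * i = m then coeff g i else 0)"
    by (simp add: coeff_sum)
  also have "\<dots> = (if p dvd m then coeff g (m div p) else 0)"
  proof (cases "p dvd m")
    case True
    then obtain n where n: "m = p * n" by blast
    have "(\<Sum>i\<le>degree g. if p * i = m then coeff g i else 0) = (\<Sum>i\<le>degree g. if i = n then coeff g i else 0)"
      by (intro sum.cong) (use assms n in auto)
    also have "\<dots> = coeff g n"
      by (simp add: coeff_eq_0)
    finally show ?thesis using n assms by simp
  qed (auto intro!: sum.neutral)
  finally show ?thesis .
qed

text \<open>All exponents of the product are congruent to \<open>s\<close> modulo \<open>p\<close>,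
  and \<open>p - 1\<close> is the only number in \<open>0..p\<close> congruent to \<open>-1\<close>.
  The range includes \<open>p\<close> because \<open>s\<close> will count the linear terms picked
  from \<open>p\<close> factors.\<close>

lemma coeff_monom_mult_expand_poly:
  assumes "p \<ge> 2" "s \<le> p"
  shows "coeff (monom c s * expand_poly p g) (p * n + (p - 1)) = (if s = p - 1 then c * coeff g n else 0)"
proof (cases "s = p - 1")
  case True
  thus ?thesis using assms by (simp add: coeff_monom_mult coeff_expand_poly)
next
  case False
  have "coeff (expand_poly p g) (p * n + (p - 1) - s) = 0" if "s \<le> p * n + (p - 1)"
  proof -
    have "\<not> p dvd (p * n + (p - 1) - s)"
    proof (cases "s = p")
      case True
      have "n \<noteq> 0" using that assms True by (intro notI) simp
      then obtain n' where n': "n = Suc n'" by (cases n) auto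
      have "p * n + (p - 1) - s = p * n' + (p - 1)" using True n' by simp
      moreover have "\<not> p dvd (p * n' + (p - 1))"
        using assms by (metis One_nat_def Suc_pred diff_is_0_eq dvd_add_right_iff dvd_triv_left gr0I lessI nat_dvd_not_less not_less_eq_eq numeral_2_eq_2 zero_less_diff less_le_trans pos2)
      ultimately show ?thesis by simp
    next
      case sp: False
      have *: "p * n + (p - 1) - s = p * n + (p - 1 - s)" using sp assms False by simp
      have "p - 1 - s > 0" "p - 1 - s < p" using sp assms False by auto
      hence "\<not> p dvd (p - 1 - s)" by (metis nat_dvd_not_less)
      thus ?thesis unfolding * by (simp add: dvd_add_right_iff)
    qed
    thus ?thesis using assms by (simp add: coeff_expand_poly)
  qed
  thus ?thesis using False by (simp add: coeff_monom_mult)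
qed

text \<open>
  A Cartier operator: a product of \<open>p\<close> additive polynomials has nonzero coefficients at exponents
  \<open>\<equiv> -1\<close> modulo \<open>p\<close> only where exactly one factor contributes a power other than \<open>u\<close>.
\<close>

lemma coeff_additive_product:
  fixes l w :: "'a::comm_ring_1"
  assumes p: "p \<ge> 2" and j: "1 \<le> j" "j \<le> p"
    and L: "L = monom l 1 + expand_poly p M" and W: "W = monom w 1 + expand_poly p V"
  shows "coeff (L ^ j * W ^ (p - j) * expand_poly p Y) (p * n + (p - 1)) =
    coeff ((smult (of_nat j * l ^ (j - 1) * w ^ (p - j)) M +
            smult (of_nat (p - j) * l ^ j * w ^ (p - j - 1)) V) * Y) n"
proof -
  have binom: "(monom c 1 + expand_poly p G) ^ k =
      (\<Sum>a\<le>k. monom (of_nat (k choose a) * c ^ a) a * expand_poly p (G ^ (k - a)))" for c :: 'a and G k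
    by (subst binomial_ring)
       (simp add: monom_power expand_poly_power of_nat_poly smult_monom flip: smult_monom)
  define T where "T a b = coeff (M ^ (j - a) * V ^ (p - j - b) * Y) n *
      (of_nat (j choose a) * l ^ a * (of_nat (p - j choose b) * w ^ b))" for a b
  have "coeff (L ^ j * W ^ (p - j) * expand_poly p Y) (p * n + (p - 1)) =
     (\<Sum>a\<le>j. \<Sum>b\<le>p-j. coeff (monom (of_nat (j choose a) * l ^ a * (of_nat (p - j choose b) * w ^ b)) (a + b)
        * expand_poly p (M ^ (j - a) * V ^ (p - j - b) * Y)) (p * n + (p - 1)))"
  proof -
    have "monom (of_nat (j choose a) * l ^ a) a * expand_poly p (M ^ (j - a)) *
        (monom (of_nat (p - j choose b) * w ^ b) b * expand_poly p (V ^ (p - j - b))) * expand_poly p Y =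
        monom (of_nat (j choose a) * l ^ a * (of_nat (p - j choose b) * w ^ b)) (a + b)
        * expand_poly p (M ^ (j - a) * V ^ (p - j - b) * Y)" for a b
      unfolding expand_poly_mult mult_monom[symmetric] by (simp only: mult_ac)
    thus ?thesis
      unfolding L W binom sum_product by (simp only: sum_distrib_right coeff_sum)
  qed
  also have "\<dots> = (\<Sum>a\<le>j. \<Sum>b\<le>p-j. if a + b = p - 1 then T a b else 0)"
    using j p by (intro sum.cong refl, subst coeff_monom_mult_expand_poly) (auto simp: T_def)
  \<comment> \<open>As \<open>b \<le> p - j\<close>, the equation \<open>a + b = p - 1\<close>
    forces \<open>a \<ge> j - 1\<close>. The one factor that does not give its linear term is an
    \<open>L\<close> for \<open>a = j - 1\<close> and a \<open>W\<close> for
    \<open>a = j\<close>.\<close>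
  also have "\<dots> = (\<Sum>a\<in>{j-1,j}. \<Sum>b\<le>p-j. if a + b = p - 1 then T a b else 0)"
    by (rule sum.mono_neutral_right) (use j in \<open>auto intro!: sum.neutral\<close>)
  also have "\<dots> = (\<Sum>b\<le>p-j. if b = p - j then T (j-1) b else 0) + (\<Sum>b\<le>p-j. if j + b = p - 1 then T j b else 0)"
  proof -
    have "(j - 1 + b = p - 1) = (b = p - j)" for b using j by auto
    moreover have "j - 1 \<noteq> j" using j by simp
    ultimately show ?thesis by simp
  qed
  also have "(\<Sum>b\<le>p-j. if b = p - j then T (j-1) b else 0) = T (j-1) (p-j)" by simp
  also have "(\<Sum>b\<le>p-j. if j + b = p - 1 then T j b else 0) = (if j = p then 0 else T j (p-j-1))"
  proof (cases "j = p")
    case False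
    hence "(j + b = p - 1) = (b = p - j - 1)" for b using j by auto
    thus ?thesis using False by simp
  next
    case True
    hence "(j + b = p - 1) = False" for b using p by simp
    thus ?thesis using True by (simp only: if_False if_True sum.neutral_const refl)
  qed
  also have "T (j-1) (p-j) = coeff (smult (of_nat j * l ^ (j - 1) * w ^ (p - j)) M * Y) n"
    using j binomial_symmetric[of "j-1" j] by (simp add: T_def mult_ac)
  also have "(if j = p then 0 else T j (p-j-1)) = coeff (smult (of_nat (p - j) * l ^ j * w ^ (p - j - 1)) V * Y) n"
  proof (cases "j = p")
    case False
    hence "(p - j choose (p - j - 1)) = p - j" "p - j - (p - j - 1) = 1"
      using j binomial_symmetric[of "p-j-1" "p-j"] by auto
    thus ?thesis using False by (simp add: T_def mult_ac)
  qed auto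
  finally show ?thesis by (simp only: distrib_right coeff_add)
qed

text \<open>This is what allows iteration: a \<open>p\<close>-th power is a polynomial in
  \<open>u^p\<close>, so a Cartier step lets it out as the Frobenius twist of its base, which is
  again additive if the base is.\<close>

lemma poly_power_char_eq_expand:
  fixes g :: "'a::comm_ring_1 poly"
  assumes "prime p" "p = CHAR('a)"
  shows "g ^ p = expand_poly p (map_poly (\<lambda>x. x ^ p) g)"
proof (induction g)
  case 0
  thus ?case using assms by (simp add: expand_poly_0 prime_gt_0_nat zero_power)
next
  case (pCons a g)
  have p0: "p > 0" using assms prime_gt_0_nat by blast
  have "pCons a g = [:a:] + monom 1 1 * g"
    by (simp add: monom_Suc)
  hence "pCons a g ^ p = [:a:] ^ p + monom 1 p * g ^ p"
    using assms freshmans_dream[of p "[:a:]" "monom 1 1 * g"] by (simp add: power_mult_distrib monom_power)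
  also have "[:a:] ^ p = [:a ^ p:]"
    by (simp add: poly_const_pow)
  also have "[:a ^ p:] + monom 1 p * g ^ p = expand_poly p (pCons (a ^ p) (map_poly (\<lambda>x. x ^ p) g))"
    by (simp add: pCons.IH expand_poly_def pcompose_pCons)
  also have "pCons (a ^ p) (map_poly (\<lambda>x. x ^ p) g) = map_poly (\<lambda>x. x ^ p) (pCons a g)"
    using p0 by (intro poly_eqI) (simp add: coeff_map_poly coeff_pCons zero_power split: nat.splits)
  finally show ?case .
qed

text \<open>The parameter \<open>r\<close> is only an upper bound for the exponents, so that the
  class contains the linear combinations which a Cartier step produces, even when their leading
  terms cancel.\<close>

definition additive_poly :: "nat \<Rightarrow> nat \<Rightarrow> 'a::comm_ring_1 poly \<Rightarrow> bool" where
  "additive_poly p r L \<longleftrightarrow> (\<forall>n. coeff L n \<noteq> 0 \<longrightarrow> (\<exists>s\<le>r. n = p ^ s))"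

lemma additive_poly_add: "additive_poly p r L \<Longrightarrow> additive_poly p r M \<Longrightarrow> additive_poly p r (L + M)"
  unfolding additive_poly_def coeff_add by (metis add.left_neutral)

lemma additive_poly_smult: "additive_poly p r L \<Longrightarrow> additive_poly p r (smult c L)"
  unfolding additive_poly_def coeff_smult by (metis mult_zero_right)

lemma additive_poly_mono: "additive_poly p r L \<Longrightarrow> r \<le> r' \<Longrightarrow> additive_poly p r' L"
  unfolding additive_poly_def using le_trans by blast

lemma additive_poly_0: "additive_poly p r 0"
  by (simp add: additive_poly_def)

lemma additive_poly_frobenius:
  assumes "additive_poly p r L" "p > 0"
  shows "additive_poly p r (map_poly (\<lambda>x. x ^ p) L)"
  using assms unfolding additive_poly_def by (metis coeff_map_poly zero_power)

lemma degree_additive_poly_le: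
  assumes "additive_poly p r L" "p > 0"
  shows "degree L \<le> p ^ r"
proof (rule degree_le, intro allI impI)
  fix n assume "p ^ r < n"
  show "coeff L n = 0"
  proof (rule ccontr)
    assume "coeff L n \<noteq> 0"
    then obtain s where "s \<le> r" "n = p ^ s" using assms unfolding additive_poly_def by blast
    hence "n \<le> p ^ r" using assms(2) by (simp add: power_increasing)
    thus False using \<open>p ^ r < n\<close> by simp
  qed
qed

lemma additive_poly_decompose:
  assumes "additive_poly p r L" "p \<ge> 2"
  obtains M where "additive_poly p (r - 1) M" "L = monom (coeff L 1) 1 + expand_poly p M"
    "\<And>n. n > 0 \<Longrightarrow> coeff M n = coeff L (p * n)" "r = 0 \<Longrightarrow> M = 0"
proof -
  define M where "M = Poly (map (\<lambda>n. coeff L (p * n)) [0..<Suc (degree L)])"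
  have coeff_M: "coeff M n = coeff L (p * n)" for n
  proof (cases "n \<le> degree L")
    case False
    moreover from this have "p * n > degree L" using assms(2)
      by (metis le_less_trans mult_le_mono1 nat_mult_1 not_le one_le_numeral order_trans)
    ultimately show ?thesis by (simp add: M_def nth_default_def coeff_eq_0 del: upt_Suc)
  qed (simp add: M_def nth_default_def del: upt_Suc)
  have L: "L = monom (coeff L 1) 1 + expand_poly p M"
  proof (rule poly_eqI)
    fix n
    show "coeff L n = coeff (monom (coeff L 1) 1 + expand_poly p M) n"
    proof (cases "coeff L n = 0")
      case True
      thus ?thesis using assms(2) by (auto simp: coeff_expand_poly coeff_M coeff_monom_mult)
    next
      case False
      then obtain s where s: "n = p ^ s" using assms(1) unfolding additive_poly_def by blast
      show ?thesis
      proof (cases s)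
        case 0
        thus ?thesis using s assms(2) by (simp add: coeff_expand_poly)
      next
        case (Suc s')
        moreover have "n \<noteq> 1" using s Suc assms(2) by simp
        ultimately show ?thesis using s assms(2) by (simp add: coeff_expand_poly coeff_M)
      qed
    qed
  qed
  have ex: "\<exists>s. Suc s \<le> r \<and> n = p ^ s" if "coeff M n \<noteq> 0" for n
  proof -
    obtain s where s: "s \<le> r" "p * n = p ^ s"
      using \<open>coeff M n \<noteq> 0\<close> assms(1) unfolding coeff_M additive_poly_def by blast
    then show ?thesis using assms(2) by (cases s) auto
  qed
  have "additive_poly p (r - 1) M"
    unfolding additive_poly_def
  proof (intro allI impI)
    fix n assume "coeff M n \<noteq> 0"
    from ex[OF this] obtain s where "Suc s \<le> r" "n = p ^ s" by blast
    thus "\<exists>s\<le>r - 1. n = p ^ s" by (intro exI[of _ s]) auto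
  qed
  moreover have "M = 0" if "r = 0"
    using ex that by (intro poly_eqI) fastforce
  ultimately show ?thesis using L coeff_M that by blast
qed

text \<open>
  \<open>L W\<^bsup>-1\<^esup>\<close> has no term \<open>u\<^bsup>p^r - 1\<^esup>\<close> at infinity; multiplying by \<open>W\<^bsup>p^N\<^esup> \<approx> u\<^bsup>p^(i + N)\<^esup>\<close> makes this a
  statement on polynomials. The Cartier operator divides the degree of \<open>L\<close> by \<open>p\<close>, and after
  \<open>r\<close> steps it is smaller than that of \<open>W\<close>.
\<close>

lemma coeff_additive_times_power_eq_0:
  fixes L W :: "'a::field poly"
  assumes p: "prime p" "p = CHAR('a)"
    and "additive_poly p (max r (i - 1)) L" "additive_poly p i W" "i \<ge> 1" "r \<le> N"
  shows "coeff (L * W ^ (p ^ N - 1)) (p ^ (i + N) + p ^ r - 1) = 0"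
  using assms(3-)
proof (induction r arbitrary: N L W)
  case 0
  have p2: "p \<ge> 2" using p(1) prime_ge_2_nat by blast
  have "degree L \<le> p ^ (i - 1)"
    using degree_additive_poly_le[OF 0(1)] p2 by simp
  moreover have "degree (W ^ (p ^ N - 1)) \<le> p ^ i * (p ^ N - 1)"
    using degree_additive_poly_le[OF 0(2)] p2 degree_power_le[of W "p ^ N - 1"]
    by (meson le_trans mult_le_mono1 pos2 order.strict_trans2)
  ultimately have "degree (L * W ^ (p ^ N - 1)) \<le> p ^ (i - 1) + p ^ i * (p ^ N - 1)"
    by (meson add_mono degree_mult_le le_trans)
  also have "\<dots> < p ^ i + p ^ i * (p ^ N - 1)"
    using p2 \<open>i \<ge> 1\<close> by simp
  also have "\<dots> = p ^ (i + N)"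
    using p2 by (simp add: power_add algebra_simps flip: mult_Suc_right)
  finally show ?case by (simp add: coeff_eq_0)
next
  case (Suc r)
  have p2: "p \<ge> 2" using p(1) prime_ge_2_nat by blast
  obtain K where K: "N = Suc K" "r \<le> K" using Suc.prems(4) by (cases N) auto
  from additive_poly_decompose[OF Suc.prems(1) p2] obtain M where
    M: "additive_poly p (max (Suc r) (i - 1) - 1) M" "L = monom (coeff L 1) 1 + expand_poly p M" by blast
  from additive_poly_decompose[OF Suc.prems(2) p2] obtain V where
    V: "additive_poly p (i - 1) V" "W = monom (coeff W 1) 1 + expand_poly p V" by blast
  define W' where "W' = map_poly (\<lambda>x. x ^ p) W"
  define E where "E = p ^ (i + K) + p ^ r - 1"
  define L' where "L' = smult (of_nat 1 * coeff L 1 ^ (1 - 1) * coeff W 1 ^ (p - 1)) M +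
            smult (of_nat (p - 1) * coeff L 1 ^ 1 * coeff W 1 ^ (p - 1 - 1)) V"
  have W': "W ^ p = expand_poly p W'"
    unfolding W'_def by (rule poly_power_char_eq_expand) fact+
  \<comment> \<open>The \<open>p\<close> places of a Cartier step are filled by \<open>L\<close> and
    \<open>p - 1\<close> factors \<open>W\<close>; the other factors form a \<open>p\<close>-th
    power. The exponent is congruent to \<open>-1\<close> modulo \<open>p\<close>, and the step
    turns it into \<open>E\<close>, which has the same shape with \<open>N\<close> and
    \<open>r\<close> lowered by one.\<close>
  have eq1: "p ^ N - 1 = (p - 1) + p * (p ^ K - 1)"
    using p2 by (simp add: K algebra_simps diff_mult_distrib2)
  have "p * 1 \<le> p * (p ^ (i + K) + p ^ r)" using p2 by (intro mult_le_mono2) (simp add: Suc_le_eq)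
  hence eq2: "p ^ (i + N) + p ^ Suc r - 1 = p * E + (p - 1)"
    using p2 by (simp add: K E_def algebra_simps diff_mult_distrib2)
  have "L * W ^ (p ^ N - 1) = L ^ 1 * W ^ (p - 1) * expand_poly p (W' ^ (p ^ K - 1))"
    unfolding eq1 power_add by (simp add: expand_poly_power power_mult W' mult_ac)
  also have "coeff \<dots> (p ^ (i + N) + p ^ Suc r - 1) = coeff (L' * W' ^ (p ^ K - 1)) E"
    unfolding eq2 L'_def
    by (rule coeff_additive_product) (use p2 M(2) V(2) in auto)
  also have "\<dots> = 0"
    unfolding E_def
  proof (rule Suc.IH)
    \<comment> \<open>\<open>M\<close> has lost one Frobenius exponent, but \<open>V\<close> enters
      with the bound \<open>i - 1\<close>, which does not shrink. This explains the maximum in the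
      claim.\<close>
    show "additive_poly p (max r (i - 1)) L'"
      unfolding L'_def
      by (intro additive_poly_add additive_poly_smult additive_poly_mono[OF M(1)] additive_poly_mono[OF V(1)])
        auto
    show "additive_poly p i W'"
      unfolding W'_def by (rule additive_poly_frobenius) (use Suc.prems p2 in auto)
  qed (use Suc.prems K in auto)
  finally show ?case .
qed

text \<open>The first Cartier step takes \<open>j\<close> factors \<open>L\<close> and
  \<open>p - j\<close> factors \<open>W\<close>. Just one of them survives, so its result is one
  additive polynomial times a power of the twist of \<open>W\<close>, and the preceding lemma
  applies.\<close>

lemma coeff_additive_power_eq_0:
  fixes L W :: "'a::field poly"
  assumes p: "prime p" "p = CHAR('a)" and j: "1 \<le> j" "j < p"
    and L: "additive_poly p r L" "r \<ge> 1" and W: "additive_poly p i W" "i \<ge> 1" and "r \<le> N"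
  shows "coeff (L ^ j * W ^ (p ^ N - j)) (p ^ (i + N) + p ^ r - 1) = 0"
proof -
  have p2: "p \<ge> 2" using p(1) prime_ge_2_nat by blast
  obtain K R where K: "N = Suc K" "R \<le> K" "r = Suc R" using L(2) \<open>r \<le> N\<close> by (cases N; cases r) auto
  from additive_poly_decompose[OF L(1) p2] obtain M where
    M: "additive_poly p (r - 1) M" "L = monom (coeff L 1) 1 + expand_poly p M" by blast
  from additive_poly_decompose[OF W(1) p2] obtain V where
    V: "additive_poly p (i - 1) V" "W = monom (coeff W 1) 1 + expand_poly p V" by blast
  define W' where "W' = map_poly (\<lambda>x. x ^ p) W"
  define E where "E = p ^ (i + K) + p ^ R - 1"
  define L' where "L' = smult (of_nat j * coeff L 1 ^ (j - 1) * coeff W 1 ^ (p - j)) M +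
            smult (of_nat (p - j) * coeff L 1 ^ j * coeff W 1 ^ (p - j - 1)) V"
  have W': "W ^ p = expand_poly p W'"
    unfolding W'_def by (rule poly_power_char_eq_expand) fact+
  have eq1: "p ^ N - j = (p - j) + p * (p ^ K - 1)"
    using p2 j by (simp add: K algebra_simps diff_mult_distrib2)
  have "p * 1 \<le> p * (p ^ (i + K) + p ^ R)" using p2 by (intro mult_le_mono2) (simp add: Suc_le_eq)
  hence eq2: "p ^ (i + N) + p ^ r - 1 = p * E + (p - 1)"
    using p2 by (simp add: K E_def algebra_simps diff_mult_distrib2)
  have "L ^ j * W ^ (p ^ N - j) = L ^ j * W ^ (p - j) * expand_poly p (W' ^ (p ^ K - 1))"
    unfolding eq1 power_add by (simp add: expand_poly_power power_mult W' mult_ac)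
  also have "coeff \<dots> (p ^ (i + N) + p ^ r - 1) = coeff (L' * W' ^ (p ^ K - 1)) E"
    unfolding eq2 L'_def
    by (rule coeff_additive_product) (use p2 j M(2) V(2) in auto)
  also have "\<dots> = 0"
    unfolding E_def
  proof (rule coeff_additive_times_power_eq_0[OF p])
    show "additive_poly p (max R (i - 1)) L'"
      unfolding L'_def
      by (intro additive_poly_add additive_poly_smult additive_poly_mono[OF M(1)] additive_poly_mono[OF V(1)])
        (auto simp: K)
    show "additive_poly p i W'"
      unfolding W'_def by (rule additive_poly_frobenius) (use W p2 in auto)
  qed (use W K in auto)
  finally show ?thesis .
qed

text \<open>This is the case \<open>W = u\<close>, where \<open>i = 0\<close> and the comparison of
  degrees fails. Here \<open>V = 0\<close>, and after one step the power of \<open>W\<close> is a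
  monomial: the coefficient at \<open>E\<close> is that of \<open>M\<close> at \<open>p ^ R\<close>,
  the top coefficient of \<open>L\<close>.\<close>

lemma coeff_additive_power_X:
  fixes L :: "'a::field poly"
  assumes p: "prime p" "p = CHAR('a)" and j: "1 \<le> j" "j < p"
    and L: "additive_poly p r L" "r \<ge> 1" and "r \<le> N"
  shows "coeff (L ^ j * monom 1 1 ^ (p ^ N - j)) (p ^ N + p ^ r - 1) =
     of_nat j * coeff L 1 ^ (j - 1) * coeff L (p ^ r)"
proof -
  have p2: "p \<ge> 2" using p(1) prime_ge_2_nat by blast
  obtain K R where K: "N = Suc K" "R \<le> K" "r = Suc R" using L(2) \<open>r \<le> N\<close> by (cases N; cases r) auto
  from additive_poly_decompose[OF L(1) p2] obtain M where
    M: "L = monom (coeff L 1) 1 + expand_poly p M" "\<And>n. n > 0 \<Longrightarrow> coeff M n = coeff L (p * n)" by blast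
  define E where "E = p ^ K + p ^ R - 1"
  have eq1: "p ^ N - j = (p - j) + p * (p ^ K - 1)"
    using p2 j by (simp add: K algebra_simps diff_mult_distrib2)
  have "p * 1 \<le> p * (p ^ K + p ^ R)" using p2 by (intro mult_le_mono2) (simp add: Suc_le_eq)
  hence eq2: "p ^ N + p ^ r - 1 = p * E + (p - 1)"
    using p2 by (simp add: K E_def algebra_simps diff_mult_distrib2)
  have "monom 1 1 ^ (p ^ N - j) = monom (1::'a) 1 ^ (p - j) * expand_poly p (monom 1 (p ^ K - 1))"
    unfolding eq1 power_add by (simp add: expand_poly_monom monom_power)
  hence "coeff (L ^ j * monom 1 1 ^ (p ^ N - j)) (p ^ N + p ^ r - 1) =
      coeff (L ^ j * monom 1 1 ^ (p - j) * expand_poly p (monom 1 (p ^ K - 1))) (p * E + (p - 1))"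
    unfolding eq2 by (simp add: mult_ac)
  also have "\<dots> = coeff ((smult (of_nat j * coeff L 1 ^ (j - 1) * 1 ^ (p - j)) M +
            smult (of_nat (p - j) * coeff L 1 ^ j * 1 ^ (p - j - 1)) 0) * monom 1 (p ^ K - 1)) E"
    by (rule coeff_additive_product) (use p2 j M(1) in \<open>auto simp: expand_poly_0\<close>)
  also have "\<dots> = of_nat j * coeff L 1 ^ (j - 1) * coeff M (p ^ R)"
    using p2 by (simp add: E_def coeff_monom_mult mult.commute[of _ "monom 1 _"])
  finally show ?thesis using M(2)[of "p ^ R"] p2 by (simp add: K)
qed

section \<open>Power sums over roots\<close>

lemma poly_eq_prod_roots:
  fixes f :: "'a::field poly"
  assumes "finite R" "\<And>x. x \<in> R \<Longrightarrow> poly f x = 0" "degree f = card R" "lead_coeff f = 1"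
  shows "f = (\<Prod>x\<in>R. [:-x, 1:])"
proof (rule poly_eqI_degree_lead_coeff[where A = R and n = "card R"])
  have d: "degree (\<Prod>x\<in>R. [:-x, 1:]) = card R"
    by (subst degree_prod_eq_sum_degree) auto
  show "degree (\<Prod>x\<in>R. [:-x, 1:]) \<le> card R" using d by simp
  have "lead_coeff (\<Prod>x\<in>R. [:-x, 1:]) = 1"
    by (subst lead_coeff_prod) simp
  thus "coeff f (card R) = coeff (\<Prod>x\<in>R. [:-x, 1:]) (card R)"
    using assms d by simp
  show "poly f z = poly (\<Prod>x\<in>R. [:-x, 1:]) z" if "z \<in> R" for z
    using that assms(1,2) by (auto simp: poly_prod)
qed (use assms in auto)

text \<open>
  The logarithmic derivative of \<open>f - y\<close> gives \<open>\<Sum> 1 / (x - u) = c / (y - f(u))\<close>; compare coefficients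
  of powers of \<open>u\<close>.
\<close>

lemma sum_power_roots_inverse:
  fixes f :: "'a::field poly"
  assumes R: "finite R" and f: "f - [:y:] = (\<Prod>x\<in>R. [:-x, 1:])"
    and f': "pderiv f = [:c:]" and f0: "coeff f 0 = 0" and y: "y \<noteq> 0" and m: "m \<ge> 1"
  shows "(\<Sum>x\<in>R. 1 / x ^ m) = (\<Sum>k<m. c * coeff (f ^ k) (m - 1) / y ^ (k + 1))"
proof -
  define F where "F = fps_of_poly f"
  \<comment> \<open>\<open>G x\<close> is the geometric series of \<open>1 / (x - u)\<close>, so
    \<open>S\<close> generates the power sums; \<open>T\<close> is the expansion of
    \<open>1 / (y - f(u))\<close> cut off after \<open>m\<close> terms.\<close>
  define G where "G x = Abs_fps (\<lambda>n. 1 / x ^ (n + 1))" for x :: 'a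
  define S where "S = (\<Sum>x\<in>R. G x)"
  define T where "T = (\<Sum>k<m. fps_const (1 / y ^ (k + 1)) * F ^ k)"
  have nz: "x \<noteq> 0" if "x \<in> R" for x
  proof
    assume "x = 0"
    hence "poly (\<Prod>x\<in>R. [:-x, 1:]) 0 = 0"
      using that R by (auto simp: poly_prod)
    thus False using y f0 by (simp add: poly_0_coeff_0 flip: f)
  qed
  have G: "(fps_X - fps_const x) * G x = -1" if "x \<in> R" for x
  proof (rule fps_ext)
    fix n
    show "((fps_X - fps_const x) * G x) $ n = (-1 :: 'a fps) $ n"
      using nz[OF that] by (cases n) (simp_all add: G_def left_diff_distrib)
  qed
  have lin: "fps_of_poly [:-x, 1:] = fps_X - fps_const x" for x :: 'a
    by (rule fps_ext) (auto simp: coeff_pCons split: nat.splits)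
  have F: "F - fps_const y = (\<Prod>x\<in>R. fps_X - fps_const x)"
  proof -
    have "F - fps_const y = fps_of_poly (f - [:y:])"
      by (simp add: F_def fps_of_poly_diff fps_of_poly_const)
    also have "\<dots> = (\<Prod>x\<in>R. fps_X - fps_const x)"
      unfolding f fps_of_poly_prod lin ..
    finally show ?thesis .
  qed
  have "(F - fps_const y) * S = (\<Sum>x\<in>R. (F - fps_const y) * G x)"
    by (simp add: S_def sum_distrib_left)
  also have "\<dots> = (\<Sum>x\<in>R. - (\<Prod>x\<in>R - {x}. fps_X - fps_const x))"
  proof (intro sum.cong refl)
    fix x assume x: "x \<in> R"
    have "(F - fps_const y) * G x = (\<Prod>x\<in>R - {x}. fps_X - fps_const x) * ((fps_X - fps_const x) * G x)"
      unfolding F using R x by (subst prod.remove[of R x]) (auto simp: mult_ac)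
    thus "(F - fps_const y) * G x = - (\<Prod>x\<in>R - {x}. fps_X - fps_const x)"
      using G[OF x] by simp
  qed
  also have "\<dots> = - fps_of_poly (pderiv (f - [:y:]))"
    unfolding f pderiv_prod
    by (simp add: fps_of_poly_sum fps_of_poly_prod lin sum_negf pderiv_pCons)
  also have "\<dots> = - fps_const c"
    by (simp add: pderiv_diff f' fps_of_poly_const pderiv_pCons)
  finally have FS: "(fps_const y - F) * S = fps_const c"
    by (metis minus_diff_eq mult_minus_left neg_equal_iff_equal)
  have "(fps_const y - F) * T = (\<Sum>k<m. fps_const (1 / y ^ k) * F ^ k - fps_const (1 / y ^ Suc k) * F ^ Suc k)"
    unfolding T_def sum_distrib_left
  proof (intro sum.cong refl)
    fix k
    have "fps_const y * fps_const (1 / y ^ (k + 1)) = fps_const (1 / y ^ k)"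
      using y by simp
    thus "(fps_const y - F) * (fps_const (1 / y ^ (k + 1)) * F ^ k) =
        fps_const (1 / y ^ k) * F ^ k - fps_const (1 / y ^ Suc k) * F ^ Suc k"
      by (simp only: left_diff_distrib mult.assoc[symmetric]) (simp add: mult_ac)
  qed
  also have "\<dots> = 1 - fps_const (1 / y ^ m) * F ^ m"
    by (subst sum_lessThan_telescope') simp
  finally have "fps_const c * T = S * (1 - fps_const (1 / y ^ m) * F ^ m)"
    by (simp add: mult_ac flip: FS)
  hence "fps_const c * T = S - fps_const (1 / y ^ m) * (S * F ^ m)"
    by (simp add: algebra_simps)
  \<comment> \<open>The cut-off is harmless: \<open>f\<close> has no constant term, so the remainder
    is divisible by \<open>u^m\<close>.\<close>
  moreover have "(S * F ^ m) $ (m - 1) = 0"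
  proof -
    have "subdegree F \<ge> 1 \<or> F = 0"
      using f0 by (metis F_def One_nat_def Suc_leI fps_of_poly_nth nth_subdegree_nonzero not_gr_zero)
    hence "fps_X dvd F"
      using f0 by (metis F_def dvd_0_right fps_dvd_iff fps_X_neq_zero subdegree_fps_X)
    then obtain F' where "F = fps_X * F'" by blast
    hence "S * F ^ m = fps_X ^ m * (S * F' ^ m)"
      by (simp add: power_mult_distrib mult_ac)
    thus ?thesis using m by (simp only: fps_X_power_mult_nth) simp
  qed
  ultimately have "S $ (m - 1) = (fps_const c * T) $ (m - 1)"
    by simp
  also have "\<dots> = (\<Sum>k<m. c * coeff (f ^ k) (m - 1) / y ^ (k + 1))"
    by (simp add: T_def sum_distrib_left F_def fps_sum_nth flip: fps_of_poly_power) 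
  also have "S $ (m - 1) = (\<Sum>x\<in>R. 1 / x ^ m)"
    using m by (simp add: S_def fps_sum_nth G_def flip: power_Suc)
  finally show ?thesis .
qed

text \<open>By linearity in \<open>g\<close> this reduces to the single powers
  \<open>1 / x^(m - n)\<close>, whose exponents are positive because \<open>degree g < m\<close>.
  Their sums over \<open>k\<close> may all be extended to \<open>k < m\<close>, since
  \<open>f^k\<close> has no terms below \<open>u^k\<close>.\<close>

lemma sum_laurent_roots:
  fixes f g :: "'a::field poly"
  assumes R: "finite R" and f: "f - [:y:] = (\<Prod>x\<in>R. [:-x, 1:])"
    and f': "pderiv f = [:c:]" and f0: "coeff f 0 = 0" and y: "y \<noteq> 0" and m: "degree g < m"
  shows "(\<Sum>x\<in>R. poly g x / x ^ m) = (\<Sum>k<m. c * coeff (g * f ^ k) (m - 1) / y ^ (k + 1))"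
proof -
  have nz: "x \<noteq> 0" if "x \<in> R" for x
  proof
    assume "x = 0"
    hence "poly (\<Prod>x\<in>R. [:-x, 1:]) 0 = 0"
      using that R by (auto simp: poly_prod)
    thus False using y f0 by (simp add: poly_0_coeff_0 flip: f)
  qed
  have low: "coeff (f ^ k) n = 0" if "n < k" for n k
  proof -
    have "[:0, 1:] dvd f" using f0 poly_eq_0_iff_dvd[of f 0] by (simp add: poly_0_coeff_0)
    then obtain f1 where "f = [:0, 1:] * f1" by blast
    hence "f ^ k = monom 1 k * f1 ^ k" by (simp only: power_mult_distrib) (simp add: monom_altdef)
    thus ?thesis using that by (simp add: coeff_monom_mult)
  qed
  have "(\<Sum>x\<in>R. poly g x / x ^ m) = (\<Sum>x\<in>R. \<Sum>n\<le>degree g. coeff g n * (1 / x ^ (m - n)))"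
  proof (intro sum.cong refl)
    fix x assume "x \<in> R"
    have "x ^ n / x ^ m = 1 / x ^ (m - n)" if "n \<le> degree g" for n
      using nz[OF \<open>x \<in> R\<close>] m that by (simp add: power_diff field_simps)
    thus "poly g x / x ^ m = (\<Sum>n\<le>degree g. coeff g n * (1 / x ^ (m - n)))"
      by (simp add: poly_altdef sum_divide_distrib flip: times_divide_eq_right)
  qed
  also have "\<dots> = (\<Sum>n\<le>degree g. coeff g n * (\<Sum>x\<in>R. 1 / x ^ (m - n)))"
    by (subst sum.swap) (simp add: sum_distrib_left)
  also have "\<dots> = (\<Sum>n\<le>degree g. \<Sum>k<m. coeff g n * (c * coeff (f ^ k) (m - 1 - n) / y ^ (k + 1)))"
  proof (intro sum.cong refl)
    fix n assume n: "n \<in> {..degree g}"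
    have "(\<Sum>x\<in>R. 1 / x ^ (m - n)) = (\<Sum>k<m-n. c * coeff (f ^ k) (m - n - 1) / y ^ (k + 1))"
      by (rule sum_power_roots_inverse) (use assms n in auto)
    also have "\<dots> = (\<Sum>k<m. c * coeff (f ^ k) (m - 1 - n) / y ^ (k + 1))"
      by (rule sum.mono_neutral_cong_left) (use n m in \<open>auto intro!: low\<close>)
    finally show "coeff g n * (\<Sum>x\<in>R. 1 / x ^ (m - n)) = 
        (\<Sum>k<m. coeff g n * (c * coeff (f ^ k) (m - 1 - n) / y ^ (k + 1)))"
      by (simp add: sum_distrib_left)
  qed
  also have "\<dots> = (\<Sum>k<m. \<Sum>n\<le>degree g. coeff g n * (c * coeff (f ^ k) (m - 1 - n) / y ^ (k + 1)))"
    by (rule sum.swap)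
  also have "\<dots> = (\<Sum>k<m. c * coeff (g * f ^ k) (m - 1) / y ^ (k + 1))"
  proof (intro sum.cong refl)
    fix k
    have "coeff (g * f ^ k) (m - 1) = (\<Sum>n\<le>degree g. coeff g n * coeff (f ^ k) (m - 1 - n))"
      unfolding coeff_mult by (rule sum.mono_neutral_right) (use m in \<open>auto simp: coeff_eq_0\<close>)
    thus "(\<Sum>n\<le>degree g. coeff g n * (c * coeff (f ^ k) (m - 1 - n) / y ^ (k + 1))) =
        c * coeff (g * f ^ k) (m - 1) / y ^ (k + 1)"
      by (simp add: sum_distrib_left sum_divide_distrib mult_ac)
  qed
  finally show ?thesis .
qed

section \<open>Ratios of linear functions over a finite field\<close>

definition monic_below :: "nat \<Rightarrow> 'f::field poly set" where
  "monic_below N = {a. lead_coeff a = 1 \<and> degree a < N}"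

lemma monic_below_0: "monic_below 0 = {}"
  by (simp add: monic_below_def)

lemma monic_below_Suc:
  "monic_below (Suc N) = insert 1 ((\<lambda>(a, c). pCons c a) ` (monic_below N \<times> UNIV))" (is "?L = ?R")
proof
  show "?L \<subseteq> ?R"
  proof
    fix b assume b: "b \<in> ?L"
    obtain c a where bca: "b = pCons c a" by (cases b)
    show "b \<in> ?R"
    proof (cases "a = 0")
      case True
      thus ?thesis using b bca by (simp add: monic_below_def one_pCons)
    next
      case False
      hence "a \<in> monic_below N" using b bca by (simp add: monic_below_def)
      thus ?thesis using bca by force
    qed
  qed
  show "?R \<subseteq> ?L"
    by (auto simp: monic_below_def)
qed

lemma finite_monic_below: "finite (monic_below N :: 'f::{finite, field} poly set)"
  by (induction N) (auto simp: monic_below_0 monic_below_Suc)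

lemma sum_monic_below_Suc:
  fixes f :: "'f::{finite, field} poly \<Rightarrow> 'a::comm_monoid_add"
  shows "sum f (monic_below (Suc N)) = f 1 + (\<Sum>a\<in>monic_below N. \<Sum>c\<in>UNIV. f (pCons c a))"
proof -
  have "inj_on (\<lambda>(a :: 'f poly, c). pCons c a) (monic_below N \<times> UNIV)"
    by (auto simp: inj_on_def)
  moreover have "1 \<notin> (\<lambda>(a :: 'f poly, c). pCons c a) ` (monic_below N \<times> UNIV)"
    by (auto simp: one_pCons monic_below_def)
  ultimately show ?thesis
    unfolding monic_below_Suc
    by (simp add: finite_monic_below sum.reindex sum.cartesian_product case_prod_unfold)
qed

locale prime_field_emb =
  fixes \<kappa> :: "'f::finite_field \<Rightarrow> 'a::field" and q :: nat
  assumes emb1: "\<kappa> 1 = 1" and embA: "\<kappa> (x + y) = \<kappa> x + \<kappa> y" and embM: "\<kappa> (x * y) = \<kappa> x * \<kappa> y"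
    and q: "q = CARD('f)" and prime_q: "prime q"
begin

lemma q2: "q \<ge> 2"
  using prime_q prime_ge_2_nat by blast

lemma emb0: "\<kappa> 0 = 0"
  using embA[of 0 0] by (metis add_cancel_right_left add_0)

lemma embN: "\<kappa> (- x) = - \<kappa> x"
  using embA[of "-x" x] by (simp add: emb0 eq_neg_iff_add_eq_0)

lemma emb_inj: "\<kappa> x = \<kappa> y \<longleftrightarrow> x = y"
proof
  assume eq: "\<kappa> x = \<kappa> y"
  show "x = y"
  proof (rule ccontr)
    assume "x \<noteq> y"
    have "\<kappa> (x - y) = 0" using embA[of x "-y"] eq by (simp add: embN)
    moreover have "\<kappa> (x - y) * \<kappa> (inverse (x - y)) = 1"
      using \<open>x \<noteq> y\<close> by (simp add: emb1 flip: embM)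
    ultimately show False by simp
  qed
qed simp

lemma emb_of_nat: "\<kappa> (of_nat n) = of_nat n"
  by (induction n) (simp_all add: emb0 emb1 embA)

lemma emb_power: "\<kappa> (x ^ n) = \<kappa> x ^ n"
  by (induction n) (simp_all add: emb1 embM)

lemma emb_power_q: "\<kappa> x ^ q = \<kappa> x"
  using finite_field_power_card_eq_same[of x] by (simp add: q flip: emb_power)

lemma of_nat_q: "of_nat q = (0 :: 'a)"
proof -
  \<comment> \<open>Translation by 1 permutes the field, so the sum of \<open>q\<close> ones
    vanishes.\<close>
  have "(\<Sum>x\<in>UNIV. x + 1) = (\<Sum>x\<in>UNIV. x :: 'f)"
    by (rule sum.reindex_bij_witness[of _ "\<lambda>x. x - 1" "\<lambda>x. x + 1"]) auto
  hence "of_nat q = (0 :: 'f)"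
    by (simp add: sum.distrib q)
  thus ?thesis using emb_of_nat[of q] emb0 by simp
qed

lemma char_eq: "CHAR('a) = q"
proof (rule CHAR_eqI)
  fix n assume "of_nat n = (0 :: 'a)"
  show "q dvd n"
  proof (rule ccontr)
    assume "\<not> q dvd n"
    hence "coprime n q" using prime_q prime_imp_coprime[of q n] by (simp add: coprime_commute)
    then obtain a b where "a * n = b * q + 1"
      using bezout_nat[of n q] \<open>\<not> q dvd n\<close> by (metis coprime_iff_gcd_eq_1 dvd_0_right mult.commute)
    hence "of_nat (a * n) = (of_nat (b * q + 1) :: 'a)" by simp
    thus False using \<open>of_nat n = 0\<close> of_nat_q by simp
  qed
qed (rule of_nat_q)

lemma add_power_q: "(x + y :: 'a) ^ q = x ^ q + y ^ q"
  by (rule freshmans_dream) (simp_all add: prime_q char_eq)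

lemma add_power_q': "(x + y :: 'a) ^ (q ^ n) = x ^ (q ^ n) + y ^ (q ^ n)"
  by (rule freshmans_dream') (simp_all add: prime_q char_eq)

lemma diff_power_q': "(x - y :: 'a) ^ (q ^ n) = x ^ (q ^ n) - y ^ (q ^ n)"
  using add_power_q'[of "x - y" y n] by simp

lemma artin_schreier_poly: "monom 1 q - monom 1 1 - [:X ^ q - X:] = (\<Prod>c\<in>range (\<lambda>c. X + \<kappa> c). [:-c, 1:])"
proof (rule poly_eq_prod_roots)
  have "degree (monom (1::'a) q + (- monom 1 1 - [:X ^ q - X:])) = q"
  proof (subst degree_add_eq_left)
    have "degree (- monom 1 1 - [:X ^ q - X:]) \<le> 1"
      by (intro degree_diff_le) (simp_all add: degree_monom_eq)
    thus "degree (- monom 1 1 - [:X ^ q - X:]) < degree (monom (1::'a) q)"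
      using q2 by (simp add: degree_monom_eq)
  qed (simp add: degree_monom_eq)
  hence deg: "degree (monom (1::'a) q - monom 1 1 - [:X ^ q - X:]) = q"
    by (simp add: algebra_simps)
  have "inj (\<lambda>c. X + \<kappa> c)" by (auto simp: inj_def emb_inj)
  thus "degree (monom (1::'a) q - monom 1 1 - [:X ^ q - X:]) = card (range (\<lambda>c. X + \<kappa> c))"
    using deg by (simp add: card_image q)
  show "lead_coeff (monom (1::'a) q - monom 1 1 - [:X ^ q - X:]) = 1"
    using deg q2 by (simp add: coeff_pCons split: nat.splits)
  show "poly (monom 1 q - monom 1 1 - [:X ^ q - X:]) x = 0" if "x \<in> range (\<lambda>c. X + \<kappa> c)" for x
    using that by (auto simp: poly_monom add_power_q emb_power_q)
qed simp

lemma artin_schreier_nonzero: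
  assumes "\<And>c. X + \<kappa> c \<noteq> 0"
  shows "X ^ q - X \<noteq> 0"
proof
  assume "X ^ q - X = 0"
  hence "poly (monom 1 q - monom 1 1 - [:X ^ q - X:]) 0 = 0"
    using q2 by (simp add: poly_monom)
  hence "(\<Prod>c\<in>range (\<lambda>c. X + \<kappa> c). - c) = 0"
    unfolding artin_schreier_poly by (simp add: poly_prod)
  thus False using assms by auto
qed

text \<open>The translates are the roots of an Artin-Schreier polynomial with derivative
  \<open>-1\<close>, so the power sum formula applies. The exponents of \<open>(u^q - u)^i\<close>
  are \<open>i + (q - 1) r\<close> with \<open>r \<le> i\<close>; for \<open>k \<le> q\<close> such
  an exponent equals \<open>k - 1\<close> only if \<open>r = 0\<close>. Hence a single term remains
  and the power sums are themselves powers.\<close>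

lemma sum_inverse_powers_translates:
  assumes "\<And>c. X + \<kappa> c \<noteq> 0" and "k \<le> q"
  shows "(\<Sum>c\<in>UNIV. 1 / (X + \<kappa> c) ^ k) = (if k = 0 then 0 else (1 / (X - X ^ q)) ^ k)"
proof (cases "k = 0")
  case True
  thus ?thesis using of_nat_q q by simp
next
  case False
  define y where "y = X ^ q - X"
  have y: "y \<noteq> 0" unfolding y_def by (rule artin_schreier_nonzero) (rule assms(1))
  have "inj (\<lambda>c. X + \<kappa> c)" by (auto simp: inj_def emb_inj)
  hence "(\<Sum>c\<in>UNIV. 1 / (X + \<kappa> c) ^ k) = (\<Sum>x\<in>range (\<lambda>c. X + \<kappa> c). 1 / x ^ k)"
    by (simp add: sum.reindex)
  also have "\<dots> = (\<Sum>i<k. - 1 * coeff ((monom 1 q - monom 1 1) ^ i) (k - 1) / y ^ (i + 1))"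
  proof (rule sum_power_roots_inverse)
    show "monom 1 q - monom 1 1 - [:y:] = (\<Prod>c\<in>range (\<lambda>c. X + \<kappa> c). [:-c, 1:])"
      unfolding y_def by (rule artin_schreier_poly)
    show "pderiv (monom 1 q - monom 1 1) = [:- 1 :: 'a:]"
      by (simp add: pderiv_diff pderiv_monom of_nat_q monom_0)
    show "coeff (monom (1::'a) q - monom 1 1) 0 = 0" using q2 by simp
  qed (use y False in auto)
  also have "\<dots> = (\<Sum>i<k. if i = k - 1 then - ((-1) ^ (k - 1)) / y ^ k else 0)"
  proof (intro sum.cong refl)
    fix i assume i: "i \<in> {..<k}"
    have "(monom (1::'a) q - monom 1 1) ^ i = monom 1 i * (monom 1 (q - 1) - 1) ^ i"
    proof -
      have "monom (1::'a) q - monom 1 1 = monom 1 1 * (monom 1 (q - 1) - 1)"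
        using q2 by (simp add: algebra_simps mult_monom)
      thus ?thesis by (simp add: power_mult_distrib monom_power)
    qed
    hence *: "coeff ((monom (1::'a) q - monom 1 1) ^ i) (k - 1) = coeff ((monom 1 (q - 1) - 1) ^ i) (k - 1 - i)"
      using i by (simp add: coeff_monom_mult)
    also have "(monom (1::'a) (q - 1) - 1) ^ i = (\<Sum>r\<le>i. of_nat (i choose r) * monom 1 ((q - 1) * r) * (- 1) ^ (i - r))"
      using binomial_ring[of "monom (1::'a) (q-1)" "-1" i] by (simp add: monom_power mult.commute)
    also have "\<dots> = (\<Sum>r\<le>i. monom (of_nat (i choose r) * (- 1) ^ (i - r)) ((q - 1) * r))"
    proof (intro sum.cong refl)
      fix r
      have "(-1 :: 'a poly) ^ s = [:(-1) ^ s:]" for s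
        by (induction s) (auto simp: one_pCons)
      thus "of_nat (i choose r) * monom 1 ((q - 1) * r) * (- 1) ^ (i - r) =
        monom (of_nat (i choose r) * (- 1 :: 'a) ^ (i - r)) ((q - 1) * r)"
        by (simp add: of_nat_poly smult_monom mult_ac)
    qed
    also have "coeff \<dots> (k - 1 - i) = (\<Sum>r\<le>i. if r = 0 then (if i = k - 1 then (-1) ^ i else 0) else 0)"
      unfolding coeff_sum coeff_monom
    proof (intro sum.cong refl)
      fix r assume r: "r \<in> {..i}"
      have "(q - 1) * r \<noteq> k - 1 - i" if "r > 0"
      proof -
        have "i > 0" using r that by auto
        hence "k - 1 - i < q - 1" using assms(2) i by auto
        moreover have "(q - 1) * r \<ge> q - 1" using that by simp
        ultimately show ?thesis by linarith
      qed
      moreover have "0 = k - 1 - i \<longleftrightarrow> i = k - 1" using i by auto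
      ultimately show "(if (q - 1) * r = k - 1 - i then of_nat (i choose r) * (- 1) ^ (i - r) else 0) =
        (if r = 0 then (if i = k - 1 then (-1 :: 'a) ^ i else 0) else 0)"
        by (cases "r = 0") auto
    qed
    also have "\<dots> = (if i = k - 1 then (-1) ^ i else 0)" by simp
    finally have "coeff ((monom (1::'a) q - monom 1 1) ^ i) (k - 1) = (if i = k - 1 then (-1) ^ i else 0)" .
    moreover have "i + 1 = k" if "i = k - 1" using that False by simp
    ultimately show "- 1 * coeff ((monom 1 q - monom 1 1) ^ i) (k - 1) / y ^ (i + 1) =
        (if i = k - 1 then - ((-1) ^ (k - 1)) / y ^ k else 0)"
      by (cases "i = k - 1") simp_all
  qed
  also have "\<dots> = - ((-1) ^ (k - 1)) / y ^ k"
    using False by simp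
  also have "\<dots> = (- 1 / y) ^ k"
  proof -
    have "- ((-1) ^ (k - 1)) = (- 1 :: 'a) ^ k" using False by (cases k) simp_all
    thus ?thesis by (simp only: power_divide)
  qed
  also have "- 1 / y = 1 / (X - X ^ q)"
    unfolding y_def by (metis divide_minus_left minus_diff_eq minus_divide_right)
  finally show ?thesis using False by simp
qed

text \<open>As a function of the parameter the ratio is \<open>r + D / (X + \<kappa> c)\<close>. In
  its binomial expansion the sum over \<open>c\<close> of \<open>(X + \<kappa> c)^-k\<close> is
  \<open>g^k\<close> for \<open>k > 0\<close>, but 0 for \<open>k = 0\<close>; this gives
  \<open>(D g + r)^j\<close> without the term \<open>r^j\<close>. Both the numerator and the
  denominator of \<open>D g + r\<close> are linear over the finite field in the pair
  \<open>(A2, B2)\<close>, as the induction over dimensions requires.\<close>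

lemma sum_line_powers:
  assumes B1: "B1 \<noteq> 0" and B2: "\<And>c. B2 + \<kappa> c * B1 \<noteq> 0" and j: "1 \<le> j" "j \<le> q"
  shows "(\<Sum>c\<in>UNIV. ((A2 + \<kappa> c * A1) / (B2 + \<kappa> c * B1)) ^ j) =
    ((A1 * B2 ^ q - A2 * B1 ^ q) / (B1 * B2 ^ q - B2 * B1 ^ q)) ^ j - (A1 / B1) ^ j"
proof -
  define X where "X = B2 / B1"
  define r where "r = A1 / B1"
  define D where "D = (A2 - r * B2) / B1"
  define g where "g = 1 / (X - X ^ q)"
  have X: "X + \<kappa> c \<noteq> 0" for c
    using B2[of c] B1 by (auto simp: X_def field_simps)
  have "X - X ^ q \<noteq> 0" using artin_schreier_nonzero[OF X] by simp
  have "(A2 + \<kappa> c * A1) / (B2 + \<kappa> c * B1) = D * (1 / (X + \<kappa> c)) + r" for c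
  proof -
    have "B2 + \<kappa> c * B1 = B1 * (X + \<kappa> c)" using B1 by (simp add: X_def field_simps)
    moreover have "A2 + \<kappa> c * A1 = B1 * (D + r * (X + \<kappa> c))"
      using B1 by (simp add: X_def r_def D_def field_simps)
    ultimately show ?thesis using B1 X[of c] by (simp add: add_divide_distrib)
  qed
  hence "(\<Sum>c\<in>UNIV. ((A2 + \<kappa> c * A1) / (B2 + \<kappa> c * B1)) ^ j) = 
      (\<Sum>c\<in>UNIV. \<Sum>k\<le>j. of_nat (j choose k) * (D * (1 / (X + \<kappa> c))) ^ k * r ^ (j - k))"
    by (simp only: binomial_ring)
  also have "\<dots> = (\<Sum>k\<le>j. of_nat (j choose k) * D ^ k * r ^ (j - k) * (\<Sum>c\<in>UNIV. 1 / (X + \<kappa> c) ^ k))"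
    by (subst sum.swap) (simp add: sum_distrib_left power_mult_distrib power_divide mult_ac)
  also have "\<dots> = (\<Sum>k\<le>j. of_nat (j choose k) * (D * g) ^ k * r ^ (j - k) - (if k = 0 then r ^ j else 0))"
  proof (intro sum.cong refl)
    fix k assume "k \<in> {..j}"
    hence "k \<le> q" using j by simp
    from sum_inverse_powers_translates[of X, OF X this]
    show "of_nat (j choose k) * D ^ k * r ^ (j - k) * (\<Sum>c\<in>UNIV. 1 / (X + \<kappa> c) ^ k) =
        of_nat (j choose k) * (D * g) ^ k * r ^ (j - k) - (if k = 0 then r ^ j else 0)"
      by (cases "k = 0") (simp_all add: g_def power_mult_distrib mult_ac del: power_divide times_divide_eq_right)
  qed
  also have "\<dots> = (D * g + r) ^ j - r ^ j"
    by (simp add: sum_subtractf binomial_ring)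
  also have "D * g + r = (A1 * B2 ^ q - A2 * B1 ^ q) / (B1 * B2 ^ q - B2 * B1 ^ q)"
  proof -
    have den: "B1 * B2 ^ q - B2 * B1 ^ q = - (B1 ^ (q + 1) * (X - X ^ q))"
      using B1 by (simp add: X_def power_divide field_simps)
    hence den0: "B1 * B2 ^ q - B2 * B1 ^ q \<noteq> 0"
      using B1 \<open>X - X ^ q \<noteq> 0\<close> by simp
    have "(D * g + r) * (B1 * B2 ^ q - B2 * B1 ^ q) = - (B1 ^ (q + 1)) * D + r * (B1 * B2 ^ q - B2 * B1 ^ q)"
      using \<open>X - X ^ q \<noteq> 0\<close> unfolding distrib_right by (simp add: den g_def)
    also have "\<dots> = A1 * B2 ^ q - A2 * B1 ^ q"
      using B1 by (simp add: D_def r_def field_simps)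
    finally show ?thesis using den0 by (simp add: nonzero_eq_divide_eq)
  qed
  finally show ?thesis by (simp add: r_def)
qed

text \<open>
  The monic polynomials are the points of a projective space; apart from \<open>1\<close> they are partitioned
  by the lines \<open>{a T + c | c}\<close> through \<open>1\<close>. On each line the sum of the \<open>j\<close>-th powers is again
  a \<open>j\<close>-th power, of a ratio of linear functions of \<open>a\<close>.
\<close>

lemma sum_linear_ratio_power:
  fixes \<alpha> \<beta> :: "'f poly \<Rightarrow> 'a"
  assumes "\<And>x y. \<alpha> (x + y) = \<alpha> x + \<alpha> y" "\<And>c x. \<alpha> (smult c x) = \<kappa> c * \<alpha> x"
    and "\<And>x y. \<beta> (x + y) = \<beta> x + \<beta> y" "\<And>c x. \<beta> (smult c x) = \<kappa> c * \<beta> x"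
    and "\<And>x. x \<noteq> 0 \<Longrightarrow> degree x < N \<Longrightarrow> \<beta> x \<noteq> 0" and j: "1 \<le> j" "j \<le> q"
  shows "(\<Sum>a\<in>monic_below N. \<alpha> a / \<beta> a) ^ j = (\<Sum>a\<in>monic_below N. (\<alpha> a / \<beta> a) ^ j)"
  using assms(1-5)
proof (induction N arbitrary: \<alpha> \<beta>)
  case 0
  thus ?case using j by (simp add: monic_below_0 zero_power)
next
  case (Suc N)
  show ?case
  proof (cases N)
    case 0
    thus ?thesis by (simp add: sum_monic_below_Suc monic_below_0)
  next
    case (Suc N')
    define A where "A a = \<alpha> 1 * \<beta> (pCons 0 a) ^ q - \<alpha> (pCons 0 a) * \<beta> 1 ^ q" for a
    define B where "B a = \<beta> 1 * \<beta> (pCons 0 a) ^ q - \<beta> (pCons 0 a) * \<beta> 1 ^ q" for a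
    have pc: "pCons c a = pCons 0 a + smult c 1" for c and a :: "'f poly"
      by (simp add: one_pCons)
    have \<alpha>_pc: "\<alpha> (pCons c a) = \<alpha> (pCons 0 a) + \<kappa> c * \<alpha> 1" for c a
      by (subst pc) (simp only: Suc.prems)
    have \<beta>_pc: "\<beta> (pCons c a) = \<beta> (pCons 0 a) + \<kappa> c * \<beta> 1" for c a
      by (subst pc) (simp only: Suc.prems)
    have b1: "\<beta> 1 \<noteq> 0" by (rule Suc.prems(5)) auto
    have bc: "\<beta> (pCons 0 a) + \<kappa> c * \<beta> 1 \<noteq> 0" if "a \<noteq> 0" "degree a < N" for c a
      using Suc.prems(5)[of "pCons c a"] that by (simp add: \<beta>_pc[of c])
    have line: "(\<Sum>c\<in>UNIV. (\<alpha> (pCons c a) / \<beta> (pCons c a)) ^ i) = (A a / B a) ^ i - (\<alpha> 1 / \<beta> 1) ^ i"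
      if "a \<in> monic_below N" "1 \<le> i" "i \<le> q" for a i
    proof -
      have "a \<noteq> 0" "degree a < N" using that by (auto simp: monic_below_def)
      note sum_line_powers[OF b1 bc[OF this] that(2,3), of "\<alpha> (pCons 0 a)" "\<alpha> 1", folded A_def B_def]
      moreover have "\<alpha> (pCons c a) / \<beta> (pCons c a) =
          (\<alpha> (pCons 0 a) + \<kappa> c * \<alpha> 1) / (\<beta> (pCons 0 a) + \<kappa> c * \<beta> 1)" for c
        by (simp only: \<alpha>_pc[of c a] \<beta>_pc[of c a])
      ultimately show ?thesis by (simp only:)
    qed
    \<comment> \<open>The number of points of a projective space is 1 modulo \<open>q\<close>. Hence
      the corrections \<open>- (\<alpha> 1 / \<beta> 1) ^ i\<close> of all lines together cancel the
      term of the point \<open>1\<close> in \<open>total\<close>.\<close>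
    have card: "of_nat (card (monic_below (Suc M) :: 'f poly set)) = (1 :: 'a)" for M
      using sum_monic_below_Suc[of "\<lambda>_ :: 'f poly. 1 :: 'a" M] of_nat_q q by simp
    have total: "(\<Sum>a\<in>monic_below (Suc N). (\<alpha> a / \<beta> a) ^ i) = (\<Sum>a\<in>monic_below N. (A a / B a) ^ i)"
      if i: "1 \<le> i" "i \<le> q" for i
    proof -
      have "(\<Sum>a\<in>monic_below (Suc N). (\<alpha> a / \<beta> a) ^ i) =
          (\<alpha> 1 / \<beta> 1) ^ i + (\<Sum>a\<in>monic_below N. (A a / B a) ^ i - (\<alpha> 1 / \<beta> 1) ^ i)"
        unfolding sum_monic_below_Suc using line[OF _ i] by (simp only: cong: sum.cong)
      thus ?thesis
        using card[of N'] unfolding sum_subtractf sum_constant Suc by simp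
    qed
    \<comment> \<open>\<open>total\<close> is used for \<open>i = 1\<close> here and for
      \<open>i = j\<close> at the end: in both cases the same \<open>A\<close> and \<open>B\<close>
      appear, so the induction hypothesis connects the two.\<close>
    have "(\<Sum>a\<in>monic_below (Suc N). \<alpha> a / \<beta> a) ^ j = (\<Sum>a\<in>monic_below N. A a / B a) ^ j"
      using total[of 1] q2 by simp
    also have "\<dots> = (\<Sum>a\<in>monic_below N. (A a / B a) ^ j)"
    proof (rule Suc.IH)
      fix x y :: "'f poly" and c :: 'f
      have 1: "pCons 0 (x + y) = pCons 0 x + pCons 0 y" by simp
      have 2: "pCons 0 (smult c x) = smult c (pCons 0 x)" by simp
      show "A (x + y) = A x + A y" "B (x + y) = B x + B y"
        unfolding A_def B_def 1 Suc.prems add_power_q by (simp_all add: algebra_simps)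
      show "A (smult c x) = \<kappa> c * A x" "B (smult c x) = \<kappa> c * B x"
        unfolding A_def B_def 2 Suc.prems power_mult_distrib emb_power_q by (simp_all add: algebra_simps)
    next
      fix a :: "'f poly" assume a: "a \<noteq> 0" "degree a < N"
      define X where "X = \<beta> (pCons 0 a) / \<beta> 1"
      have "X + \<kappa> c \<noteq> 0" for c
        using bc[OF a, of c] b1 by (auto simp: X_def field_simps)
      hence "X ^ q - X \<noteq> 0" by (rule artin_schreier_nonzero)
      moreover have "B a = \<beta> 1 ^ (q + 1) * (X ^ q - X)"
        using b1 by (simp add: B_def X_def power_divide field_simps)
      ultimately show "B a \<noteq> 0" using b1 by simp
    qed
    finally show ?thesis using total[OF j] by simp
  qed
qed

end

section \<open>Ultrametric analysis\<close>

lemma dist_eq_absval: "dist x y = absval (x - y :: 'a::complete_valued_field)"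
  by (simp add: absval_def flip: dist_diff)

lemma absval_nonneg [simp]: "absval x \<ge> 0"
  by (simp add: absval_def)

lemma absval_eq_0_iff [simp]: "absval x = 0 \<longleftrightarrow> x = 0"
  by (simp add: absval_def)

lemma absval_0 [simp]: "absval 0 = 0"
  by (simp add: absval_def)

lemma absval_pos_iff [simp]: "absval x > 0 \<longleftrightarrow> x \<noteq> 0"
  by (simp add: absval_def)

lemma absval_mult: "absval (x * y) = absval x * absval y"
  unfolding absval_def by (rule dist_mult_zero)

lemma absval_1 [simp]: "absval (1 :: 'a::complete_valued_field) = 1"
  using absval_mult[of 1 "1 :: 'a"] by simp

lemma absval_minus [simp]: "absval (- x :: 'a::complete_valued_field) = absval x"
  using dist_eq_absval[of 0 x] dist_eq_absval[of x 0] dist_commute[of 0 x] by simp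

lemma absval_diff_commute: "absval (x - y :: 'a::complete_valued_field) = absval (y - x)"
  using absval_minus[of "x - y"] by simp

lemma absval_power: "absval (x ^ n :: 'a::complete_valued_field) = absval x ^ n"
  by (induction n) (simp_all add: absval_mult)

lemma absval_inverse: "absval (inverse x :: 'a::complete_valued_field) = inverse (absval x)"
proof (cases "x = 0")
  case False
  hence "absval x * absval (inverse x) = 1" by (simp flip: absval_mult)
  thus ?thesis by (metis inverse_unique)
qed simp

lemma absval_divide: "absval (x / y :: 'a::complete_valued_field) = absval x / absval y"
  by (simp add: divide_inverse absval_mult absval_inverse)

lemma absval_prod: "absval (prod f A :: 'a::complete_valued_field) = (\<Prod>x\<in>A. absval (f x))"
  by (induction A rule: infinite_finite_induct) (simp_all add: absval_mult)

lemma absval_add_le: "absval (x + y :: 'a::complete_valued_field) \<le> max (absval x) (absval y)"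
  unfolding absval_def by (rule dist_add_zero)

lemma absval_add_bound:
  "absval x \<le> C \<Longrightarrow> absval y \<le> C \<Longrightarrow> absval (x + y :: 'a::complete_valued_field) \<le> C"
  using absval_add_le[of x y] by simp

lemma absval_diff_bound:
  "absval x \<le> C \<Longrightarrow> absval y \<le> C \<Longrightarrow> absval (x - y :: 'a::complete_valued_field) \<le> C"
  using absval_add_bound[of x C "-y"] by simp

lemma absval_sum_bound:
  "(\<And>x. x \<in> A \<Longrightarrow> absval (f x) \<le> C) \<Longrightarrow> C \<ge> 0 \<Longrightarrow> absval (sum f A :: 'a::complete_valued_field) \<le> C"
  by (induction A rule: infinite_finite_induct) (auto intro: absval_add_bound)

lemma absval_add_eq:
  assumes "absval x < absval (y :: 'a::complete_valued_field)"
  shows "absval (x + y) = absval y"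
proof (rule antisym)
  show "absval (x + y) \<le> absval y" using absval_add_le[of x y] assms by simp
  have "absval y \<le> max (absval (x + y)) (absval x)"
    using absval_add_le[of "x + y" "- x"] by simp
  thus "absval y \<le> absval (x + y)" using assms by (simp split: if_splits add: max_def)
qed

lemma absval_diff_eq_max:
  assumes "absval x \<noteq> absval (y :: 'a::complete_valued_field)"
  shows "absval (x - y) = max (absval x) (absval y)"
  using assms absval_add_eq[of x "- y"] absval_add_eq[of "- y" x]
  by (cases "absval x < absval y") (auto simp: max_def add.commute)

lemma tendsto_absval_le:
  fixes g :: "'b set \<Rightarrow> 'a::complete_valued_field"
  assumes "(g \<longlongrightarrow> s) (finite_subsets_at_top A)"
    and "finite F0" "F0 \<subseteq> A" "\<And>F. finite F \<Longrightarrow> F0 \<subseteq> F \<Longrightarrow> F \<subseteq> A \<Longrightarrow> absval (g F - c) \<le> C"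
  shows "absval (s - c) \<le> C"
proof (rule field_le_epsilon)
  fix e :: real assume e: "e > 0"
  have "eventually (\<lambda>F. dist (g F) s < e) (finite_subsets_at_top A)"
    using assms(1) e by (rule tendstoD)
  then obtain X where X: "finite X" "X \<subseteq> A"
      "\<forall>F. finite F \<and> X \<subseteq> F \<and> F \<subseteq> A \<longrightarrow> dist (g F) s < e"
    unfolding eventually_finite_subsets_at_top by (elim exE conjE)
  have 1: "absval (s - g (X \<union> F0)) < e"
  proof -
    have "dist (g (X \<union> F0)) s < e" using X assms(2,3) by auto
    thus ?thesis unfolding dist_eq_absval by (subst absval_diff_commute)
  qed
  have 2: "absval (g (X \<union> F0) - c) \<le> C"
    using assms(4)[of "X \<union> F0"] X(1,2) assms(2,3) by simp
  have "C \<ge> 0" using 2 absval_nonneg order_trans by blast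
  have "absval (s - c) \<le> max (absval (s - g (X \<union> F0))) (absval (g (X \<union> F0) - c))"
    using absval_add_le[of "s - g (X \<union> F0)" "g (X \<union> F0) - c"] by simp
  thus "absval (s - c) \<le> C + e" using 1 2 e \<open>C \<ge> 0\<close> by linarith
qed

text \<open>By the ultrametric inequality, values close to the one at \<open>F0\<close> are equally
  close to each other, so comparison with a single set already gives a Cauchy net.\<close>

lemma ultrametric_net_converges:
  fixes g :: "'b set \<Rightarrow> 'a::complete_valued_field"
  assumes "\<And>e. e > 0 \<Longrightarrow> \<exists>F0. finite F0 \<and> F0 \<subseteq> A \<and>
      (\<forall>F. finite F \<and> F0 \<subseteq> F \<and> F \<subseteq> A \<longrightarrow> absval (g F - g F0) \<le> e)"
  obtains s where "(g \<longlongrightarrow> s) (finite_subsets_at_top A)"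
proof -
  have "cauchy_filter (filtermap g (finite_subsets_at_top A))"
    unfolding cauchy_filter_metric_filtermap
  proof (intro allI impI)
    fix e :: real assume e: "e > 0"
    have "\<exists>F0. finite F0 \<and> F0 \<subseteq> A \<and>
      (\<forall>F. finite F \<and> F0 \<subseteq> F \<and> F \<subseteq> A \<longrightarrow> absval (g F - g F0) \<le> e / 2)"
      by (rule assms) (use e in simp)
    then obtain F0 where F0: "finite F0" "F0 \<subseteq> A"
      "\<And>F. finite F \<and> F0 \<subseteq> F \<and> F \<subseteq> A \<Longrightarrow> absval (g F - g F0) \<le> e / 2"
      by (elim exE conjE) simp
    have "dist (g F) (g F') < e"
      if "finite F \<and> F0 \<subseteq> F \<and> F \<subseteq> A" "finite F' \<and> F0 \<subseteq> F' \<and> F' \<subseteq> A" for F F'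
    proof -
      have "absval ((g F - g F0) - (g F' - g F0)) \<le> e / 2"
        by (rule absval_diff_bound[OF F0(3)[OF that(1)] F0(3)[OF that(2)]])
      thus ?thesis using e by (simp add: dist_eq_absval)
    qed
    moreover have "eventually (\<lambda>F. finite F \<and> F0 \<subseteq> F \<and> F \<subseteq> A) (finite_subsets_at_top A)"
      unfolding eventually_finite_subsets_at_top using F0(1,2) by (intro exI[of _ F0]) simp
    ultimately show "\<exists>P. eventually P (finite_subsets_at_top A) \<and>
        (\<forall>F F'. P F \<and> P F' \<longrightarrow> dist (g F) (g F') < e)"
      by (intro exI[of _ "\<lambda>F. finite F \<and> F0 \<subseteq> F \<and> F \<subseteq> A"]) simp
  qed
  moreover have "complete (UNIV :: 'a set)"
    by (meson Cauchy_convergent UNIV_I complete_def convergent_def)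
  ultimately have "\<exists>s. (g \<longlongrightarrow> s) (finite_subsets_at_top A)"
    using complete_uniform[where S = "UNIV :: 'a set"] by (force simp add: filterlim_def)
  thus ?thesis using that by blast
qed

text \<open>Over an ultrametric field, terms tending to 0 are summable, and a tail is no larger than
  its largest term. The first assumption expresses the convergence to 0 without ordering the index
  set; it also guarantees that \<open>infsum\<close> is a true limit and not its default
  value.\<close>

lemma infsum_absval_diff_le:
  fixes f :: "'b \<Rightarrow> 'a::complete_valued_field"
  assumes "\<And>e. e > 0 \<Longrightarrow> finite {x \<in> A. absval (f x) \<ge> e}"
    and "finite F" "F \<subseteq> A" "\<And>x. x \<in> A - F \<Longrightarrow> absval (f x) \<le> C" "C \<ge> 0"
  shows "absval (infsum f A - sum f F) \<le> C"
proof -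
  have diff: "absval (sum f G' - sum f G) \<le> e"
    if "finite G'" "G \<subseteq> G'" "G' \<subseteq> A" "\<And>x. x \<in> A - G \<Longrightarrow> absval (f x) \<le> e" "e \<ge> 0" for G G' e
  proof -
    have "sum f G' - sum f G = sum f (G' - G)" using that by (simp add: sum_diff)
    also have "absval \<dots> \<le> e" by (rule absval_sum_bound) (use that in auto)
    finally show ?thesis .
  qed
  obtain s where s: "(sum f \<longlongrightarrow> s) (finite_subsets_at_top A)"
  proof (rule ultrametric_net_converges)
    fix e :: real assume e: "e > 0"
    show "\<exists>F0. finite F0 \<and> F0 \<subseteq> A \<and>
        (\<forall>F. finite F \<and> F0 \<subseteq> F \<and> F \<subseteq> A \<longrightarrow> absval (sum f F - sum f F0) \<le> e)"
      using assms(1)[OF e] e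
      by (intro exI[of _ "{x \<in> A. absval (f x) \<ge> e}"]) (auto intro!: diff)
  qed blast
  hence "(f has_sum s) A" by (simp add: has_sum_def)
  hence "infsum f A = s" by (rule infsumI)
  moreover have "absval (s - sum f F) \<le> C"
  proof (rule tendsto_absval_le[OF s assms(2,3)])
    fix F' assume "finite F'" "F \<subseteq> F'" "F' \<subseteq> A"
    thus "absval (sum f F' - sum f F) \<le> C" using assms(4,5) by (rule diff)
  qed
  ultimately show ?thesis by simp
qed

section \<open>Order of decay at infinity\<close>

definition O_inf :: "nat \<Rightarrow> ('a::complete_valued_field \<Rightarrow> 'a) \<Rightarrow> bool" where
  "O_inf m f \<longleftrightarrow> (\<exists>C B. \<forall>x. absval x \<ge> B \<longrightarrow> absval (f x) * absval x ^ m \<le> C)"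

lemma O_infE:
  assumes "O_inf m f"
  obtains C B where "C \<ge> 0" "B \<ge> 1" "\<And>x. absval x \<ge> B \<Longrightarrow> absval (f x) * absval x ^ m \<le> C"
proof -
  from assms obtain C B where "\<And>x. absval x \<ge> B \<Longrightarrow> absval (f x) * absval x ^ m \<le> C"
    unfolding O_inf_def by blast
  hence "\<And>x. absval x \<ge> max B 1 \<Longrightarrow> absval (f x) * absval x ^ m \<le> max C 0"
    by (meson max.bounded_iff max.coboundedI1)
  thus ?thesis using that[of "max C 0" "max B 1"] by simp
qed

lemma O_infI: "(\<And>x. absval x \<ge> B \<Longrightarrow> absval (f x) * absval x ^ m \<le> C) \<Longrightarrow> O_inf m f"
  unfolding O_inf_def by blast

lemma O_inf_cong:
  assumes "O_inf m f" "\<And>x. absval x \<ge> B \<Longrightarrow> f x = g x"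
  shows "O_inf m g"
proof -
  from assms(1) obtain C B' where "C \<ge> 0" "B' \<ge> 1" "\<And>x. absval x \<ge> B' \<Longrightarrow> absval (f x) * absval x ^ m \<le> C"
    by (rule O_infE) (rule that)
  thus ?thesis by (intro O_infI[of "max B B'" _ _ C]) (simp flip: assms(2))
qed

lemma O_inf_add:
  assumes "O_inf m f" "O_inf m g"
  shows "O_inf m (\<lambda>x. f x + g x)"
proof -
  from assms(1) obtain C B where f: "C \<ge> 0" "B \<ge> 1" "\<And>x. absval x \<ge> B \<Longrightarrow> absval (f x) * absval x ^ m \<le> C"
    by (rule O_infE) (rule that)
  from assms(2) obtain C' B' where g: "C' \<ge> 0" "B' \<ge> 1" "\<And>x. absval x \<ge> B' \<Longrightarrow> absval (g x) * absval x ^ m \<le> C'"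
    by (rule O_infE) (rule that)
  show ?thesis
  proof (rule O_infI[of "max B B'" _ _ "max C C'"])
    fix x :: 'a assume x: "absval x \<ge> max B B'"
    have "absval (f x * x ^ m + g x * x ^ m) \<le> max C C'"
      using f(3)[of x] g(3)[of x] x
      by (intro absval_add_bound) (auto simp: absval_mult absval_power le_max_iff_disj)
    thus "absval (f x + g x) * absval x ^ m \<le> max C C'"
      by (simp add: absval_mult absval_power flip: distrib_right)
  qed
qed

lemma O_inf_minus: "O_inf m f \<Longrightarrow> O_inf m (\<lambda>x. - f x)"
  by (simp add: O_inf_def)

lemma O_inf_diff: "O_inf m f \<Longrightarrow> O_inf m g \<Longrightarrow> O_inf m (\<lambda>x. f x - g x)"
  using O_inf_add[of m f "\<lambda>x. - g x"] O_inf_minus[of m g] by simp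

lemma O_inf_mult:
  assumes "O_inf m f" "O_inf n g"
  shows "O_inf (m + n) (\<lambda>x. f x * g x)"
proof -
  from assms(1) obtain C B where f: "C \<ge> 0" "B \<ge> 1" "\<And>x. absval x \<ge> B \<Longrightarrow> absval (f x) * absval x ^ m \<le> C"
    by (rule O_infE) (rule that)
  from assms(2) obtain C' B' where g: "C' \<ge> 0" "B' \<ge> 1" "\<And>x. absval x \<ge> B' \<Longrightarrow> absval (g x) * absval x ^ n \<le> C'"
    by (rule O_infE) (rule that)
  show ?thesis
  proof (rule O_infI[of "max B B'" _ _ "C * C'"])
    fix x :: 'a assume x: "absval x \<ge> max B B'"
    have "(absval (f x) * absval x ^ m) * (absval (g x) * absval x ^ n) \<le> C * C'"
      by (rule mult_mono) (use f(3)[of x] g(3)[of x] x f(1) in auto)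
    thus "absval (f x * g x) * absval x ^ (m + n) \<le> C * C'"
      by (simp add: absval_mult power_add mult_ac)
  qed
qed

lemma O_inf_mono:
  assumes "O_inf m f" "n \<le> m"
  shows "O_inf n f"
proof -
  from assms(1) obtain C B where f: "C \<ge> 0" "B \<ge> 1" "\<And>x. absval x \<ge> B \<Longrightarrow> absval (f x) * absval x ^ m \<le> C"
    by (rule O_infE) (rule that)
  show ?thesis
  proof (rule O_infI[of B _ _ C])
    fix x :: 'a assume x: "absval x \<ge> B"
    have "absval (f x) * absval x ^ n \<le> absval (f x) * absval x ^ m"
      using x f(2) assms(2) by (intro mult_left_mono power_increasing) auto
    thus "absval (f x) * absval x ^ n \<le> C" using f(3)[OF x] by simp
  qed
qed

lemma O_inf_const: "O_inf 0 (\<lambda>_. c)"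
  by (rule O_infI[of 0 _ _ "absval c"]) simp

lemma O_inf_0: "O_inf m (\<lambda>_. 0)"
  by (rule O_infI[of 0 _ _ 0]) simp

lemma O_inf_cmult: "O_inf m f \<Longrightarrow> O_inf m (\<lambda>x. c * f x)"
  using O_inf_mult[OF O_inf_const, of m f c] by simp

lemma O_inf_power: "O_inf m f \<Longrightarrow> O_inf (m * k) (\<lambda>x. f x ^ k)"
  by (induction k) (auto simp: O_inf_const[of 1, simplified] intro: O_inf_mult)

lemma O_inf_sum: "(\<And>i. i \<in> I \<Longrightarrow> O_inf m (f i)) \<Longrightarrow> O_inf m (\<lambda>x. \<Sum>i\<in>I. f i x)"
  by (induction I rule: infinite_finite_induct) (auto simp: O_inf_0 intro: O_inf_add)

lemma O_inf_inverse_power: "O_inf m (\<lambda>x. 1 / x ^ m)"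
  by (rule O_infI[of 1 _ _ 1]) (auto simp: absval_divide absval_power)

lemma O_inf_power_divide:
  assumes "n + m \<le> k"
  shows "O_inf m (\<lambda>x. x ^ n / x ^ k)"
proof (rule O_inf_cong[of _ _ 1])
  show "O_inf m (\<lambda>x :: 'a. 1 / x ^ (k - n))"
    by (rule O_inf_mono[OF O_inf_inverse_power]) (use assms in simp)
  show "1 / x ^ (k - n) = x ^ n / x ^ k" if "absval x \<ge> 1" for x :: 'a
  proof -
    have "x \<noteq> 0" using that by auto
    thus ?thesis using assms by (simp add: power_diff)
  qed
qed

lemma O_inf_poly_divide:
  assumes "\<And>n. coeff g n \<noteq> 0 \<Longrightarrow> n + m \<le> k"
  shows "O_inf m (\<lambda>x. poly g x / x ^ k)"
proof -
  have "O_inf m (\<lambda>x. coeff g n * (x ^ n / x ^ k))" for n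
  proof (cases "coeff g n = 0")
    case False
    show ?thesis by (intro O_inf_cmult O_inf_power_divide assms False)
  qed (simp add: O_inf_0)
  hence "O_inf m (\<lambda>x. \<Sum>n\<le>degree g. coeff g n * (x ^ n / x ^ k))"
    by (intro O_inf_sum)
  thus ?thesis by (simp add: poly_altdef sum_divide_distrib)
qed

text \<open>One spare order turns the unknown constant into an arbitrarily small one. This is why
  later estimates are stated with \<open>Suc\<close>.\<close>

lemma O_inf_small:
  assumes "O_inf (Suc m) f" "e > 0"
  obtains B where "B \<ge> 1" "\<And>x. absval x \<ge> B \<Longrightarrow> absval (f x) * absval x ^ m < e"
proof -
  from assms(1) obtain C B where f: "C \<ge> 0" "B \<ge> 1" "\<And>x. absval x \<ge> B \<Longrightarrow> absval (f x) * absval x ^ Suc m \<le> C"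
    by (rule O_infE) (rule that)
  show ?thesis
  proof (rule that[of "max B (C / e + 1)"])
    fix x :: 'a assume x: "absval x \<ge> max B (C / e + 1)"
    hence xpos: "absval x > 0" using f(2) by linarith
    have "absval (f x) * absval x ^ m * absval x \<le> C"
      using f(3)[of x] x by (simp add: mult_ac)
    also have "C < e * absval x"
    proof -
      have "C / e < absval x" using x by simp
      thus ?thesis using assms(2) by (simp add: field_simps)
    qed
    finally show "absval (f x) * absval x ^ m < e" using xpos by simp
  qed (use f in auto)
qed

lemma absval_poly_at_infinity:
  fixes f :: "'a::complete_valued_field poly"
  assumes "lead_coeff f = 1"
  obtains B where "B \<ge> 1" "\<And>x. absval x \<ge> B \<Longrightarrow> absval (poly f x) = absval x ^ degree f"
proof -
  define g where "g = f - monom 1 (degree f)"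
  have "O_inf (Suc 0) (\<lambda>x. poly g x / x ^ degree f)"
  proof (rule O_inf_poly_divide)
    fix n assume n: "coeff g n \<noteq> 0"
    have "n \<noteq> degree f" using n assms by (auto simp: g_def)
    moreover have "n \<le> degree f"
    proof (rule ccontr)
      assume "\<not> n \<le> degree f"
      thus False using n by (simp add: g_def coeff_eq_0)
    qed
    ultimately show "n + Suc 0 \<le> degree f" by simp
  qed
  then obtain B where B: "B \<ge> 1" "\<And>x. absval x \<ge> B \<Longrightarrow> absval (poly g x / x ^ degree f) * absval x ^ 0 < 1"
    by (rule O_inf_small[of 0 _ 1]) auto
  show ?thesis
  proof (rule that[of B])
    fix x :: 'a assume x: "absval x \<ge> B"
    hence x0: "absval x > 0" using B(1) by linarith
    have "absval (poly g x) < absval (x ^ degree f)"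
      using B(2)[OF x] x0 by (simp add: absval_divide absval_power field_simps)
    hence "absval (poly g x + x ^ degree f) = absval (x ^ degree f)" by (rule absval_add_eq)
    thus "absval (poly f x) = absval x ^ degree f"
      by (simp add: g_def poly_monom absval_power)
  qed fact
qed

lemma O_inf_inverse_poly:
  assumes "lead_coeff f = 1"
  shows "O_inf (degree f) (\<lambda>x. 1 / poly f x)"
proof -
  obtain B where B: "B \<ge> 1" "\<And>x. absval x \<ge> B \<Longrightarrow> absval (poly f x) = absval x ^ degree f"
    by (rule absval_poly_at_infinity[OF assms]) (rule that)
  show ?thesis
    by (rule O_infI[of B _ _ 1]) (use B in \<open>auto simp: absval_divide\<close>)
qed

text \<open>Uniqueness of asymptotic expansions, in the variable \<open>s\<close> tending to \<open>0\<close>.\<close>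

lemma coeff_eq_0_of_small_values:
  fixes g :: "'a::complete_valued_field poly"
  assumes "filterlim (\<lambda>r. absval (s r)) (at_right 0) sequentially"
    and "(\<lambda>r. absval (poly g (s r)) / absval (s r) ^ j) \<longlonglongrightarrow> 0"
  shows "coeff g j = 0"
  using assms(2)
proof (induction j arbitrary: g)
  have s0: "(\<lambda>r. absval (s r)) \<longlonglongrightarrow> 0" and sne: "eventually (\<lambda>r. absval (s r) > 0) sequentially"
    using assms(1) unfolding filterlim_at by (auto elim: eventually_mono)
  \<comment> \<open>The case \<open>j = 0\<close> is needed for every polynomial: the induction step
    uses it to split off a factor of the variable. The rest of the polynomial contributes at most
    \<open>M * absval (s r)\<close>.\<close>
  have coeff0: "coeff g 0 = 0" if "(\<lambda>r. absval (poly g (s r))) \<longlonglongrightarrow> 0" for g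
  proof (cases g)
    case (pCons a g')
    define M where "M = Max (insert 1 ((\<lambda>n. absval (coeff g' n)) ` {..degree g'}))"
    have M1: "M \<ge> 1" unfolding M_def by (rule Max_ge) auto
    have M: "absval (coeff g' n) \<le> M" for n
    proof (cases "n \<le> degree g'")
      case True
      thus ?thesis unfolding M_def by (intro Max_ge) auto
    qed (use M1 in \<open>simp add: coeff_eq_0\<close>)
    have "eventually (\<lambda>r. absval a \<le> max (absval (poly g (s r))) (M * absval (s r))) sequentially"
    proof -
      have "eventually (\<lambda>r. absval (s r) < 1) sequentially"
        using order_tendstoD(2)[OF s0, of 1] by simp
      thus ?thesis
      proof eventually_elim
        case (elim r)
        have "absval (poly g' (s r)) \<le> M"
          unfolding poly_altdef
        proof (rule absval_sum_bound)
          fix n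
          have "absval (coeff g' n) * absval (s r) ^ n \<le> M * 1"
            using M M1 elim by (intro mult_mono power_le_one) auto
          thus "absval (coeff g' n * s r ^ n) \<le> M" by (simp add: absval_mult absval_power)
        qed (use M1 in auto)
        hence "absval (s r * poly g' (s r)) \<le> M * absval (s r)"
          by (simp add: absval_mult mult.commute[of M] mult_left_mono)
        moreover have "a = poly g (s r) - s r * poly g' (s r)" by (simp add: pCons)
        ultimately show ?case
          by (metis absval_diff_bound max.cobounded1 max.coboundedI2)
      qed
    qed
    moreover have "(\<lambda>r. max (absval (poly g (s r))) (M * absval (s r))) \<longlonglongrightarrow> max 0 (M * 0)"
      by (intro tendsto_intros that s0)
    ultimately have "absval a \<le> max 0 (M * 0)"
      by (intro tendsto_lowerbound) auto
    hence "absval a = 0" using absval_nonneg[of a] by simp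
    thus ?thesis by (simp add: pCons)
  qed
  {
    case 0
    thus ?case using coeff0[of g] by simp
  next
    case (Suc j)
    have lim: "(\<lambda>r. absval (poly g (s r)) / absval (s r) ^ Suc j * absval (s r) ^ Suc j) \<longlonglongrightarrow> 0 * 0 ^ Suc j"
      by (intro tendsto_intros Suc.prems s0)
    have "eventually (\<lambda>r. absval (poly g (s r)) / absval (s r) ^ Suc j * absval (s r) ^ Suc j =
        absval (poly g (s r))) sequentially"
      using sne by eventually_elim simp
    from Lim_transform_eventually[OF lim this] have "(\<lambda>r. absval (poly g (s r))) \<longlonglongrightarrow> 0"
      by simp
    hence g0: "coeff g 0 = 0" by (rule coeff0)
    then obtain g' where g': "g = pCons 0 g'" by (cases g) auto
    have "eventually (\<lambda>r. absval (poly g (s r)) / absval (s r) ^ Suc j =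
        absval (poly g' (s r)) / absval (s r) ^ j) sequentially"
      using sne by eventually_elim (simp add: g' absval_mult)
    from Lim_transform_eventually[OF Suc.prems this]
    have "(\<lambda>r. absval (poly g' (s r)) / absval (s r) ^ j) \<longlonglongrightarrow> 0" .
    from Suc.IH[OF this] show ?case by (simp add: g')
  }
qed

section \<open>Carlitz polynomials\<close>

lemma coeff_power_char:
  fixes g :: "'a::comm_ring_1 poly"
  assumes "prime p" "p = CHAR('a)"
  shows "coeff (g ^ p) n = (if p dvd n then coeff g (n div p) ^ p else 0)"
  unfolding poly_power_char_eq_expand[OF assms]
  using assms prime_gt_0_nat[of p] by (simp add: coeff_expand_poly coeff_map_poly zero_power)

lemma additive_poly_power:
  fixes g :: "'a::comm_ring_1 poly"
  assumes "prime p" "p = CHAR('a)" "additive_poly p r g"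
  shows "additive_poly p (Suc r) (g ^ p)"
  unfolding additive_poly_def
proof (intro allI impI)
  fix n assume n: "coeff (g ^ p) n \<noteq> 0"
  have p0: "p > 0" using assms(1) prime_gt_0_nat by blast
  from n have "p dvd n" "coeff g (n div p) \<noteq> 0"
    using p0 unfolding coeff_power_char[OF assms(1,2)] by (auto simp: zero_power split: if_splits)
  then obtain s where "s \<le> r" "n div p = p ^ s" using assms(3) unfolding additive_poly_def by blast
  moreover have "n = p * (n div p)" using \<open>p dvd n\<close> by simp
  ultimately show "\<exists>s\<le>Suc r. n = p ^ s"
    by (intro exI[of _ "Suc s"]) simp
qed

locale carlitz = C_infinity \<iota>
  for \<iota> :: "'f::finite_field poly fract \<Rightarrow> 'c::complete_valued_field" +
  fixes q :: nat
  assumes q_def: "q = CARD('f)" and prime_q': "prime q"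
begin

abbreviation "emb \<equiv> emb_A \<iota>"

definition \<kappa> :: "'f \<Rightarrow> 'c" where "\<kappa> c = emb [:c:]"

lemma emb_A_add: "emb (a + b) = emb a + emb b"
  by (simp add: emb_A_def emb_add)

lemma emb_A_mult: "emb (a * b) = emb a * emb b"
  by (simp add: emb_A_def emb_mult)

lemma emb_A_1: "emb 1 = 1"
  by (simp add: emb_A_def emb_one)

lemma emb_A_0: "emb 0 = 0"
  using emb_A_add[of 0 0] by (metis add_cancel_right_left add_0)

lemma emb_A_minus: "emb (- a) = - emb a"
  using emb_A_add[of "- a" a] by (simp add: emb_A_0 eq_neg_iff_add_eq_0)

lemma emb_A_diff: "emb (a - b) = emb a - emb b"
  using emb_A_add[of a "- b"] by (simp add: emb_A_minus)

lemma absval_emb_A: "a \<noteq> 0 \<Longrightarrow> absval (emb a) = real q ^ degree a"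
  by (simp add: emb_A_def absval_emb q_def)

lemma emb_A_eq_0_iff: "emb a = 0 \<longleftrightarrow> a = 0"
proof (cases "a = 0")
  case False
  have "absval (emb a) > 0" using absval_emb_A[OF False] prime_gt_0_nat[OF prime_q'] by simp
  thus ?thesis using False by simp
qed (simp add: emb_A_0)

lemma emb_A_eq_iff: "emb a = emb b \<longleftrightarrow> a = b"
  using emb_A_eq_0_iff[of "a - b"] by (simp add: emb_A_diff)

lemma emb_A_smult: "emb (smult c a) = \<kappa> c * emb a"
  by (simp add: \<kappa>_def flip: emb_A_mult)

lemma emb_A_pCons: "emb (pCons c a) = \<kappa> c + emb [:0, 1:] * emb a"
  by (simp add: \<kappa>_def flip: emb_A_mult emb_A_add)

sublocale prime_field_emb \<kappa> q
proof
  show "\<kappa> 1 = 1" using emb_A_1 by (simp add: \<kappa>_def one_pCons)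
  show "\<kappa> (x + y) = \<kappa> x + \<kappa> y" for x y by (simp add: \<kappa>_def flip: emb_A_add)
  show "\<kappa> (x * y) = \<kappa> x * \<kappa> y" for x y by (simp add: \<kappa>_def mult.commute flip: emb_A_mult)
qed (fact q_def prime_q')+

lemma absval_\<kappa>_le: "absval (\<kappa> c) \<le> 1"
  using absval_emb_A[of "[:c:]"] by (cases "c = 0") (simp_all add: emb0, simp add: \<kappa>_def)

lemma absval_\<kappa>: "c \<noteq> 0 \<Longrightarrow> absval (\<kappa> c) = 1"
  using absval_emb_A[of "[:c:]"] by (simp add: \<kappa>_def)

text \<open>The polynomial \<open>\<phi>_a(u)\<close> of the Carlitz module by Horner's rule: each
  coefficient of \<open>a\<close> applies \<open>\<phi>_T\<close> once more from the
  outside.\<close>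

definition carlitz_poly :: "'f poly \<Rightarrow> 'c poly" where
  "carlitz_poly = (\<lambda>a. fold_coeffs (\<lambda>c g. [:0, \<kappa> c:] + smult (emb [:0, 1:]) g + g ^ q) a 0)"

lemma carlitz_poly_0 [simp]: "carlitz_poly 0 = 0"
  by (simp add: carlitz_poly_def)

lemma carlitz_poly_pCons:
  "carlitz_poly (pCons c a) =
     [:0, \<kappa> c:] + smult (emb [:0, 1:]) (carlitz_poly a) + carlitz_poly a ^ q"
proof (cases "a = 0 \<and> c = 0")
  case True
  thus ?thesis using q2 by (simp add: emb0 zero_power)
next
  case False
  hence "coeffs (pCons c a) = c # coeffs a"
    by (auto simp: cCons_def)
  thus ?thesis by (simp add: carlitz_poly_def fold_coeffs_def)
qed

lemma carlitz_poly_add: "carlitz_poly (a + b) = carlitz_poly a + carlitz_poly b"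
proof (induction a b rule: poly_induct2)
  case (pCons c a d b)
  have 1: "(carlitz_poly a + carlitz_poly b) ^ q = carlitz_poly a ^ q + carlitz_poly b ^ q"
    by (rule freshmans_dream) (simp_all add: char_eq prime_q)
  have 2: "[:0, \<kappa> (c + d):] = [:0, \<kappa> c:] + [:0, \<kappa> d:]" by (simp add: embA)
  show ?case
    by (subst add_pCons) (simp only: carlitz_poly_pCons pCons.IH smult_add_right 1 2 ac_simps)
qed simp

lemma carlitz_poly_smult: "carlitz_poly (smult c a) = smult (\<kappa> c) (carlitz_poly a)"
proof (induction a)
  case (pCons d a)
  have "smult (\<kappa> c) (carlitz_poly a) ^ q = smult (\<kappa> c) (carlitz_poly a ^ q)"
    by (simp add: smult_power emb_power_q)
  thus ?case
    by (simp add: carlitz_poly_pCons pCons.IH smult_add_right embM mult_ac)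
qed simp

lemma carlitz_T_eq: "carlitz_T \<iota> x = emb [:0, 1:] * x + x ^ q"
  by (simp add: carlitz_T_def q_def)

lemma poly_carlitz_poly_pCons:
  "poly (carlitz_poly (pCons c a)) x = \<kappa> c * x + carlitz_T \<iota> (poly (carlitz_poly a) x)"
  by (simp add: carlitz_poly_pCons carlitz_T_eq mult.commute add_ac)

lemma coeff_carlitz_poly_0 [simp]: "coeff (carlitz_poly a) 0 = 0"
proof (induction a)
  case (pCons c a)
  thus ?case using q2 coeff_power_char[OF prime_q char_eq[symmetric], of "carlitz_poly a" 0]
    by (simp add: carlitz_poly_pCons zero_power)
qed simp

lemma coeff_carlitz_poly_1: "coeff (carlitz_poly a) 1 = emb a"
proof (induction a)
  case (pCons c a)
  have "\<not> q dvd 1" using q2 by simp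
  hence "coeff (carlitz_poly a ^ q) 1 = 0"
    unfolding coeff_power_char[OF prime_q char_eq[symmetric]] by (simp only: if_False)
  moreover have "coeff [:0, \<kappa> c:] 1 = \<kappa> c" by simp
  ultimately show ?case
    unfolding carlitz_poly_pCons emb_A_pCons[of c] coeff_add coeff_smult pCons.IH by (simp only: add_0_right)
qed (simp add: emb_A_0)

lemma additive_carlitz_poly: "additive_poly q (degree a) (carlitz_poly a)"
proof (induction a)
  case (pCons c a)
  have 1: "additive_poly q r [:0, \<kappa> c:]" for r
    unfolding additive_poly_def by (auto simp: coeff_pCons split: nat.splits intro!: exI[of _ 0])
  show ?case
  proof (cases "a = 0")
    case True
    thus ?thesis using 1[of 0] q2 by (simp add: carlitz_poly_pCons zero_power)
  next
    case False
    have "additive_poly q (Suc (degree a)) (carlitz_poly (pCons c a))"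
      unfolding carlitz_poly_pCons
      by (intro additive_poly_add additive_poly_smult 1 additive_poly_mono[OF pCons.IH]
          additive_poly_power pCons.IH prime_q char_eq[symmetric]) simp
    thus ?thesis using False by simp
  qed
qed (simp add: additive_poly_0)

lemma coeff_carlitz_poly_top: "coeff (carlitz_poly a) (q ^ degree a) = \<kappa> (lead_coeff a)"
proof (induction a)
  case (pCons c a)
  show ?case
  proof (cases "a = 0")
    case True
    thus ?thesis using q2 by (simp add: carlitz_poly_pCons zero_power)
  next
    case False
    have "degree (carlitz_poly a) \<le> q ^ degree a"
      by (rule degree_additive_poly_le[OF additive_carlitz_poly]) (use q2 in simp)
    also have "\<dots> < q ^ Suc (degree a)" using q2 by simp
    finally have "coeff (carlitz_poly a) (q ^ Suc (degree a)) = 0" by (rule coeff_eq_0)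
    moreover have "1 < q ^ Suc (degree a)" using q2 by (intro one_less_power) auto
    hence "coeff [:0, \<kappa> c:] (q ^ Suc (degree a)) = 0"
      using q2 by (simp add: coeff_pCons del: power_Suc split: nat.splits)
    moreover have "coeff (carlitz_poly a ^ q) (q ^ Suc (degree a)) = \<kappa> (lead_coeff a)"
      using q2 pCons.IH coeff_power_char[OF prime_q char_eq[symmetric], of "carlitz_poly a" "q ^ Suc (degree a)"]
      by (simp add: emb_power_q)
    ultimately show ?thesis using False
      by (simp add: carlitz_poly_pCons del: power_Suc)
  qed
qed (simp add: emb0)

lemma degree_carlitz_poly: "a \<noteq> 0 \<Longrightarrow> degree (carlitz_poly a) = q ^ degree a"
proof (rule antisym)
  show "degree (carlitz_poly a) \<le> q ^ degree a"
    by (rule degree_additive_poly_le[OF additive_carlitz_poly]) (use q2 in simp)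
  assume "a \<noteq> 0"
  hence "coeff (carlitz_poly a) (q ^ degree a) \<noteq> 0"
    using absval_\<kappa>[of "lead_coeff a"] by (auto simp: coeff_carlitz_poly_top)
  thus "q ^ degree a \<le> degree (carlitz_poly a)" by (rule le_degree)
qed

lemma carlitz_poly_1: "carlitz_poly 1 = monom 1 1"
  using q2 by (simp add: one_pCons carlitz_poly_pCons zero_power emb1 monom_Suc monom_0)

text \<open>Exponents other than 1 are multiples of the characteristic. The constant derivative is
  what the sums over roots require.\<close>

lemma pderiv_carlitz_poly: "pderiv (carlitz_poly a) = [:emb a:]"
proof (rule poly_eqI)
  fix n
  show "coeff (pderiv (carlitz_poly a)) n = coeff [:emb a:] n"
  proof (cases n)
    case 0
    thus ?thesis using coeff_carlitz_poly_1[of a] by (simp add: coeff_pderiv)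
  next
    case (Suc m)
    have "of_nat (Suc n) * coeff (carlitz_poly a) (Suc n) = 0"
    proof (rule ccontr)
      assume *: "of_nat (Suc n) * coeff (carlitz_poly a) (Suc n) \<noteq> 0"
      then obtain s where s: "Suc n = q ^ s"
        using additive_carlitz_poly[of a] unfolding additive_poly_def by auto
      hence "s \<noteq> 0" using Suc by (intro notI) simp
      hence "q dvd Suc n" unfolding s by simp
      then obtain k where "Suc n = q * k" by blast
      hence "(of_nat (Suc n) :: 'c) = 0" using of_nat_q by simp
      thus False using * by simp
    qed
    thus ?thesis using Suc by (simp add: coeff_pderiv)
  qed
qed

text \<open>In \<open>\<phi>_T(v) = T v + v^q\<close> the second term dominates as soon as
  \<open>|v| > q = |T|\<close>, and \<open>|v| \<ge> |x|\<close> persists along the recursion. The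
  bound on \<open>x\<close> is uniform in \<open>a\<close>, so it serves for the whole series of
  \<open>h\<close>.\<close>

lemma absval_carlitz_poly:
  assumes x: "absval x > real q" and a: "a \<noteq> 0"
  shows "absval (poly (carlitz_poly a) x) = absval x ^ (q ^ degree a)"
  using a
proof (induction a)
  case (pCons c a)
  show ?case
  proof (cases "a = 0")
    case True
    thus ?thesis using pCons.hyps absval_\<kappa>[of c] q2
      by (simp add: carlitz_poly_pCons zero_power absval_mult)
  next
    case False
    have x1: "absval x > 1" using x q2 by linarith
    define v where "v = poly (carlitz_poly a) x"
    have v: "absval v = absval x ^ (q ^ degree a)" using pCons.IH False by (simp add: v_def)
    have "absval x ^ 1 \<le> absval v" unfolding v using x1 q2 by (intro power_increasing) auto
    hence vx: "absval x \<le> absval v" by simp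
    have v1: "absval v > 1" using vx x1 by linarith
    have "absval v ^ 1 \<le> absval v ^ (q - 1)" using v1 q2 by (intro power_increasing) auto
    hence "real q < absval v ^ (q - 1)" using vx x by simp
    hence "real q * absval v < absval v ^ (q - 1) * absval v"
      using v1 by (intro mult_strict_right_mono) auto
    hence lt: "real q * absval v < absval v ^ q"
      using q2 power_minus_mult[of q "absval v"] by simp
    have "absval (emb [:0, 1:] * v) = real q * absval v"
      using absval_emb_A[of "[:0, 1:]"] by (simp add: absval_mult)
    moreover have "absval (\<kappa> c * x) \<le> real q * absval v"
    proof -
      have "absval (\<kappa> c) * absval x \<le> 1 * absval x" by (intro mult_right_mono absval_\<kappa>_le) simp
      also have "\<dots> \<le> real q * absval v" using vx q2 v1 by (intro mult_mono) auto
      finally show ?thesis by (simp add: absval_mult)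
    qed
    ultimately have "absval (\<kappa> c * x + emb [:0, 1:] * v) \<le> real q * absval v"
      by (intro absval_add_bound) auto
    hence "absval ((\<kappa> c * x + emb [:0, 1:] * v) + v ^ q) = absval (v ^ q)"
      using lt by (intro absval_add_eq) (simp add: absval_power)
    moreover have "poly (carlitz_poly (pCons c a)) x = (\<kappa> c * x + emb [:0, 1:] * v) + v ^ q"
      unfolding poly_carlitz_poly_pCons carlitz_T_eq v_def by (simp only: add.assoc)
    ultimately show ?thesis using False
      by (simp add: absval_power v mult.commute[of q] flip: power_mult)
  qed
qed simp

end

section \<open>The Carlitz exponential\<close>

lemma absval_le_0_iff [simp]: "absval x \<le> 0 \<longleftrightarrow> x = 0"
  using absval_nonneg[of x] absval_eq_0_iff[of x] by linarith

lemma tendsto_absval_iff: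
  fixes l :: "'a::complete_valued_field"
  shows "(f \<longlongrightarrow> l) F \<longleftrightarrow> ((\<lambda>x. absval (f x - l)) \<longlongrightarrow> 0) F"
  by (subst tendsto_dist_iff) (simp add: dist_eq_absval)

lemma tendsto_mult_left_valued:
  fixes l :: "'a::complete_valued_field"
  assumes "(f \<longlongrightarrow> l) F"
  shows "((\<lambda>x. c * f x) \<longlongrightarrow> c * l) F"
proof -
  have "((\<lambda>x. absval c * absval (f x - l)) \<longlongrightarrow> absval c * 0) F"
    using assms unfolding tendsto_absval_iff by (intro tendsto_intros)
  thus ?thesis unfolding tendsto_absval_iff
    by (simp add: absval_mult flip: right_diff_distrib)
qed

lemma tendsto_add_valued:
  fixes l :: "'a::complete_valued_field"
  assumes "(f \<longlongrightarrow> l) F" "(g \<longlongrightarrow> m) F"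
  shows "((\<lambda>x. f x + g x) \<longlongrightarrow> l + m) F"
proof -
  have "((\<lambda>x. max (absval (f x - l)) (absval (g x - m))) \<longlongrightarrow> max 0 0) F"
    using assms unfolding tendsto_absval_iff by (intro tendsto_intros)
  hence lim: "((\<lambda>x. max (absval (f x - l)) (absval (g x - m))) \<longlongrightarrow> 0) F" by simp
  show ?thesis unfolding tendsto_absval_iff
  proof (rule tendsto_sandwich[OF _ _ tendsto_const lim])
    show "eventually (\<lambda>x. absval (f x + g x - (l + m)) \<le> max (absval (f x - l)) (absval (g x - m))) F"
    proof (rule always_eventually, rule allI)
      fix x show "absval (f x + g x - (l + m)) \<le> max (absval (f x - l)) (absval (g x - m))"
        using absval_add_le[of "f x - l" "g x - m"] by (simp add: algebra_simps)
    qed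
  qed simp
qed

lemma absval_prod_one_minus:
  fixes x :: "'b \<Rightarrow> 'a::complete_valued_field"
  assumes "\<And>i. i \<in> G \<Longrightarrow> absval (x i) \<le> \<delta>" "0 \<le> \<delta>" "\<delta> \<le> 1"
  shows "absval ((\<Prod>i\<in>G. 1 - x i) - 1) \<le> \<delta>"
  using assms(1)
proof (induction G rule: infinite_finite_induct)
  case (insert i G)
  have IH: "absval ((\<Prod>i\<in>G. 1 - x i) - 1) \<le> \<delta>" using insert by auto
  have "absval ((\<Prod>i\<in>G. 1 - x i) - 1 + 1) \<le> 1"
    by (rule absval_add_bound) (use IH assms(3) in auto)
  hence le1: "absval (\<Prod>i\<in>G. 1 - x i) \<le> 1" by simp
  have "absval (x i) * absval (\<Prod>i\<in>G. 1 - x i) \<le> \<delta> * 1"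
    using insert.prems[of i] le1 assms(2) by (intro mult_mono) auto
  hence "absval (((\<Prod>i\<in>G. 1 - x i) - 1) - x i * (\<Prod>i\<in>G. 1 - x i)) \<le> \<delta>"
    by (intro absval_diff_bound[OF IH]) (simp add: absval_mult)
  thus ?case using insert.hyps by (simp add: algebra_simps)
qed (use assms in auto)

text \<open>Let \<open>f\<close> be the monic polynomial with root set \<open>V\<close>. As
  polynomials in \<open>z\<close>, \<open>f(z + w)\<close> and \<open>f(z) + f(w)\<close> are monic
  of degree \<open>card V\<close>, and on \<open>V\<close> both take the value \<open>f(w)\<close>,
  the first because translation permutes \<open>V\<close>.\<close>

lemma prod_subgroup_additive:
  fixes V :: "'a::field set"
  assumes V: "finite V" "0 \<in> V" "\<And>u v. u \<in> V \<Longrightarrow> v \<in> V \<Longrightarrow> u + v \<in> V" "\<And>v. v \<in> V \<Longrightarrow> - v \<in> V"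
  shows "(\<Prod>v\<in>V. z + w - v) = (\<Prod>v\<in>V. z - v) + (\<Prod>v\<in>V. w - v)"
proof -
  define f where "f = (\<Prod>v\<in>V. [:-v, 1:])"
  define g where "g = (\<Prod>v\<in>V. [:w - v, 1:])"
  define n where "n = card V"
  have n: "n > 0" using V(1,2) by (auto simp: n_def card_gt_0_iff)
  have deg: "degree f = n" "degree g = n"
    unfolding f_def g_def n_def by (subst degree_prod_eq_sum_degree; auto)+
  have "lead_coeff f = 1" "lead_coeff g = 1"
    unfolding f_def g_def by (subst lead_coeff_prod; simp)+
  hence lc: "coeff f n = 1" "coeff g n = 1" using deg by simp_all
  have "g = f + [:poly f w:]"
  proof (rule poly_eqI_degree_lead_coeff[where A = V and n = n])
    show "coeff g n = coeff (f + [:poly f w:]) n"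
      using lc n by (simp add: coeff_pCons split: nat.splits)
    show "degree (f + [:poly f w:]) \<le> n"
      by (rule degree_add_le) (use deg in auto)
    fix v assume v: "v \<in> V"
    have "poly g v = (\<Prod>u\<in>V. w - (u - v))"
      by (simp add: g_def poly_prod algebra_simps)
    also have "\<dots> = (\<Prod>u\<in>V. w - u)"
      by (rule prod.reindex_bij_witness[of _ "\<lambda>u. u + v" "\<lambda>u. u - v"])
        (use v V(3) V(3)[OF _ V(4)] in auto)
    also have "\<dots> = poly f w"
      by (simp add: f_def poly_prod)
    finally show "poly g v = poly (f + [:poly f w:]) v"
      using v V(1) by (auto simp: f_def poly_prod)
  qed (use deg n_def in auto)
  hence "poly g z = poly f z + poly f w" by simp
  thus ?thesis by (simp add: f_def g_def poly_prod algebra_simps)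
qed

lemma finite_degree_less: "finite {a :: 'f::{finite, zero} poly. degree a < N}"
proof (induction N)
  case (Suc N)
  have "{a :: 'f poly. degree a < Suc N} \<subseteq> (\<lambda>(c, a). pCons c a) ` (UNIV \<times> insert 0 {a. degree a < N})"
  proof
    fix b :: "'f poly" assume b: "b \<in> {a. degree a < Suc N}"
    obtain c a where ca: "b = pCons c a" by (cases b)
    have "a = 0 \<or> degree a < N" using b ca by (cases "a = 0") auto
    thus "b \<in> (\<lambda>(c, a). pCons c a) ` (UNIV \<times> insert 0 {a. degree a < N})"
      using ca by (auto intro!: image_eqI[of _ _ "(c, a)"])
  qed
  moreover have "finite ((\<lambda>(c :: 'f, a). pCons c a) ` (UNIV \<times> insert 0 {a. degree a < N}))"
    using Suc by simp
  ultimately show ?case by (rule finite_subset)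
qed simp

section \<open>The product over the lattice and its functional equations\<close>

locale carlitz_uniformization = carlitz \<iota> q
  for \<iota> :: "'f::finite_field poly fract \<Rightarrow> 'c::complete_valued_field" and q :: nat +
  fixes \<pi> :: 'c
  assumes period: "carlitz_period \<iota> \<pi>"
begin

lemma period_nonzero: "\<pi> \<noteq> 0"
  using period by (simp add: carlitz_period_def)

text \<open>Partial products of \<open>exp_lattice\<close> at \<open>\<pi> z\<close> for the lattice
  \<open>\<pi> A\<close>, with \<open>\<pi>\<close> cancelled in every factor.\<close>

definition lattice_prod :: "'c \<Rightarrow> 'f poly set \<Rightarrow> 'c" where
  "lattice_prod z F = (\<Prod>a\<in>F. 1 - z / emb a)"

definition ball_A :: "nat \<Rightarrow> 'f poly set" where
  "ball_A N = {a. a \<noteq> 0 \<and> degree a < N}"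

definition lattice_lim :: "'c \<Rightarrow> 'c" where
  "lattice_lim z = Lim (finite_subsets_at_top (- {0})) (lattice_prod z)"

definition carlitz_exp :: "'c \<Rightarrow> 'c" where
  "carlitz_exp z = exp_lattice (period_lattice \<iota> \<pi>) (\<pi> * z)"

lemma finite_ball_A: "finite (ball_A N)"
  by (rule finite_subset[OF _ finite_degree_less[of N]]) (auto simp: ball_A_def)

text \<open>A factor with \<open>deg a \<ge> N\<close> differs from 1 by at most
  \<open>|z| / q^N < 1\<close>, and by the ultrametric inequality so does any finite product of
  them. This bounds the relative error.\<close>

lemma lattice_prod_diff_le:
  assumes z: "absval z < real q ^ N" and F: "finite F" "ball_A N \<subseteq> F" "F \<subseteq> - {0}"
  shows "absval (lattice_prod z F - lattice_prod z (ball_A N)) \<le>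
    absval (lattice_prod z (ball_A N)) * (absval z / real q ^ N)"
proof -
  have q1: "real q ^ N > 0" using q2 by simp
  have "lattice_prod z F = lattice_prod z (ball_A N) * lattice_prod z (F - ball_A N)"
    unfolding lattice_prod_def using F by (metis mult.commute prod.subset_diff)
  hence "lattice_prod z F - lattice_prod z (ball_A N) =
      lattice_prod z (ball_A N) * (lattice_prod z (F - ball_A N) - 1)"
    by (simp add: algebra_simps)
  moreover have "absval (lattice_prod z (F - ball_A N) - 1) \<le> absval z / real q ^ N"
    unfolding lattice_prod_def
  proof (rule absval_prod_one_minus)
    fix a assume a: "a \<in> F - ball_A N"
    hence a0: "a \<noteq> 0" "N \<le> degree a" using F(3) by (auto simp: ball_A_def)
    have "real q ^ N \<le> real q ^ degree a" using a0 q2 by (intro power_increasing) auto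
    thus "absval (z / emb a) \<le> absval z / real q ^ N"
      using a0 q1 by (simp add: absval_divide absval_emb_A frac_le)
  qed (use z q1 in auto)
  ultimately show ?thesis
    by (simp only: absval_mult) (intro mult_left_mono absval_nonneg)
qed

lemma absval_lattice_prod:
  assumes z: "absval z < real q ^ N" and F: "finite F" "ball_A N \<subseteq> F" "F \<subseteq> - {0}"
  shows "absval (lattice_prod z F) = absval (lattice_prod z (ball_A N))"
proof (cases "lattice_prod z (ball_A N) = 0")
  case True
  thus ?thesis using lattice_prod_diff_le[OF assms] by simp
next
  case False
  have "absval z / real q ^ N < 1" using z q2 by simp
  hence "absval (lattice_prod z (ball_A N)) * (absval z / real q ^ N) < absval (lattice_prod z (ball_A N)) * 1"
    using False by (intro mult_strict_left_mono) auto
  hence "absval (lattice_prod z F - lattice_prod z (ball_A N)) < absval (lattice_prod z (ball_A N))"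
    using lattice_prod_diff_le[OF assms] by simp
  from absval_add_eq[OF this] show ?thesis by simp
qed

lemma exists_power_greater: "\<exists>N. x < real q ^ N"
  using real_arch_pow[of "real q" x] q2 by auto

lemma lattice_prod_tendsto: "(lattice_prod z \<longlongrightarrow> lattice_lim z) (finite_subsets_at_top (- {0}))"
proof -
  obtain N0 where N0: "absval z < real q ^ N0" using exists_power_greater by blast
  define D where "D = absval (lattice_prod z (ball_A N0))"
  obtain s where s: "(lattice_prod z \<longlongrightarrow> s) (finite_subsets_at_top (- {0}))"
  proof (rule ultrametric_net_converges)
    fix e :: real assume e: "e > 0"
    obtain N1 where N1: "D * absval z / e < real q ^ N1" using exists_power_greater by blast
    define N where "N = max N0 N1"
    have "real q ^ N0 \<le> real q ^ N" "real q ^ N1 \<le> real q ^ N"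
      unfolding N_def using q2 by (intro power_increasing; auto)+
    hence N: "absval z < real q ^ N" "D * absval z / e < real q ^ N" using N0 N1 by linarith+
    have "ball_A N0 \<subseteq> ball_A N" by (auto simp: ball_A_def N_def)
    hence D: "absval (lattice_prod z (ball_A N)) = D"
      unfolding D_def by (intro absval_lattice_prod N0 finite_ball_A) (auto simp: ball_A_def)
    have "D * (absval z / real q ^ N) \<le> e"
      using N(2) e q2 by (simp add: field_simps)
    hence "absval (lattice_prod z F - lattice_prod z (ball_A N)) \<le> e"
      if "finite F \<and> ball_A N \<subseteq> F \<and> F \<subseteq> - {0}" for F
      using lattice_prod_diff_le[OF N(1), of F] that D by simp
    thus "\<exists>F0. finite F0 \<and> F0 \<subseteq> - {0} \<and> (\<forall>F. finite F \<and> F0 \<subseteq> F \<and> F \<subseteq> - {0} \<longrightarrow>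
        absval (lattice_prod z F - lattice_prod z F0) \<le> e)"
      by (intro exI[of _ "ball_A N"]) (simp add: finite_ball_A, auto simp: ball_A_def)
  qed (rule that)
  moreover from s have "lattice_lim z = s"
    unfolding lattice_lim_def by (intro tendsto_Lim) auto
  ultimately show ?thesis by simp
qed

text \<open>A relative error below 1 cannot change the absolute value. Zeros and lower bounds of the
  infinite product can therefore be read off a finite one.\<close>

lemma absval_lattice_lim:
  assumes z: "absval z < real q ^ N"
  shows "absval (lattice_lim z) = absval (lattice_prod z (ball_A N))"
proof -
  have le: "absval (lattice_lim z - lattice_prod z (ball_A N)) \<le>
      absval (lattice_prod z (ball_A N)) * (absval z / real q ^ N)"
    by (rule tendsto_absval_le[OF lattice_prod_tendsto finite_ball_A])
       (use lattice_prod_diff_le[OF z] in \<open>auto simp: ball_A_def\<close>)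
  show ?thesis
  proof (cases "lattice_prod z (ball_A N) = 0")
    case True
    thus ?thesis using le by simp
  next
    case False
    have "absval z / real q ^ N < 1" using z q2 by simp
    hence "absval (lattice_prod z (ball_A N)) * (absval z / real q ^ N) < absval (lattice_prod z (ball_A N)) * 1"
      using False by (intro mult_strict_left_mono) auto
    hence "absval (lattice_lim z - lattice_prod z (ball_A N)) < absval (lattice_prod z (ball_A N))"
      using le by simp
    from absval_add_eq[OF this] show ?thesis by simp
  qed
qed

text \<open>Reindexing the finite subsets along \<open>a \<mapsto> \<pi> a\<close> shows that the
  \<open>Lim\<close> in \<open>exp_lattice\<close> is an actual limit.\<close>

lemma carlitz_exp_eq: "carlitz_exp z = \<pi> * z * lattice_lim z"
proof -
  define f where "f a = \<pi> * emb a" for a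
  have inj: "inj_on f (- {0})"
    using period_nonzero by (auto simp: inj_on_def f_def emb_A_eq_iff)
  have img: "period_lattice \<iota> \<pi> - {0} = f ` (- {0})"
    using period_nonzero by (auto simp: period_lattice_def f_def emb_A_eq_0_iff)
  have "((\<lambda>F. \<Prod>l\<in>F. 1 - \<pi> * z / l) \<longlongrightarrow> lattice_lim z) (finite_subsets_at_top (f ` (- {0})))"
    unfolding filtermap_image_finite_subsets_at_top[OF inj, symmetric] filterlim_filtermap
  proof (rule Lim_transform_eventually[OF lattice_prod_tendsto])
    show "eventually (\<lambda>F. lattice_prod z F = (\<Prod>l\<in>f ` F. 1 - \<pi> * z / l)) (finite_subsets_at_top (- {0}))"
    proof (rule eventually_finite_subsets_at_top_weakI)
      fix F assume F: "finite F" "F \<subseteq> - {0::'f poly}"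
      have "(\<Prod>l\<in>f ` F. 1 - \<pi> * z / l) = (\<Prod>a\<in>F. 1 - \<pi> * z / f a)"
        using inj_on_subset[OF inj F(2)] by (simp add: prod.reindex)
      also have "\<dots> = lattice_prod z F"
        unfolding lattice_prod_def f_def using period_nonzero by simp
      finally show "lattice_prod z F = (\<Prod>l\<in>f ` F. 1 - \<pi> * z / l)" ..
    qed
  qed
  hence "Lim (finite_subsets_at_top (f ` (- {0}))) (\<lambda>F. \<Prod>l\<in>F. 1 - \<pi> * z / l) = lattice_lim z"
    by (intro tendsto_Lim) auto
  thus ?thesis by (simp add: carlitz_exp_def exp_lattice_def img)
qed

lemma ball_A_tendsto: "(\<lambda>N. lattice_prod z (ball_A N)) \<longlonglongrightarrow> lattice_lim z"
proof (rule filterlim_compose[OF lattice_prod_tendsto])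
  show "filterlim ball_A (finite_subsets_at_top (- {0})) sequentially"
    unfolding filterlim_finite_subsets_at_top
  proof (intro allI impI)
    fix X :: "'f poly set" assume X: "finite X \<and> X \<subseteq> - {0}"
    define M where "M = Max (insert 0 (degree ` X))"
    have M: "degree a \<le> M" if "a \<in> X" for a
      unfolding M_def using X that by (intro Max_ge) auto
    show "eventually (\<lambda>N. finite (ball_A N) \<and> X \<subseteq> ball_A N \<and> ball_A N \<subseteq> - {0}) sequentially"
      using eventually_gt_at_top[of M]
    proof eventually_elim
      case (elim N)
      have "X \<subseteq> ball_A N" using X M elim by (fastforce simp: ball_A_def)
      thus ?case by (auto simp: finite_ball_A) (auto simp: ball_A_def)
    qed
  qed
qed

text \<open>Up to the constant \<open>K\<close>, the function is the monic polynomial whose roots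
  are the additive group of polynomials of degree below \<open>N\<close>.\<close>

lemma lattice_prod_additive:
  "(z + w) * lattice_prod (z + w) (ball_A N) = z * lattice_prod z (ball_A N) + w * lattice_prod w (ball_A N)"
\<comment> \<open>For \<open>N = 0\<close> the set \<open>V\<close> below would be empty and not
  contain 0, since \<open>degree 0 = 0\<close>.\<close>
proof (cases "N = 0")
  case True
  thus ?thesis by (simp add: ball_A_def lattice_prod_def)
next
  case False
  define V where "V = emb ` {a. degree a < N}"
  define K where "K = (\<Prod>a\<in>ball_A N. - emb a)"
  have "K \<noteq> 0"
    unfolding K_def by (subst prod_zero_iff[OF finite_ball_A]) (auto simp: ball_A_def emb_A_eq_0_iff)
  have eq: "(\<Prod>v\<in>V. x - v) = K * (x * lattice_prod x (ball_A N))" for x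
  proof -
    have "(\<Prod>v\<in>V. x - v) = (\<Prod>a\<in>{a. degree a < N}. x - emb a)"
      unfolding V_def by (simp add: prod.reindex inj_on_def emb_A_eq_iff)
    also have "{a. degree a < N} = insert 0 (ball_A N)"
      using False by (auto simp: ball_A_def)
    also have "(\<Prod>a\<in>\<dots>. x - emb a) = x * (\<Prod>a\<in>ball_A N. x - emb a)"
      by (subst prod.insert[OF finite_ball_A]) (auto simp: ball_A_def emb_A_0)
    also have "(\<Prod>a\<in>ball_A N. x - emb a) = (\<Prod>a\<in>ball_A N. - emb a * (1 - x / emb a))"
      by (intro prod.cong refl) (auto simp: ball_A_def emb_A_eq_0_iff field_simps)
    also have "\<dots> = K * lattice_prod x (ball_A N)"
      unfolding K_def lattice_prod_def by (rule prod.distrib)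
    finally show ?thesis by (simp add: mult_ac)
  qed
  have "(\<Prod>v\<in>V. z + w - v) = (\<Prod>v\<in>V. z - v) + (\<Prod>v\<in>V. w - v)"
  proof (rule prod_subgroup_additive)
    show "finite V" unfolding V_def by (intro finite_imageI finite_degree_less)
    show "0 \<in> V" unfolding V_def using False emb_A_0 by (intro image_eqI[of _ _ 0]) auto
    show "u + v \<in> V" if "u \<in> V" "v \<in> V" for u v
    proof -
      from that obtain a b where ab: "u = emb a" "v = emb b" "degree a < N" "degree b < N"
        unfolding V_def by blast
      thus ?thesis unfolding V_def
        by (intro image_eqI[of _ _ "a + b"]) (auto simp: emb_A_add intro: degree_add_less)
    qed
    show "- v \<in> V" if "v \<in> V" for v
    proof -
      from that obtain b where b: "v = emb b" "degree b < N" unfolding V_def by blast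
      thus ?thesis unfolding V_def
        by (intro image_eqI[of _ _ "- b"]) (auto simp: emb_A_minus)
    qed
  qed
  thus ?thesis using \<open>K \<noteq> 0\<close> unfolding eq by (simp flip: distrib_left)
qed

lemma carlitz_exp_add: "carlitz_exp (z + w) = carlitz_exp z + carlitz_exp w"
proof -
  have "(\<lambda>N. z * lattice_prod z (ball_A N) + w * lattice_prod w (ball_A N)) \<longlonglongrightarrow>
      z * lattice_lim z + w * lattice_lim w"
    by (intro tendsto_add_valued tendsto_mult_left_valued ball_A_tendsto)
  moreover have "(\<lambda>N. (z + w) * lattice_prod (z + w) (ball_A N)) \<longlonglongrightarrow> (z + w) * lattice_lim (z + w)"
    by (intro tendsto_mult_left_valued ball_A_tendsto)
  ultimately have "(z + w) * lattice_lim (z + w) = z * lattice_lim z + w * lattice_lim w"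
    unfolding lattice_prod_additive by (rule LIMSEQ_unique[rotated])
  thus ?thesis by (simp add: carlitz_exp_eq mult.assoc flip: distrib_left)
qed

lemma carlitz_exp_diff: "carlitz_exp (z - w) = carlitz_exp z - carlitz_exp w"
  using carlitz_exp_add[of "z - w" w] by simp

lemma carlitz_exp_\<kappa>: "carlitz_exp (\<kappa> c * z) = \<kappa> c * carlitz_exp z"
proof (cases "c = 0")
  case True
  thus ?thesis by (simp add: emb0 carlitz_exp_eq)
next
  case False
  have \<kappa>: "\<kappa> c \<noteq> 0" using absval_\<kappa>[OF False] by auto
  have "\<kappa> c * \<kappa> (inverse c) = 1" using False by (simp add: emb1 flip: embM)
  hence \<kappa>': "\<kappa> (inverse c) = inverse (\<kappa> c)" by (metis inverse_unique)
  have "lattice_prod (\<kappa> c * z) (ball_A N) = lattice_prod z (ball_A N)" for N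
    unfolding lattice_prod_def
    by (rule prod.reindex_bij_witness[of _ "smult c" "smult (inverse c)"])
       (use False \<kappa> in \<open>auto simp: ball_A_def emb_A_smult \<kappa>' divide_inverse mult_ac\<close>)
  hence "lattice_lim (\<kappa> c * z) = lattice_lim z"
    using ball_A_tendsto[of "\<kappa> c * z"] ball_A_tendsto[of z] by (auto intro: LIMSEQ_unique)
  thus ?thesis by (simp add: carlitz_exp_eq)
qed

text \<open>The period condition is the case \<open>a = T\<close>; additivity and linearity over the
  constants carry it through the Horner recursion.\<close>

lemma carlitz_exp_emb: "carlitz_exp (emb a * z) = poly (carlitz_poly a) (carlitz_exp z)"
proof (induction a)
  case 0
  thus ?case by (simp add: emb_A_0 carlitz_exp_eq)
next
  case (pCons c a)
  have "carlitz_exp (emb [:0, 1:] * x) = carlitz_T \<iota> (carlitz_exp x)" for x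
    using period by (simp add: carlitz_period_def carlitz_exp_def mult.left_commute[of \<pi>])
  moreover have "emb (pCons c a) * z = \<kappa> c * z + emb [:0, 1:] * (emb a * z)"
    by (subst emb_A_pCons) (simp add: algebra_simps)
  ultimately show ?case
    by (simp add: carlitz_exp_add carlitz_exp_\<kappa> pCons.IH poly_carlitz_poly_pCons)
qed

lemma carlitz_exp_nonzero:
  assumes "z \<notin> range emb"
  shows "carlitz_exp z \<noteq> 0"
proof -
  obtain N where N: "absval z < real q ^ N" using exists_power_greater by blast
  have "lattice_prod z (ball_A N) \<noteq> 0"
    unfolding lattice_prod_def prod_zero_iff[OF finite_ball_A]
    using assms by (auto simp: ball_A_def emb_A_eq_0_iff)
  hence "lattice_lim z \<noteq> 0" using absval_lattice_lim[OF N] by (metis absval_eq_0_iff)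
  moreover have "z \<noteq> 0" using assms emb_A_0 by (metis rangeI)
  ultimately show ?thesis using period_nonzero by (simp add: carlitz_exp_eq)
qed

text \<open>
  The points are square roots of odd powers of \<open>T\<close>: their absolute values are not attained on the
  completion of \<open>K\<close>.
\<close>

lemma exists_point:
  "\<exists>z\<in>Omega \<iota>. absval z ^ 2 = real q ^ (2 * r + 1) \<and> absval (carlitz_exp z) \<ge> absval \<pi> * absval z"
proof -
  obtain z where z: "z ^ 2 = emb ([:0, 1:] ^ (2 * r + 1))"
    using nth_root_exists[of 2] by auto
  have "[:0, 1:] ^ n \<noteq> (0 :: 'f poly)" for n by simp
  moreover have "degree ([:0, 1 :: 'f:] ^ n) = n" for n
    by (simp add: degree_power_eq)
  ultimately have z2: "absval z ^ 2 = real q ^ (2 * r + 1)"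
    using absval_emb_A[of "[:0, 1:] ^ (2 * r + 1)"] z by (simp flip: absval_power)
  have parity: "absval z * real q ^ n \<noteq> real q ^ m" for m n
  proof
    assume "absval z * real q ^ n = real q ^ m"
    hence "(absval z * real q ^ n) ^ 2 = (real q ^ m) ^ 2" by simp
    hence "real q ^ (2 * r + 1 + 2 * n) = real q ^ (2 * m)"
      unfolding power_mult_distrib z2 by (simp only: power_add mult.commute[of 2] power_mult)
    hence "2 * r + 1 + 2 * n = 2 * m"
      using q2 by (subst (asm) power_inject_exp) auto
    thus False by presburger
  qed
  have z0: "absval z > 0" using z2 q2 by (cases "z = 0") auto
  have "z \<in> Omega \<iota>"
    unfolding Omega_def K_inf_def
  proof (rule ComplI)
    assume "z \<in> closure (range \<iota>)"
    then obtain x where x: "dist (\<iota> x) z < absval z"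
      using z0 unfolding closure_approachable by blast
    have "absval ((\<iota> x - z) + z) = absval z"
      using x by (intro absval_add_eq) (simp add: dist_eq_absval)
    hence xz: "absval (\<iota> x) = absval z" by simp
    obtain a b where ab: "b \<noteq> 0" "x = to_fract a / to_fract b"
      by (metis Fract_cases Fract_conv_to_fract)
    have "\<iota> x * emb b = emb a"
      using ab by (simp add: emb_A_def flip: emb_mult)
    moreover have "a \<noteq> 0"
    proof
      assume "a = 0"
      hence "\<iota> x = 0" using \<open>\<iota> x * emb b = emb a\<close> ab emb_A_eq_0_iff[of b] by (simp add: emb_A_0)
      thus False using xz z0 by simp
    qed
    ultimately have "absval z * real q ^ degree b = real q ^ degree a"
      using xz ab by (metis absval_mult absval_emb_A)
    thus False using parity by blast
  qed
  moreover have "absval (carlitz_exp z) \<ge> absval \<pi> * absval z"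
  proof -
    obtain N where N: "absval z < real q ^ N" using exists_power_greater by blast
    \<comment> \<open>Because \<open>|z| \<noteq> |a|\<close>, the absolute value of the factor is
      the maximum of \<open>1\<close> and \<open>|z / a|\<close>.\<close>
    have "1 \<le> absval (1 - z / emb a)" if "a \<noteq> 0" for a
    proof -
      have "absval z \<noteq> absval (emb a)"
        using parity[of 0 "degree a"] that by (simp add: absval_emb_A)
      hence "absval (z / emb a) \<noteq> absval (1 :: 'c)"
        using that emb_A_eq_0_iff[of a] by (simp add: absval_divide)
      hence "absval (1 - z / emb a) = max (absval (1 :: 'c)) (absval (z / emb a))"
        by (metis absval_diff_eq_max)
      thus ?thesis by simp
    qed
    hence "1 \<le> absval (lattice_prod z (ball_A N))"
      unfolding lattice_prod_def absval_prod by (intro prod_ge_1) (auto simp: ball_A_def)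
    hence "1 \<le> absval (lattice_lim z)" using absval_lattice_lim[OF N] by simp
    hence "absval \<pi> * absval z * 1 \<le> absval \<pi> * absval z * absval (lattice_lim z)"
      by (intro mult_left_mono) simp_all
    thus ?thesis
      by (simp add: carlitz_exp_eq absval_mult)
  qed
  ultimately show ?thesis using z2 by blast
qed

section \<open>The form \<open>h\<close> as a series in the Carlitz exponential\<close>

definition h_series :: "'c \<Rightarrow> 'c" where
  "h_series x = (\<Sum>\<^sub>\<infinity>a\<in>{a. lead_coeff a = 1}. emb a ^ q / poly (carlitz_poly a) x)"

lemma drinfeld_h_eq: "drinfeld_h \<iota> \<pi> z = h_series (carlitz_exp z)"
proof -
  have "t_param \<iota> \<pi> (emb a * z) = 1 / poly (carlitz_poly a) (carlitz_exp z)" for a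
    using carlitz_exp_emb[of a z] by (simp add: t_param_def carlitz_exp_def)
  thus ?thesis by (simp add: drinfeld_h_def h_series_def flip: q_def)
qed

text \<open>The term of a monic \<open>a\<close> has size
  \<open>q^(q deg a) / |x|^(q^deg a)\<close>. For large \<open>x\<close> this is largest at the
  smallest degree \<open>N\<close>, and the ultrametric tail is bounded by that term.\<close>

lemma h_series_tail:
  "O_inf (q ^ N) (\<lambda>x. h_series x - (\<Sum>a\<in>monic_below N. emb a ^ q / poly (carlitz_poly a) x))"
proof (rule O_infI)
  \<comment> \<open>With this radius each degree gains a factor \<open>q^q\<close>, which pays for
    the numerator \<open>a^q\<close>, and one more factor \<open>q\<close>, which makes the terms
    tend to 0.\<close>
  fix x :: 'c assume x: "absval x \<ge> real q ^ (q + 1)"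
  have "real q ^ 1 < real q ^ (q + 1)" using q2 by (intro power_strict_increasing) auto
  hence xq: "absval x > real q" using x by simp
  have x1: "absval x > 1" using xq q2 by linarith
  define T where "T a = absval (emb a ^ q / poly (carlitz_poly a) x)" for a
  have T: "T a = real q ^ (degree a * q) / absval x ^ (q ^ degree a)" if "lead_coeff a = 1" for a
  proof -
    have "a \<noteq> 0" using that by auto
    thus ?thesis
      using absval_carlitz_poly[OF xq, of a]
      by (simp add: T_def absval_divide absval_power absval_emb_A power_mult)
  qed
  have small: "T a \<le> 1 / real q ^ degree a" if a: "lead_coeff a = 1" for a
  proof -
    have "degree a \<le> q ^ degree a" using power_gt_expt[of q "degree a"] q2 by simp
    hence "(real q ^ (q + 1)) ^ degree a \<le> absval x ^ (q ^ degree a)"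
      using x x1 by (intro order_trans[OF power_mono power_increasing]) auto
    also have "(real q ^ (q + 1)) ^ degree a = real q ^ (degree a * q) * real q ^ degree a"
      by (simp flip: power_mult power_add add: algebra_simps)
    finally have "real q ^ (degree a * q) * real q ^ degree a \<le> absval x ^ (q ^ degree a)" .
    moreover have "absval x > 0" using x1 by linarith
    hence "absval x ^ (q ^ degree a) > 0" by (rule zero_less_power)
    moreover have "real q ^ degree a > 0" using q2 by simp
    ultimately show ?thesis unfolding T[OF a] by (simp add: field_simps)
  qed
  have "absval (infsum (\<lambda>a. emb a ^ q / poly (carlitz_poly a) x) {a. lead_coeff a = 1}
      - (\<Sum>a\<in>monic_below N. emb a ^ q / poly (carlitz_poly a) x)) \<le> real q ^ (N * q) / absval x ^ (q ^ N)"
  proof (rule infsum_absval_diff_le)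
    fix e :: real assume e: "e > 0"
    obtain M where M: "1 / e < real q ^ M" using exists_power_greater by blast
    have "degree a < M" if "lead_coeff a = 1" "T a \<ge> e" for a
    proof (rule ccontr)
      assume "\<not> degree a < M"
      hence "real q ^ M \<le> real q ^ degree a" using q2 by (intro power_increasing) auto
      hence "1 / e < real q ^ degree a" using M by linarith
      hence "1 / real q ^ degree a < e" using e q2 by (simp add: field_simps)
      thus False using small[OF that(1)] that(2) by linarith
    qed
    hence "{a \<in> {a. lead_coeff a = 1}. e \<le> absval (emb a ^ q / poly (carlitz_poly a) x)} \<subseteq> {a. degree a < M}"
      by (auto simp: T_def)
    thus "finite {a \<in> {a. lead_coeff a = 1}. e \<le> absval (emb a ^ q / poly (carlitz_poly a) x)}"
      by (rule finite_subset) (rule finite_degree_less)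
  next
    show "finite (monic_below N :: 'f poly set)" by (rule finite_monic_below)
    show "monic_below N \<subseteq> {a :: 'f poly. lead_coeff a = 1}" by (auto simp: monic_below_def)
    fix a :: "'f poly" assume "a \<in> {a. lead_coeff a = 1} - monic_below N"
    hence a: "lead_coeff a = 1" "N \<le> degree a" by (auto simp: monic_below_def)
    then obtain k where k: "degree a = N + k" using le_Suc_ex by blast
    \<comment> \<open>The \<open>k\<close> additional powers of \<open>x\<close> compensate the
      factor \<open>q^(q k)\<close> by which the numerator grows from degree \<open>N\<close> to
      degree \<open>N + k\<close>.\<close>
    have "q ^ N + k \<le> q ^ (N + k)"
    proof -
      have "k < q ^ k" using power_gt_expt[of q k] q2 by simp
      hence "q ^ N * Suc k \<le> q ^ N * q ^ k" by (intro mult_le_mono2) simp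
      moreover have "1 * k \<le> q ^ N * k" using q2 by (intro mult_le_mono1) simp
      hence "k \<le> q ^ N * k" by simp
      ultimately show ?thesis by (simp only: power_add mult_Suc_right)
    qed
    hence "absval x ^ (q ^ N + k) \<le> absval x ^ (q ^ degree a)"
      unfolding k using x1 by (intro power_increasing) auto
    moreover have "absval x ^ (q ^ N) * real q ^ (q * k) \<le> absval x ^ (q ^ N + k)"
    proof -
      have "real q ^ q \<le> absval x"
      proof -
        have "real q ^ q \<le> real q ^ (q + 1)" using q2 by (intro power_increasing) auto
        thus ?thesis using x by linarith
      qed
      hence "(real q ^ q) ^ k \<le> absval x ^ k" by (intro power_mono) auto
      thus ?thesis using x1 by (simp add: power_add power_mult mult_left_mono)
    qed
    ultimately have le: "absval x ^ (q ^ N) * real q ^ (q * k) \<le> absval x ^ (q ^ degree a)" by simp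
    have "absval x > 0" using x1 by linarith
    hence pos: "absval x ^ (q ^ N) * real q ^ (q * k) > 0"
      using q2 by (intro mult_pos_pos zero_less_power) simp_all
    have "T a \<le> real q ^ (degree a * q) / (absval x ^ (q ^ N) * real q ^ (q * k))"
      unfolding T[OF a(1)] by (rule divide_left_mono[OF le]) (use pos le in auto)
    also have "\<dots> = real q ^ (N * q) / absval x ^ (q ^ N)"
      using q2 by (simp add: k algebra_simps power_add)
    finally show "absval (emb a ^ q / poly (carlitz_poly a) x) \<le> real q ^ (N * q) / absval x ^ (q ^ N)"
      by (simp add: T_def)
  qed simp
  moreover have "absval x > 0" using x1 by linarith
  hence "absval x ^ (q ^ N) > 0" by (rule zero_less_power)
  ultimately show "absval (h_series x - (\<Sum>a\<in>monic_below N. emb a ^ q / poly (carlitz_poly a) x)) * absval x ^ (q ^ N)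
      \<le> real q ^ (N * q)"
    by (simp add: h_series_def pos_le_divide_eq)
qed

end

section \<open>The Hecke operator at infinity\<close>

lemma card_degree_less: "card {a :: 'f::{finite, field} poly. degree a < Suc N} = CARD('f) ^ Suc N"
proof (induction N)
  case 0
  have "{a :: 'f poly. degree a < Suc 0} = range (\<lambda>c. [:c:])"
    by (auto simp: degree_eq_zeroE elim: degree_eq_zeroE)
  thus ?case by (simp add: card_image inj_def)
next
  case (Suc N)
  have "{a :: 'f poly. degree a < Suc (Suc N)} = (\<lambda>(c, a). pCons c a) ` (UNIV \<times> {a. degree a < Suc N})"
  proof
    show "{a :: 'f poly. degree a < Suc (Suc N)} \<subseteq> (\<lambda>(c, a). pCons c a) ` (UNIV \<times> {a. degree a < Suc N})"
    proof
      fix b :: "'f poly" assume b: "b \<in> {a. degree a < Suc (Suc N)}"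
      obtain c a where ca: "b = pCons c a" by (cases b)
      have "degree a < Suc N" using b ca by (cases "a = 0") auto
      thus "b \<in> (\<lambda>(c, a). pCons c a) ` (UNIV \<times> {a. degree a < Suc N})"
        using ca by (auto intro!: image_eqI[of _ _ "(c, a)"])
    qed
  qed (auto simp: degree_pCons_eq_if)
  moreover have "inj_on (\<lambda>(c :: 'f, a). pCons c a) (UNIV \<times> {a. degree a < Suc N})"
    by (auto simp: inj_on_def)
  ultimately show ?case using Suc by (simp add: card_image card_cartesian_product)
qed

lemma absval_poly_bounded:
  fixes f :: "'a::complete_valued_field poly"
  obtains M where "\<And>x. absval x \<le> B \<Longrightarrow> absval (poly f x) \<le> M"
proof
  fix x :: 'a assume x: "absval x \<le> B"
  show "absval (poly f x) \<le> (\<Sum>n\<le>degree f. absval (coeff f n) * B ^ n)"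
    unfolding poly_altdef
  proof (rule absval_sum_bound)
    have B: "B \<ge> 0" using x absval_nonneg order_trans by blast
    thus "0 \<le> (\<Sum>n\<le>degree f. absval (coeff f n) * B ^ n)" by (intro sum_nonneg) simp
    fix n assume n: "n \<in> {..degree f}"
    have "absval (coeff f n * x ^ n) \<le> absval (coeff f n) * B ^ n"
      using x by (simp add: absval_mult absval_power mult_left_mono power_mono)
    also have "\<dots> \<le> (\<Sum>n\<le>degree f. absval (coeff f n) * B ^ n)"
      by (rule member_le_sum) (use n B in auto)
    finally show "absval (coeff f n * x ^ n) \<le> (\<Sum>n\<le>degree f. absval (coeff f n) * B ^ n)" .
  qed
qed

lemma O_inf_power_diff:
  assumes "O_inf m (\<lambda>x. f x - g x)" "O_inf 0 f" "O_inf 0 g"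
  shows "O_inf m (\<lambda>x. f x ^ k - g x ^ k)"
proof (induction k)
  case (Suc k)
  have "O_inf (0 + m) (\<lambda>x. f x * (f x ^ k - g x ^ k))"
    by (intro O_inf_mult assms Suc)
  moreover have "O_inf (m + 0 * k) (\<lambda>x. (f x - g x) * g x ^ k)"
    by (intro O_inf_mult O_inf_power assms)
  ultimately have "O_inf m (\<lambda>x. f x * (f x ^ k - g x ^ k) + (f x - g x) * g x ^ k)"
    by (intro O_inf_add) simp_all
  thus ?case by (simp add: algebra_simps)
qed (simp add: O_inf_0)

context carlitz_uniformization
begin

lemma carlitz_exp_emb_A: "carlitz_exp (emb a) = 0"
proof -
  obtain N where N: "absval 1 < real q ^ N" "N > 0"
  proof -
    have "absval (1 :: 'c) < real q ^ 1" using q2 by simp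
    thus ?thesis using that[of 1] by simp
  qed
  have "lattice_prod 1 (ball_A N) = 0"
    unfolding lattice_prod_def prod_zero_iff[OF finite_ball_A] using N(2)
    by (intro bexI[of _ 1]) (auto simp: ball_A_def emb_A_1)
  hence "lattice_lim 1 = 0" using absval_lattice_lim[of 1 N] N(1) by simp
  hence "carlitz_exp 1 = 0" by (simp add: carlitz_exp_eq)
  thus ?thesis using carlitz_exp_emb[of a 1] by (simp add: poly_0_coeff_0)
qed

text \<open>The exponential vanishes exactly on \<open>A\<close>, so equal values at two shifts mean
  that these are congruent modulo \<open>P\<close>, hence equal by degree. The
  \<open>q ^ degree P\<close> distinct values exhaust the roots of
  \<open>\<phi>_P(x) = y\<close>.\<close>

lemma carlitz_poly_roots:
  fixes P :: "'f poly" and z :: 'c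
  defines "\<xi> \<equiv> \<lambda>\<beta>. carlitz_exp ((z + emb \<beta>) / emb P)"
  assumes P: "lead_coeff P = 1" "degree P > 0"
  shows "inj_on \<xi> {\<beta>. degree \<beta> < degree P}"
    and "\<And>\<beta>. poly (carlitz_poly P) (\<xi> \<beta>) = carlitz_exp z"
    and "carlitz_poly P - [:carlitz_exp z:] = (\<Prod>x\<in>\<xi> ` {\<beta>. degree \<beta> < degree P}. [:-x, 1:])"
proof -
  have P0: "P \<noteq> 0" "emb P \<noteq> 0" using P by (auto simp: emb_A_eq_0_iff)
  show root: "poly (carlitz_poly P) (\<xi> \<beta>) = carlitz_exp z" for \<beta>
    unfolding \<xi>_def using P0 carlitz_exp_emb_A
    by (simp add: carlitz_exp_add flip: carlitz_exp_emb)
  show inj: "inj_on \<xi> {\<beta>. degree \<beta> < degree P}"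
  proof (rule inj_onI, rule ccontr)
    fix a b assume ab: "a \<in> {\<beta>. degree \<beta> < degree P}" "b \<in> {\<beta>. degree \<beta> < degree P}"
      "\<xi> a = \<xi> b" "a \<noteq> b"
    have "carlitz_exp (emb (a - b) / emb P) = 0"
      using ab(3) unfolding \<xi>_def
      by (simp add: emb_A_diff diff_divide_distrib add_divide_distrib carlitz_exp_diff carlitz_exp_add)
    then obtain c where "emb (a - b) / emb P = emb c"
      using carlitz_exp_nonzero by blast
    hence "emb (a - b) = emb (c * P)" using P0 by (simp add: emb_A_mult field_simps)
    hence eq: "a - b = c * P" by (simp add: emb_A_eq_iff)
    hence "c \<noteq> 0" using ab(4) by auto
    hence "degree P \<le> degree (a - b)" using P0 by (simp add: eq degree_mult_eq)
    moreover have "degree (a - b) < degree P" using ab by (intro degree_diff_less) auto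
    ultimately show False by simp
  qed
  show "carlitz_poly P - [:carlitz_exp z:] = (\<Prod>x\<in>\<xi> ` {\<beta>. degree \<beta> < degree P}. [:-x, 1:])"
  proof (rule poly_eq_prod_roots)
    have "degree (carlitz_poly P + - [:carlitz_exp z:]) = degree (carlitz_poly P)"
      by (rule degree_add_eq_left) (use P P0 q2 in \<open>simp add: degree_carlitz_poly\<close>)
    hence deg: "degree (carlitz_poly P - [:carlitz_exp z:]) = q ^ degree P"
      using degree_carlitz_poly[OF P0(1)] by (simp only: diff_conv_add_uminus)
    obtain d where d: "degree P = Suc d" using P(2) by (cases "degree P") auto
    have "card {\<beta> :: 'f poly. degree \<beta> < degree P} = q ^ degree P"
      unfolding d using card_degree_less[where 'f = 'f] by (simp only: q_def)
    thus "degree (carlitz_poly P - [:carlitz_exp z:]) = card (\<xi> ` {\<beta>. degree \<beta> < degree P})"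
      by (simp only: deg card_image[OF inj])
    have "q ^ degree P \<noteq> 0" using q2 by simp
    hence "coeff [:carlitz_exp z:] (q ^ degree P) = 0"
      by (cases "q ^ degree P") simp_all
    thus "lead_coeff (carlitz_poly P - [:carlitz_exp z:]) = 1"
      unfolding deg by (simp add: coeff_carlitz_poly_top P emb1)
    show "finite (\<xi> ` {\<beta>. degree \<beta> < degree P})" by (intro finite_imageI finite_degree_less)
  qed (use root in auto)
qed

lemma O_inf_h_series_minus_inverse: "O_inf q (\<lambda>x. h_series x - 1 / x)"
proof -
  have "(\<Sum>a\<in>monic_below 1. emb a ^ q / poly (carlitz_poly a) x) = 1 / x" for x
    using sum_monic_below_Suc[of "\<lambda>a. emb a ^ q / poly (carlitz_poly a) x" 0]
    by (simp add: monic_below_0 emb_A_1 carlitz_poly_1 poly_monom)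
  thus ?thesis using h_series_tail[of 1] by simp
qed

lemma O_inf_h_series: "O_inf 1 h_series"
proof -
  have "O_inf 1 (\<lambda>x. (h_series x - 1 / x) + 1 / x ^ 1)"
    by (intro O_inf_add O_inf_inverse_power O_inf_mono[OF O_inf_h_series_minus_inverse])
       (use q2 in simp)
  thus ?thesis by simp
qed

text \<open>Both \<open>a \<mapsto> a^q\<close> and \<open>a \<mapsto> \<phi>_a(x)\<close> are
  linear over the constants, and \<open>|x| > q\<close> keeps \<open>\<phi>_a(x)\<close> away from 0
  for all nonzero \<open>a\<close>.\<close>

lemma h_series_below_power:
  assumes "absval x > real q" "1 \<le> j" "j \<le> q"
  shows "(\<Sum>a\<in>monic_below N. emb a ^ q / poly (carlitz_poly a) x) ^ j =
    (\<Sum>a\<in>monic_below N. emb a ^ (q * j) / poly (carlitz_poly a) x ^ j)"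
proof -
  have "(\<Sum>a\<in>monic_below N. emb a ^ q / poly (carlitz_poly a) x) ^ j =
    (\<Sum>a\<in>monic_below N. (emb a ^ q / poly (carlitz_poly a) x) ^ j)"
  proof (rule sum_linear_ratio_power)
    show "emb (a + b) ^ q = emb a ^ q + emb b ^ q" for a b
      by (simp add: emb_A_add add_power_q)
    show "emb (smult c a) ^ q = \<kappa> c * emb a ^ q" for c a
      by (simp add: emb_A_smult power_mult_distrib emb_power_q)
    show "poly (carlitz_poly a) x \<noteq> 0" if "a \<noteq> 0" for a
    proof -
      have "absval x > 0" using assms(1) q2 by linarith
      hence "absval (poly (carlitz_poly a) x) \<noteq> 0"
        unfolding absval_carlitz_poly[OF assms(1) that] by simp
      thus ?thesis by auto
    qed
  qed (use assms in \<open>simp_all add: carlitz_poly_add carlitz_poly_smult\<close>)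
  thus ?thesis by (simp add: power_divide power_mult)
qed

text \<open>
  The polynomial whose quotient by \<open>x\<^bsup>q^(deg a + N) + M\<^esup>\<close> approximates
  \<open>x\<^bsup>-M\<^esup> \<phi>_a(x)\<^bsup>-j\<^esup>\<close>: the relative error is the \<open>q\<^sup>N\<close>-th power of \<open>1 - \<phi>_a(x) / x\<^bsup>q^deg a\<^esup>\<close>.
\<close>

definition laurent_num :: "nat \<Rightarrow> nat \<Rightarrow> 'f poly \<Rightarrow> 'c poly" where
  "laurent_num N j a = carlitz_poly a ^ (q ^ N - j)"

lemma O_inf_laurent_approx:
  assumes a: "lead_coeff a = 1" and j: "j \<le> q ^ N"
  shows "O_inf (M + q ^ N) (\<lambda>x. 1 / x ^ M * (1 / poly (carlitz_poly a) x ^ j) -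
    poly (laurent_num N j a) x / x ^ (q ^ (degree a + N) + M))"
proof -
  define w where "w = carlitz_poly a"
  define i where "i = degree a"
  have a0: "a \<noteq> 0" using a by auto
  have deg: "degree w = q ^ i" using a0 by (simp add: w_def i_def degree_carlitz_poly)
  have lc: "lead_coeff w = 1" using coeff_carlitz_poly_top[of a] a deg by (simp add: w_def i_def emb1)
  \<comment> \<open>Cancelling the leading term gains one order. Raising to the power
    \<open>q^N\<close> multiplies this gain by \<open>q^N\<close>, and Frobenius rewrites the result
    as \<open>1 - (\<phi>_a / x^(q^i))^(q^N)\<close>.\<close>
  have "O_inf 1 (\<lambda>x. poly (monom 1 (q ^ i) - w) x / x ^ (q ^ i))"
  proof (rule O_inf_poly_divide)
    fix n assume n: "coeff (monom 1 (q ^ i) - w) n \<noteq> 0"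
    have "n \<noteq> q ^ i" using n lc deg by auto
    moreover have "n \<le> q ^ i"
    proof (rule ccontr)
      assume "\<not> n \<le> q ^ i"
      thus False using n deg by (simp add: coeff_eq_0)
    qed
    ultimately show "n + 1 \<le> q ^ i" by simp
  qed
  hence 1: "O_inf (1 * q ^ N) (\<lambda>x. (poly (monom 1 (q ^ i) - w) x / x ^ (q ^ i)) ^ (q ^ N))"
    by (rule O_inf_power)
  have "O_inf (0 * j) (\<lambda>x. (1 / poly w x) ^ j)"
    by (intro O_inf_power O_inf_mono[OF O_inf_inverse_poly[OF lc]]) simp
  hence 2: "O_inf (M + 0) (\<lambda>x. 1 / x ^ M * (1 / poly w x) ^ j)"
    by (intro O_inf_mult O_inf_inverse_power) simp
  have "O_inf (M + 0 + 1 * q ^ N) (\<lambda>x. 1 / x ^ M * (1 / poly w x) ^ j *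
     (poly (monom 1 (q ^ i) - w) x / x ^ (q ^ i)) ^ (q ^ N))"
    by (rule O_inf_mult[OF 2 1])
  hence "O_inf (M + q ^ N) (\<lambda>x. 1 / x ^ M * (1 / poly w x) ^ j *
     (poly (monom 1 (q ^ i) - w) x / x ^ (q ^ i)) ^ (q ^ N))" by simp
  thus ?thesis
  proof (rule O_inf_cong[of _ _ "real q + 1"])
    fix x :: 'c assume x: "absval x \<ge> real q + 1"
    hence x0: "x \<noteq> 0" by auto
    have "absval (poly w x) \<noteq> 0"
      unfolding w_def using x x0 absval_carlitz_poly[of x a] a0 by simp
    hence w0: "poly w x \<noteq> 0" by auto
    have "poly (monom 1 (q ^ i) - w) x / x ^ (q ^ i) = 1 - poly w x / x ^ (q ^ i)"
      using x0 by (simp add: poly_monom diff_divide_distrib)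
    hence "(poly (monom 1 (q ^ i) - w) x / x ^ (q ^ i)) ^ (q ^ N) = 1 - (poly w x / x ^ (q ^ i)) ^ (q ^ N)"
      by (simp add: diff_power_q')
    also have "\<dots> = 1 - poly w x ^ (q ^ N) / x ^ (q ^ (i + N))"
      by (simp add: power_divide power_add flip: power_mult)
    finally have eq: "(poly (monom 1 (q ^ i) - w) x / x ^ (q ^ i)) ^ (q ^ N) = 
        1 - poly w x ^ (q ^ N) / x ^ (q ^ (i + N))" .
    have "poly w x ^ (q ^ N) = poly w x ^ (q ^ N - j) * poly w x ^ j"
      using j by (simp flip: power_add)
    hence "1 / x ^ M * (1 / poly w x) ^ j * (poly w x ^ (q ^ N) / x ^ (q ^ (i + N))) =
        poly w x ^ (q ^ N - j) / x ^ (q ^ (i + N) + M)"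
      using w0 x0 by (simp add: power_divide power_add)
    thus "1 / x ^ M * (1 / poly w x) ^ j * (poly (monom 1 (q ^ i) - w) x / x ^ (q ^ i)) ^ (q ^ N) =
      1 / x ^ M * (1 / poly (carlitz_poly a) x ^ j) -
      poly (laurent_num N j a) x / x ^ (q ^ (degree a + N) + M)"
      unfolding eq right_diff_distrib
      by (simp add: w_def i_def laurent_num_def power_one_over)
  qed
qed

text \<open>Approximates \<open>x^-Q H(x)^j\<close> for \<open>Q = q^d\<close>. The number
  \<open>d + 1\<close> is both the cut-off for the degree of \<open>a\<close> and the Frobenius
  exponent of \<open>laurent_num\<close>; either choice leaves an error of order
  \<open>Q + q Q\<close>.\<close>

definition laurent_approx :: "nat \<Rightarrow> nat \<Rightarrow> 'c \<Rightarrow> 'c" where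
  "laurent_approx d j x = (\<Sum>a\<in>monic_below (d + 1). emb a ^ (q * j) *
     (poly (laurent_num (d + 1) j a) x / x ^ (q ^ (degree a + (d + 1)) + q ^ d)))"

lemma O_inf_h_series_power:
  assumes j: "1 \<le> j" "j < q"
  shows "O_inf (Suc (q ^ d * (j + 1))) (\<lambda>x. h_series x ^ (q ^ d + j) - laurent_approx d j x)"
proof -
  define Q where "Q = q ^ d"
  define H where "H x = (\<Sum>a\<in>monic_below (d + 1). emb a ^ q / poly (carlitz_poly a) x)" for x
  have Q1: "Q \<ge> 1" unfolding Q_def using q2 by simp
  have jQ: "(j + 1) * Q \<le> q * Q" using j by (intro mult_le_mono1) simp
  have tail: "O_inf (q * Q) (\<lambda>x. h_series x - H x)"
    using h_series_tail[of "d + 1"] by (simp add: H_def Q_def)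
  have h0: "O_inf 0 h_series" by (rule O_inf_mono[OF O_inf_h_series]) simp
  have "O_inf 0 (\<lambda>x. h_series x - (h_series x - H x))"
    by (intro O_inf_diff h0 O_inf_mono[OF tail]) simp
  hence H0: "O_inf 0 H" by simp
  \<comment> \<open>Raising to the power \<open>Q\<close> is additive, so the order \<open>q\<close>
    of \<open>h_series x - 1 / x\<close> is multiplied by \<open>Q\<close>.\<close>
  have 1: "O_inf (Suc (Q * (j + 1))) (\<lambda>x. h_series x ^ (Q + j) - 1 / x ^ Q * h_series x ^ j)"
  proof -
    have "O_inf (q * Q + 1 * j) (\<lambda>x. (h_series x - 1 / x) ^ Q * h_series x ^ j)"
      by (intro O_inf_mult O_inf_power O_inf_h_series_minus_inverse O_inf_h_series)
    moreover have "(h_series x - 1 / x) ^ Q * h_series x ^ j =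
        h_series x ^ (Q + j) - 1 / x ^ Q * h_series x ^ j" for x
      unfolding Q_def diff_power_q' by (simp add: power_add power_divide left_diff_distrib)
    ultimately have "O_inf (q * Q + j) (\<lambda>x. h_series x ^ (Q + j) - 1 / x ^ Q * h_series x ^ j)"
      by simp
    thus ?thesis by (rule O_inf_mono) (use jQ j in \<open>simp add: mult.commute\<close>)
  qed
  \<comment> \<open>The full series is cut off only here, after \<open>x^-Q\<close> has been split
    off: this factor supplies the orders beyond \<open>q Q\<close>.\<close>
  have 2: "O_inf (Suc (Q * (j + 1))) (\<lambda>x. 1 / x ^ Q * h_series x ^ j - 1 / x ^ Q * H x ^ j)"
  proof -
    have "O_inf (Q + q * Q) (\<lambda>x. 1 / x ^ Q * (h_series x ^ j - H x ^ j))"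
      by (intro O_inf_mult O_inf_inverse_power O_inf_power_diff tail h0 H0)
    hence "O_inf (Q + q * Q) (\<lambda>x. 1 / x ^ Q * h_series x ^ j - 1 / x ^ Q * H x ^ j)"
      by (simp only: right_diff_distrib)
    thus ?thesis by (rule O_inf_mono) (use jQ Q1 in \<open>simp add: mult.commute\<close>)
  qed
  have 3: "O_inf (Suc (Q * (j + 1))) (\<lambda>x. 1 / x ^ Q * H x ^ j - laurent_approx d j x)"
  proof -
    have "j \<le> q ^ (d + 1)"
      using j q2 by (metis Suc_eq_plus1 le_trans less_imp_le_nat power_Suc mult_le_mono2 one_le_power mult.right_neutral one_le_numeral)
    hence "O_inf (Q + q ^ (d + 1)) (\<lambda>x. 1 / x ^ Q * (1 / poly (carlitz_poly a) x ^ j) -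
       poly (laurent_num (d + 1) j a) x / x ^ (q ^ (degree a + (d + 1)) + Q))"
      if "a \<in> monic_below (d + 1)" for a
      using that by (intro O_inf_laurent_approx) (simp_all add: monic_below_def)
    hence "O_inf (Q + q ^ (d + 1)) (\<lambda>x. \<Sum>a\<in>monic_below (d + 1). emb a ^ (q * j) *
      (1 / x ^ Q * (1 / poly (carlitz_poly a) x ^ j) -
       poly (laurent_num (d + 1) j a) x / x ^ (q ^ (degree a + (d + 1)) + Q)))"
      by (intro O_inf_sum O_inf_cmult)
    hence "O_inf (Q + q ^ (d + 1)) (\<lambda>x. 1 / x ^ Q * H x ^ j - laurent_approx d j x)"
    proof (rule O_inf_cong[of _ _ "real q + 1"])
      fix x :: 'c assume "absval x \<ge> real q + 1"
      hence "H x ^ j = (\<Sum>a\<in>monic_below (d + 1). emb a ^ (q * j) / poly (carlitz_poly a) x ^ j)"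
        unfolding H_def using j by (intro h_series_below_power) auto
      thus "(\<Sum>a\<in>monic_below (d + 1). emb a ^ (q * j) *
          (1 / x ^ Q * (1 / poly (carlitz_poly a) x ^ j) -
           poly (laurent_num (d + 1) j a) x / x ^ (q ^ (degree a + (d + 1)) + Q))) =
        1 / x ^ Q * H x ^ j - laurent_approx d j x"
        unfolding laurent_approx_def
        by (simp only: right_diff_distrib sum_subtractf sum_distrib_left flip: Q_def)
           (simp add: mult_ac)
    qed
    thus ?thesis by (rule O_inf_mono) (use jQ Q1 in \<open>simp add: Q_def mult.commute\<close>)
  qed
  have "O_inf (Suc (Q * (j + 1))) (\<lambda>x. (h_series x ^ (Q + j) - 1 / x ^ Q * h_series x ^ j) +
      ((1 / x ^ Q * h_series x ^ j - 1 / x ^ Q * H x ^ j) + (1 / x ^ Q * H x ^ j - laurent_approx d j x)))"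
    by (intro O_inf_add 1 2 3)
  thus ?thesis by (simp add: Q_def)
qed

text \<open>
  The sum of \<open>laurent_approx\<close> over the roots of \<open>\<phi>_P(x) = y\<close>, divided by \<open>s = 1 / y\<close>, as a polynomial in \<open>s\<close>.
\<close>

definition trace_poly :: "'f poly \<Rightarrow> nat \<Rightarrow> 'c poly" where
  "trace_poly P j = (\<Sum>a\<in>monic_below (degree P + 1). 
     \<Sum>k<q ^ (degree a + (degree P + 1)) + q ^ degree P.
       monom (emb a ^ (q * j) * (emb P * coeff (laurent_num (degree P + 1) j a * carlitz_poly P ^ k)
         (q ^ (degree a + (degree P + 1)) + q ^ degree P - 1))) k)"

text \<open>The Cartier argument with \<open>L = \<phi>_P\<close> and \<open>W = \<phi>_a\<close>
  removes all \<open>a\<close> of positive degree. For \<open>a = 1\<close> it yields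
  \<open>j P^(j - 1)\<close>, and the derivative of \<open>\<phi>_P\<close> supplies one more factor
  \<open>P\<close>.\<close>

lemma coeff_trace_poly:
  assumes P: "lead_coeff P = 1" "degree P > 0" and j: "1 \<le> j" "j < q"
  shows "coeff (trace_poly P j) j = of_nat j * emb P ^ j"
proof -
  define d where "d = degree P"
  define N where "N = d + 1"
  define m where "m a = q ^ (degree a + N) + q ^ d" for a :: "'f poly"
  define C where "C a = coeff (carlitz_poly P ^ j * carlitz_poly a ^ (q ^ N - j)) (m a - 1)" for a
  have jm: "j < m a" for a
  proof -
    have "q ^ 1 \<le> q ^ (degree a + N)" unfolding N_def using q2 by (intro power_increasing) auto
    thus ?thesis using j by (simp add: m_def)
  qed
  have "coeff (trace_poly P j) j = (\<Sum>a\<in>monic_below N. emb a ^ (q * j) * (emb P * C a))"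
    unfolding trace_poly_def coeff_sum coeff_monom d_def[symmetric] N_def[symmetric] m_def[symmetric]
      C_def laurent_num_def
    using jm by (simp add: mult.commute[of "carlitz_poly P ^ j"])
  also have "\<dots> = emb 1 ^ (q * j) * (emb P * C 1) +
      (\<Sum>a\<in>monic_below N - {1}. emb a ^ (q * j) * (emb P * C a))"
    by (rule sum.remove[OF finite_monic_below]) (simp add: N_def monic_below_def)
  also have "(\<Sum>a\<in>monic_below N - {1}. emb a ^ (q * j) * (emb P * C a)) = 0"
  proof (rule sum.neutral, rule ballI)
    fix a :: "'f poly" assume a: "a \<in> monic_below N - {1}"
    \<comment> \<open>The only monic constant is 1, so here \<open>i = deg a \<ge> 1\<close> and the
      vanishing lemma applies.\<close>
    have "degree a \<noteq> 0"
    proof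
      assume "degree a = 0"
      then obtain c where "a = [:c:]" by (rule degree_eq_zeroE)
      thus False using a by (auto simp: monic_below_def one_pCons)
    qed
    hence "C a = 0"
      unfolding C_def m_def
      by (intro coeff_additive_power_eq_0 prime_q char_eq[symmetric] j)
         (use P in \<open>simp_all add: d_def N_def additive_carlitz_poly\<close>)
    thus "emb a ^ (q * j) * (emb P * C a) = 0" by simp
  qed
  also have "C 1 = of_nat j * emb P ^ (j - 1)"
  proof -
    have "C 1 = coeff (carlitz_poly P ^ j * monom 1 1 ^ (q ^ N - j)) (q ^ N + q ^ degree P - 1)"
      by (simp add: C_def m_def d_def carlitz_poly_1)
    also have "\<dots> = of_nat j * coeff (carlitz_poly P) 1 ^ (j - 1) * coeff (carlitz_poly P) (q ^ degree P)"
      by (intro coeff_additive_power_X prime_q char_eq[symmetric] additive_carlitz_poly j)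
         (use P in \<open>simp_all add: d_def N_def\<close>)
    finally show ?thesis
      unfolding coeff_carlitz_poly_top coeff_carlitz_poly_1 P emb1 by simp
  qed
  also have "emb 1 ^ (q * j) * (emb P * (of_nat j * emb P ^ (j - 1))) + 0 = of_nat j * emb P ^ j"
    using j by (cases j) (simp_all add: emb_A_1 mult_ac)
  finally show ?thesis .
qed

lemma sum_laurent_approx:
  assumes R: "finite R" "carlitz_poly P - [:y:] = (\<Prod>x\<in>R. [:-x, 1:])" and y: "y \<noteq> 0" and j: "1 \<le> j"
  shows "(\<Sum>x\<in>R. laurent_approx (degree P) j x) = poly (trace_poly P j) (1 / y) / y"
proof -
  define N where "N = degree P + 1"
  define m where "m a = q ^ (degree a + N) + q ^ degree P" for a :: "'f poly"
  have "(\<Sum>x\<in>R. laurent_approx (degree P) j x) =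
    (\<Sum>a\<in>monic_below N. emb a ^ (q * j) * (\<Sum>x\<in>R. poly (laurent_num N j a) x / x ^ m a))"
    unfolding laurent_approx_def N_def[symmetric] m_def[symmetric]
    by (subst sum.swap) (simp only: sum_distrib_left)
  also have "\<dots> = (\<Sum>a\<in>monic_below N. emb a ^ (q * j) *
      (\<Sum>k<m a. emb P * coeff (laurent_num N j a * carlitz_poly P ^ k) (m a - 1) / y ^ (k + 1)))"
  proof (intro sum.cong refl arg_cong2[where f = "(*)"])
    fix a :: "'f poly" assume "a \<in> monic_below N"
    hence a0: "a \<noteq> 0" by (auto simp: monic_below_def)
    have "degree (laurent_num N j a) \<le> q ^ degree a * (q ^ N - j)"
      unfolding laurent_num_def using degree_power_le[of "carlitz_poly a"] degree_carlitz_poly[OF a0] by simp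
    also have "\<dots> \<le> q ^ degree a * q ^ N" by simp
    also have "\<dots> < m a" using q2 by (simp add: m_def power_add)
    finally show "(\<Sum>x\<in>R. poly (laurent_num N j a) x / x ^ m a) =
       (\<Sum>k<m a. emb P * coeff (laurent_num N j a * carlitz_poly P ^ k) (m a - 1) / y ^ (k + 1))"
      using R y by (intro sum_laurent_roots) (simp_all add: pderiv_carlitz_poly)
  qed
  also have "\<dots> = poly (trace_poly P j) (1 / y) / y"
    unfolding trace_poly_def N_def[symmetric] m_def[symmetric]
    by (simp add: poly_sum poly_monom sum_distrib_left sum_divide_distrib power_one_over mult_ac)
  finally show ?thesis .
qed

lemma hecke_drinfeld_h_power:
  assumes P: "lead_coeff P = 1" "degree P > 0"
  shows "hecke \<iota> P k (\<lambda>z. drinfeld_h \<iota> \<pi> z ^ n) z =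
    emb P ^ k * h_series (poly (carlitz_poly P) (carlitz_exp z)) ^ n +
    (\<Sum>x\<in>(\<lambda>\<beta>. carlitz_exp ((z + emb \<beta>) / emb P)) ` {\<beta>. degree \<beta> < degree P}. h_series x ^ n)"
  unfolding hecke_def drinfeld_h_eq carlitz_exp_emb
  by (simp add: sum.reindex[OF carlitz_poly_roots(1)[OF P]])

text \<open>Solving the eigenvalue equation for the sum of the approximants writes it as a
  combination of \<open>H(y)^n\<close>, \<open>H(\<phi>_P(y))^n\<close> and the errors at the roots.
  Each of these is \<open>o(y^-(j + 1))\<close>, and the coefficient with index \<open>j\<close> of
  \<open>trace_poly\<close> belongs to \<open>y^-(j + 1)\<close>.\<close>

lemma h_power_not_eigen:
  assumes P: "lead_coeff P = 1" "degree P > 0" and j: "1 \<le> j" "j < q"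
    and eigen: "\<And>z. z \<in> Omega \<iota> \<Longrightarrow> hecke \<iota> P k (\<lambda>z. drinfeld_h \<iota> \<pi> z ^ (q ^ degree P + j)) z =
      c * drinfeld_h \<iota> \<pi> z ^ (q ^ degree P + j)"
  shows False
proof -
  define Q where "Q = q ^ degree P"
  define n where "n = Q + j"
  define err where "err x = h_series x ^ n - laurent_approx (degree P) j x" for x
  have P0: "P \<noteq> 0" using P by auto
  have Q2: "Q \<ge> 2"
    using q2 self_le_power[of q "degree P"] P by (simp add: Q_def)
  have err: "O_inf (Suc (Q * (j + 1))) err"
    using O_inf_h_series_power[OF j, of "degree P"] unfolding err_def n_def Q_def .
  \<comment> \<open>Here \<open>n = Q + j \<ge> j + 2\<close>, because
    \<open>Q \<ge> 2\<close>.\<close>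
  have h1: "O_inf (Suc (j + 1)) (\<lambda>y. c * h_series y ^ n)"
    by (intro O_inf_cmult O_inf_mono[OF O_inf_power[OF O_inf_h_series, of n]])
      (use Q2 in \<open>simp add: n_def\<close>)
  have "O_inf 1 (\<lambda>y. h_series (poly (carlitz_poly P) y))"
  proof -
    obtain C B where CB: "C \<ge> 0" "B \<ge> 1" "\<And>x. absval x \<ge> B \<Longrightarrow> absval (h_series x) * absval x ^ 1 \<le> C"
      using O_inf_h_series by (rule O_infE) (rule that)
    show ?thesis
    proof (rule O_infI[of "max B (real q + 1)" _ _ C])
      fix y :: 'c assume y: "absval y \<ge> max B (real q + 1)"
      have "absval y ^ 1 \<le> absval y ^ Q" using y CB(2) Q2 by (intro power_increasing) auto
      also have "\<dots> = absval (poly (carlitz_poly P) y)"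
        using y P0 absval_carlitz_poly[of y P] by (simp add: Q_def)
      finally have le: "absval y \<le> absval (poly (carlitz_poly P) y)" by simp
      have "absval (h_series (poly (carlitz_poly P) y)) * absval y \<le>
          absval (h_series (poly (carlitz_poly P) y)) * absval (poly (carlitz_poly P) y)"
        by (intro mult_left_mono le) simp
      also have "\<dots> \<le> C" using CB(3)[of "poly (carlitz_poly P) y"] le y by simp
      finally show "absval (h_series (poly (carlitz_poly P) y)) * absval y ^ 1 \<le> C" by simp
    qed
  qed
  from O_inf_power[OF this, of n]
  have h2: "O_inf (Suc (j + 1)) (\<lambda>y. emb P ^ k * h_series (poly (carlitz_poly P) y) ^ n)"
    by (intro O_inf_cmult) (rule O_inf_mono, assumption, use Q2 in \<open>simp add: n_def\<close>)
  have main: "\<exists>B. \<forall>z\<in>Omega \<iota>. absval (carlitz_exp z) \<ge> B \<longrightarrow>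
      absval (poly (trace_poly P j) (1 / carlitz_exp z) / carlitz_exp z) * absval (carlitz_exp z) ^ (j + 1) \<le> e"
    if e: "e > 0" for e
  proof -
    obtain B1 where B1: "B1 \<ge> 1" "\<And>x. absval x \<ge> B1 \<Longrightarrow> absval (err x) * absval x ^ (Q * (j + 1)) < e"
      using O_inf_small[OF err e] by blast
    obtain B2 where B2: "B2 \<ge> 1" "\<And>y. absval y \<ge> B2 \<Longrightarrow> absval (c * h_series y ^ n) * absval y ^ (j + 1) < e"
      using O_inf_small[OF h1 e] by blast
    obtain B3 where B3: "B3 \<ge> 1" "\<And>y. absval y \<ge> B3 \<Longrightarrow>
        absval (emb P ^ k * h_series (poly (carlitz_poly P) y) ^ n) * absval y ^ (j + 1) < e"
      using O_inf_small[OF h2 e] by blast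
    \<comment> \<open>\<open>\<phi>_P\<close> is bounded on bounded sets, so a large
      \<open>y\<close> forces all roots of \<open>\<phi>_P(x) = y\<close> to be large.\<close>
    obtain B4 where B4: "\<And>x. absval x \<le> max B1 (real q + 1) \<Longrightarrow> absval (poly (carlitz_poly P) x) \<le> B4"
      using absval_poly_bounded by blast
    show ?thesis
    proof (intro exI ballI impI)
      fix z assume z: "z \<in> Omega \<iota>" "absval (carlitz_exp z) \<ge> max (max B2 B3) (B4 + 1)"
      define y where "y = carlitz_exp z"
      define R where "R = (\<lambda>\<beta>. carlitz_exp ((z + emb \<beta>) / emb P)) ` {\<beta>. degree \<beta> < degree P}"
      have yB: "absval y \<ge> B2" "absval y \<ge> B3" "absval y > B4" using z(2) by (auto simp: y_def)
      have y0: "y \<noteq> 0" using yB(1) B2(1) by auto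
      have finR: "finite R" unfolding R_def by (intro finite_imageI finite_degree_less)
      have Rpoly: "carlitz_poly P - [:y:] = (\<Prod>x\<in>R. [:-x, 1:])"
        unfolding R_def y_def by (rule carlitz_poly_roots(3)[OF P])
      have root: "poly (carlitz_poly P) x = y" if "x \<in> R" for x
        using that carlitz_poly_roots(2)[OF P] by (auto simp: R_def y_def)
      have large: "absval x > max B1 (real q + 1)" if "x \<in> R" for x
        using B4[of x] root[OF that] yB(3) by force
      have errx: "absval (err x) * absval y ^ (j + 1) \<le> e" if "x \<in> R" for x
      proof -
        \<comment> \<open>This equality converts the order \<open>Q (j + 1)\<close> in the root
          \<open>x\<close> into the order \<open>j + 1\<close> in \<open>y\<close>.\<close>
        have "absval y = absval x ^ Q"
          using absval_carlitz_poly[of x P] large[OF that] P0 root[OF that] by (simp add: Q_def)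
        hence "absval y ^ (j + 1) = absval x ^ (Q * (j + 1))" by (simp only: power_mult)
        thus ?thesis using B1(2)[of x] large[OF that] by (simp only:) simp
      qed
      have "emb P ^ k * h_series (poly (carlitz_poly P) y) ^ n + (\<Sum>x\<in>R. h_series x ^ n) = c * h_series y ^ n"
        using eigen[OF z(1), unfolded hecke_drinfeld_h_power[OF P]]
        by (simp add: drinfeld_h_eq R_def y_def n_def Q_def)
      moreover have "(\<Sum>x\<in>R. h_series x ^ n) = (\<Sum>x\<in>R. err x) + poly (trace_poly P j) (1 / y) / y"
        by (simp add: err_def sum_subtractf sum_laurent_approx[OF finR Rpoly y0 j(1)])
      ultimately have "poly (trace_poly P j) (1 / y) / y = c * h_series y ^ n -
          (emb P ^ k * h_series (poly (carlitz_poly P) y) ^ n + (\<Sum>x\<in>R. err x))"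
        by (simp add: algebra_simps)
      hence "absval (poly (trace_poly P j) (1 / y) / y) * absval y ^ (j + 1) =
        absval (c * h_series y ^ n * y ^ (j + 1) -
          (emb P ^ k * h_series (poly (carlitz_poly P) y) ^ n * y ^ (j + 1) + (\<Sum>x\<in>R. err x * y ^ (j + 1))))"
        by (simp only: absval_power[symmetric] absval_mult[symmetric] left_diff_distrib distrib_right
            sum_distrib_right)
      also have "\<dots> \<le> e"
      proof (intro absval_diff_bound absval_add_bound absval_sum_bound)
        show "absval (c * h_series y ^ n * y ^ (j + 1)) \<le> e"
          using B2(2)[OF yB(1)] unfolding absval_mult[of _ "y ^ (j + 1)"] absval_power[of y] by simp
        show "absval (emb P ^ k * h_series (poly (carlitz_poly P) y) ^ n * y ^ (j + 1)) \<le> e"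
          using B3(2)[OF yB(2)] unfolding absval_mult[of _ "y ^ (j + 1)"] absval_power[of y] by simp
        show "absval (err x * y ^ (j + 1)) \<le> e" if "x \<in> R" for x
          using errx[OF that] unfolding absval_mult[of _ "y ^ (j + 1)"] absval_power[of y] by simp
      qed (use e in simp)
      finally show "absval (poly (trace_poly P j) (1 / carlitz_exp z) / carlitz_exp z) *
          absval (carlitz_exp z) ^ (j + 1) \<le> e" by (simp add: y_def)
    qed
  qed
  obtain Z where Z: "\<And>r. Z r \<in> Omega \<iota>" "\<And>r. absval (Z r) ^ 2 = real q ^ (2 * r + 1)"
    "\<And>r. absval (carlitz_exp (Z r)) \<ge> absval \<pi> * absval (Z r)"
    using exists_point by metis
  define Y where "Y r = absval (carlitz_exp (Z r))" for r
  have Y: "filterlim Y at_top sequentially"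
  proof (rule filterlim_at_top_mono)
    show "filterlim (\<lambda>r. absval \<pi> * real r) at_top sequentially"
      using period_nonzero by (intro filterlim_tendsto_pos_mult_at_top[OF tendsto_const] filterlim_real_sequentially) simp
    have "absval \<pi> * real r \<le> Y r" for r
    proof -
      have "r < q ^ r" using power_gt_expt[of q r] q2 by simp
      hence "real r < real (q ^ r)" by (simp only: of_nat_less_iff)
      hence "real r < real q ^ r" by (simp only: of_nat_power)
      hence "real r ^ 2 \<le> (real q ^ r) ^ 2" by (intro power_mono) auto
      also have "(real q ^ r) ^ 2 = real q ^ (2 * r)" by (simp only: mult.commute[of 2 r] power_mult)
      also have "\<dots> \<le> real q ^ (2 * r + 1)" using q2 by (intro power_increasing) auto
      also have "\<dots> = absval (Z r) ^ 2" by (rule Z(2)[symmetric])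
      finally have "real r \<le> absval (Z r)" by (rule power2_le_imp_le) simp
      hence "absval \<pi> * real r \<le> absval \<pi> * absval (Z r)" by (intro mult_left_mono) auto
      thus ?thesis using Z(3)[of r] by (simp add: Y_def)
    qed
    thus "eventually (\<lambda>r. absval \<pi> * real r \<le> Y r) sequentially" by simp
  qed
  have Ypos: "eventually (\<lambda>r. Y r > 0) sequentially"
    using Y by (simp add: filterlim_at_top_dense)
  have "coeff (trace_poly P j) j = 0"
  proof (rule coeff_eq_0_of_small_values)
    have "filterlim (\<lambda>r. inverse (Y r)) (at_right 0) sequentially"
      by (rule filterlim_compose[OF filterlim_inverse_at_right_top Y])
    thus "filterlim (\<lambda>r. absval (1 / carlitz_exp (Z r))) (at_right 0) sequentially"
      by (simp add: absval_divide Y_def inverse_eq_divide)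
    show "(\<lambda>r. absval (poly (trace_poly P j) (1 / carlitz_exp (Z r))) /
        absval (1 / carlitz_exp (Z r)) ^ j) \<longlonglongrightarrow> 0"
    proof (rule tendstoI)
      fix e :: real assume e: "e > 0"
      then obtain B where B: "\<And>z. z \<in> Omega \<iota> \<Longrightarrow> absval (carlitz_exp z) \<ge> B \<Longrightarrow>
          absval (poly (trace_poly P j) (1 / carlitz_exp z) / carlitz_exp z) *
            absval (carlitz_exp z) ^ (j + 1) \<le> e / 2"
        using main[of "e / 2"] by auto
      have "eventually (\<lambda>r. Y r \<ge> B) sequentially"
        using Y by (simp add: filterlim_at_top)
      with Ypos show "eventually (\<lambda>r. dist (absval (poly (trace_poly P j) (1 / carlitz_exp (Z r))) /
        absval (1 / carlitz_exp (Z r)) ^ j) 0 < e) sequentially"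
      proof eventually_elim
        case (elim r)
        define y where "y = carlitz_exp (Z r)"
        have y: "absval y > 0" using elim by (simp add: Y_def y_def)
        have "absval (poly (trace_poly P j) (1 / y)) / absval (1 / y) ^ j =
            absval (poly (trace_poly P j) (1 / y) / y) * absval y ^ (j + 1)"
          using y by (simp add: absval_divide power_divide)
        also have "\<dots> \<le> e / 2" using B[OF Z(1)] elim by (simp add: Y_def y_def)
        also have "\<dots> < e" using e by simp
        finally show ?case by (simp add: y_def)
      qed
    qed
  qed
  hence "of_nat j * emb P ^ j = 0" using coeff_trace_poly[OF P j] by simp
  moreover have "emb P ^ j \<noteq> 0" using P0 by (simp add: emb_A_eq_0_iff)
  moreover have "(of_nat j :: 'c) \<noteq> 0"
    using j by (auto simp: of_nat_eq_0_iff_char_dvd char_eq dest: dvd_imp_le)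
  ultimately show False by simp
qed

end

theorem theorem4p2:
  fixes \<iota> :: "'f::finite_field poly fract \<Rightarrow> 'c::complete_valued_field"
    and \<pi> :: 'c and P :: "'f poly" and q d j :: nat
  assumes "C_infinity \<iota>" and "carlitz_period \<iota> \<pi>"
    and "q = CARD('f)" and "prime q"
    and "d > 0" and "lead_coeff P = 1" and "irreducible P" and "degree P = d"
    and "P \<noteq> [:0, 1:]"
    and "j \<in> {1..q - 1}"
  shows "\<not> hecke_eigenform \<iota> \<pi> P ((q ^ d + j) * (q + 1)) (int (q ^ d + j))
            (\<lambda>z. drinfeld_h \<iota> \<pi> z ^ (q ^ d + j))"
proof
  interpret C_infinity \<iota> by fact
  interpret carlitz_uniformization \<iota> q \<pi>
    by unfold_locales fact+
  assume "hecke_eigenform \<iota> \<pi> P ((q ^ d + j) * (q + 1)) (int (q ^ d + j))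
            (\<lambda>z. drinfeld_h \<iota> \<pi> z ^ (q ^ d + j))"
  then obtain c where c: "\<And>z. z \<in> Omega \<iota> \<Longrightarrow>
      hecke \<iota> P ((q ^ d + j) * (q + 1)) (\<lambda>z. drinfeld_h \<iota> \<pi> z ^ (q ^ d + j)) z =
      c * drinfeld_h \<iota> \<pi> z ^ (q ^ d + j)"
    unfolding hecke_eigenform_def by blast
  show False
    by (rule h_power_not_eigen[of P j "(q ^ d + j) * (q + 1)" c])
      (use assms c in auto)
qed

end
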